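(* Let $m=0$ and let $n\in\mathbb{R}$ with $4\le n<6$. Let $\phi_0$ satisfy $$\|\phi_0-1\|_{H^1}<\infty,\qquad\Big\|\frac1{\phi_0}\Big\|_\infty<\infty .$$ Then there exists a global solution $\phi$, with $\phi-1\in C^1([0,\infty);H^1(\mathbb{R}))$, of $$\phi_t+(\phi^n)_z-(\phi^n\phi_{tz})_z=0$$ with $\phi(\cdot,0)=\phi_0$.
   Context: $H^k=W^{k,2}(\mathbb{R})$; functions are real valued. A solution with data $\phi_0$ is a function $\phi>0$ with $\phi-1\in C^1([0,\infty);H^1(\mathbb{R}))$ such that $$\phi(\cdot,t)=\phi_0+\int_0^t u(\cdot,s)\,ds,$$ where for each $s$, $u(\cdot,s)\in H^1(\mathbb{R})$ is the unique weak solution of $-(\phi(\cdot,s)^n u_z)_z+u=-(\phi(\cdot,s)^n)_z$. *)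

theory Defs
  imports "HOL-Analysis.Analysis" "HOL-Probability.Essential_Supremum"
begin

definition test_function :: "(real \<Rightarrow> real) \<Rightarrow> bool" where
  "test_function \<psi> \<longleftrightarrow>
     (\<forall>k x. (deriv ^^ k) \<psi> field_differentiable at x) \<and> compact (closure {x. \<psi> x \<noteq> 0})"

definition L2 :: "(real \<Rightarrow> real) set" where
  "L2 = {f \<in> borel_measurable lebesgue. integrable lebesgue (\<lambda>x. (f x)\<^sup>2)}"

(* For f and g in L2 both integrals exist, since test functions are bounded with compact support. *)
definition has_weak_deriv :: "(real \<Rightarrow> real) \<Rightarrow> (real \<Rightarrow> real) \<Rightarrow> bool" where
  "has_weak_deriv f g \<longleftrightarrow>
     (\<forall>\<psi>. test_function \<psi> \<longrightarrow>
        (\<integral>x. f x * deriv \<psi> x \<partial>lebesgue) = - (\<integral>x. g x * \<psi> x \<partial>lebesgue))"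

(* Elements of H1 are functions, not classes: membership, wderiv and H1_norm
   are insensitive to changes on null sets. *)
definition H1 :: "(real \<Rightarrow> real) set" where
  "H1 = {f \<in> L2. \<exists>g \<in> L2. has_weak_deriv f g}"

(* Determined up to a null set when f is in H1; arbitrary otherwise. *)
definition wderiv :: "(real \<Rightarrow> real) \<Rightarrow> real \<Rightarrow> real" where
  "wderiv f = (SOME g. g \<in> L2 \<and> has_weak_deriv f g)"

(* Meaningful only for f in H1. *)
definition H1_norm :: "(real \<Rightarrow> real) \<Rightarrow> real" where
  "H1_norm f = sqrt ((\<integral>x. (f x)\<^sup>2 \<partial>lebesgue) + (\<integral>x. (wderiv f x)\<^sup>2 \<partial>lebesgue))"

definition H1_continuous_on :: "real set \<Rightarrow> (real \<Rightarrow> real \<Rightarrow> real) \<Rightarrow> bool" where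
  "H1_continuous_on T f \<longleftrightarrow>
     (\<forall>t\<in>T. f t \<in> H1) \<and>
     (\<forall>t\<in>T. ((\<lambda>s. H1_norm (\<lambda>z. f s z - f t z)) \<longlongrightarrow> 0) (at t within T))"

(* On T = {0..} the derivative at 0 is one-sided. *)
definition C1_H1_on :: "real set \<Rightarrow> (real \<Rightarrow> real \<Rightarrow> real) \<Rightarrow> bool" where
  "C1_H1_on T f \<longleftrightarrow>
     (\<forall>t\<in>T. f t \<in> H1) \<and>
     (\<exists>f'. H1_continuous_on T f' \<and>
       (\<forall>t\<in>T. ((\<lambda>s. H1_norm (\<lambda>z. (f s z - f t z) / (s - t) - f' t z)) \<longlongrightarrow> 0)
                (at t within T)))"

(* The integral of an H1-valued function over [a,b]: the library's has_integral on
   intervals (see has_integral_cbox), with convergence taken in the H1 norm. *)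
definition has_H1_integral ::
    "(real \<Rightarrow> real \<Rightarrow> real) \<Rightarrow> (real \<Rightarrow> real) \<Rightarrow> real \<Rightarrow> real \<Rightarrow> bool" where
  "has_H1_integral u I a b \<longleftrightarrow>
     (\<forall>s\<in>{a..b}. u s \<in> H1) \<and> I \<in> H1 \<and>
     ((\<lambda>p. H1_norm (\<lambda>z. (\<Sum>(s,K)\<in>p. measure lborel K * u s z) - I z)) \<longlongrightarrow> 0)
       (division_filter (cbox a b))"

(* Weak form of - (\<phi>^n u_z)_z + u = - (\<phi>^n)_z for a fixed profile \<phi> > 0.  Both terms in
   divergence form are tested against compactly supported functions because \<phi>^n itself
   tends to 1 at infinity and is not square integrable. *)
definition weak_solution :: "real \<Rightarrow> (real \<Rightarrow> real) \<Rightarrow> (real \<Rightarrow> real) \<Rightarrow> bool" where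
  "weak_solution n \<phi> u \<longleftrightarrow>
     u \<in> H1 \<and>
     (\<forall>\<psi>. test_function \<psi> \<longrightarrow>
        (\<integral>z. \<phi> z powr n * wderiv u z * deriv \<psi> z \<partial>lebesgue) + (\<integral>z. u z * \<psi> z \<partial>lebesgue)
        = (\<integral>z. \<phi> z powr n * deriv \<psi> z \<partial>lebesgue))"

definition unique_weak_solution :: "real \<Rightarrow> (real \<Rightarrow> real) \<Rightarrow> (real \<Rightarrow> real) \<Rightarrow> bool" where
  "unique_weak_solution n \<phi> u \<longleftrightarrow>
     weak_solution n \<phi> u \<and> (\<forall>w. weak_solution n \<phi> w \<longrightarrow> (AE z in lebesgue. w z = u z))"

(* Global solution of \<phi>_t + (\<phi>^n)_z - (\<phi>^n \<phi>_tz)_z = 0 with data \<phi>0; the time variable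
   comes first.  The profile \<phi> t is the continuous representative of its class, so that
   positivity holds at every point. *)
definition global_solution ::
    "real \<Rightarrow> (real \<Rightarrow> real) \<Rightarrow> (real \<Rightarrow> real \<Rightarrow> real) \<Rightarrow> bool" where
  "global_solution n \<phi>0 \<phi> \<longleftrightarrow>
     (\<forall>t\<ge>0. continuous_on UNIV (\<phi> t) \<and> (\<forall>z. \<phi> t z > 0)) \<and>
     C1_H1_on {0..} (\<lambda>t z. \<phi> t z - 1) \<and>
     (\<exists>u. (\<forall>s\<ge>0. unique_weak_solution n (\<phi> s) (u s)) \<and>
          (\<forall>t\<ge>0. has_H1_integral u (\<lambda>z. \<phi> t z - \<phi>0 z) 0 t))"

end

theory Submission
  imports Defs
begin

text \<open>The flux potential \<open>p\<close> of the elliptic problem, \<open>\<phi>\<^sup>n (u_z - 1) = p - 1\<close>, satisfies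
  \<open>p' = u\<close>, and with \<open>b = \<phi> powr (- n)\<close> it solves the Schroedinger equation
  \<open>- p'' + b p = b - 1\<close>. If \<open>b\<close> is replaced by a Lipschitz function of \<open>\<phi>\<close> with positive upper
  and lower bounds, then \<open>\<phi> \<mapsto> u\<close> is globally Lipschitz on the Banach space of bounded
  continuous square integrable functions, so \<open>\<phi>_t = u\<close> has a global solution. It conserves the
  energy \<open>\<integral> \<phi>_z\<^sup>2 / 2 + V \<phi>\<close> with \<open>V'' = b\<close>, \<open>V 1 = V' 1 = 0\<close>. For \<open>n \<ge> 4\<close> the function
  \<open>\<integral> sqrt (2 V)\<close> diverges both at \<open>0\<close> and at \<open>\<infinity>\<close>, so by the Modica--Mortola inequality the energy
  confines \<open>\<phi>\<close> to a compact subinterval of the positive half line. A truncation outside that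
  interval is therefore never active.\<close>

section \<open>Square integrable functions\<close>

text \<open>The obstacle is a circularity: truncating the coefficient changes \<open>V\<close>, and
  with it the energy that has to justify the truncation. It is broken by two bounds free of the
  truncation levels. From above, the initial energy is estimated by the H1 norm and a lower bound of
  the data. From below, \<open>V\<close> dominates the fixed function \<open>(1 - 1/y)^2 / 8\<close>
  between the levels; the root of twice this function integrates to
  \<open>(y - 1 - ln y) / 2\<close> up to sign. So the levels can be chosen once the energy is
  known. The threshold 4 comes from the behaviour at 0: there \<open>V\<close> is of order
  \<open>y^(2 - n)\<close>, whose root is not integrable. The Lipschitz dependence comes from adding
  \<open>B p\<close> to both sides, with \<open>B\<close> an upper bound of the coefficient: the
  resolvent of the second derivative at \<open>B\<close> has norm at most \<open>1 / B\<close>,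
  while \<open>B - b\<close> is at most \<open>B - B1\<close>, which leaves a contraction. The phase
  space contains no space derivative, since that of the data is only square integrable. But
  \<open>u_z = b p + 1 - b\<close> lies in the phase space again, so the space derivative of a
  solution is that of the data plus a differentiable curve in the phase space.\<close>

definition sq_int :: "(real \<Rightarrow> real) \<Rightarrow> bool" where
  "sq_int f \<longleftrightarrow> f \<in> borel_measurable borel \<and> integrable lborel (\<lambda>x. (f x)\<^sup>2)"

definition l2 :: "(real \<Rightarrow> real) \<Rightarrow> real" where
  "l2 f = sqrt (LBINT x. (f x)\<^sup>2)"

lemma l2_nonneg [simp]: "l2 f \<ge> 0"
  by (simp add: l2_def)

lemma l2_sq: "(l2 f)\<^sup>2 = (LBINT x. (f x)\<^sup>2)"
  by (simp add: l2_def)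

lemma sq_int_measurable [measurable_dest]: "sq_int f \<Longrightarrow> f \<in> borel_measurable borel"
  by (simp add: sq_int_def)

lemma sq_int_integrable: "sq_int f \<Longrightarrow> integrable lborel (\<lambda>x. (f x)\<^sup>2)"
  by (simp add: sq_int_def)

lemma sq_int_bound:
  assumes "sq_int g" "f \<in> borel_measurable borel" "\<And>x. \<bar>f x\<bar> \<le> C * \<bar>g x\<bar>"
  shows "sq_int f"
proof -
  have "integrable lborel (\<lambda>x. C\<^sup>2 * (g x)\<^sup>2)"
    using assms(1) by (simp add: sq_int_integrable)
  moreover have "(f x)\<^sup>2 \<le> C\<^sup>2 * (g x)\<^sup>2" for x
    using power_mono[OF assms(3)[of x], of 2] by (simp add: power_mult_distrib)
  ultimately have "integrable lborel (\<lambda>x. (f x)\<^sup>2)"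
    by (intro Bochner_Integration.integrable_bound[of _ "\<lambda>x. C\<^sup>2 * (g x)\<^sup>2" "\<lambda>x. (f x)\<^sup>2"])
      (use assms(2) in auto)
  then show ?thesis using assms(2) by (simp add: sq_int_def)
qed

lemma l2_bound:
  assumes "sq_int g" "f \<in> borel_measurable borel" "\<And>x. \<bar>f x\<bar> \<le> C * \<bar>g x\<bar>" "C \<ge> 0"
  shows "l2 f \<le> C * l2 g"
proof -
  have "(LBINT x. (f x)\<^sup>2) \<le> (LBINT x. C\<^sup>2 * (g x)\<^sup>2)"
  proof (rule integral_mono)
    show "integrable lborel (\<lambda>x. (f x)\<^sup>2)"
      using sq_int_bound[OF assms(1-3)] by (simp add: sq_int_integrable)
    show "(f x)\<^sup>2 \<le> C\<^sup>2 * (g x)\<^sup>2" for x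
      using power_mono[OF assms(3)[of x], of 2] by (simp add: power_mult_distrib)
  qed (use assms(1) in \<open>simp add: sq_int_integrable\<close>)
  then have "(LBINT x. (f x)\<^sup>2) \<le> (C * l2 g)\<^sup>2"
    by (simp add: power_mult_distrib l2_sq)
  then show ?thesis
    using assms(4) by (simp add: l2_def real_le_lsqrt)
qed

lemma sq_int_mult:
  assumes "sq_int f" "sq_int g"
  shows "integrable lborel (\<lambda>x. f x * g x)"
proof (rule Bochner_Integration.integrable_bound)
  show "integrable lborel (\<lambda>x. (f x)\<^sup>2 + (g x)\<^sup>2)"
    using assms by (simp add: sq_int_integrable)
  show "(\<lambda>x. f x * g x) \<in> borel_measurable lborel"
    using assms by (auto simp: sq_int_def)
  have "\<bar>a * b\<bar> \<le> a\<^sup>2 + b\<^sup>2" for a b :: real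
  proof -
    have "0 \<le> (\<bar>a\<bar> - \<bar>b\<bar>)\<^sup>2" by simp
    then have "2 * (\<bar>a\<bar> * \<bar>b\<bar>) \<le> a\<^sup>2 + b\<^sup>2" by (simp add: power2_diff)
    moreover have "\<bar>a\<bar> * \<bar>b\<bar> \<ge> 0" by simp
    ultimately show ?thesis unfolding abs_mult by linarith
  qed
  then show "AE x in lborel. norm (f x * g x) \<le> norm ((f x)\<^sup>2 + (g x)\<^sup>2)" by simp
qed

lemma sq_int_add:
  assumes "sq_int f" "sq_int g"
  shows "sq_int (\<lambda>x. f x + g x)"
proof -
  have "integrable lborel (\<lambda>x. (f x)\<^sup>2 + (g x)\<^sup>2 + 2 * (f x * g x))"
    using assms sq_int_mult[OF assms] by (simp add: sq_int_integrable)
  then show ?thesis using assms by (auto simp: sq_int_def power2_sum mult.assoc)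
qed

lemma sq_int_scale: "sq_int f \<Longrightarrow> sq_int (\<lambda>x. c * f x)"
  by (auto simp: sq_int_def power_mult_distrib)

lemma sq_int_minus: "sq_int f \<Longrightarrow> sq_int (\<lambda>x. - f x)"
  by (auto simp: sq_int_def)

lemma sq_int_diff: "sq_int f \<Longrightarrow> sq_int g \<Longrightarrow> sq_int (\<lambda>x. f x - g x)"
  using sq_int_add[of f "\<lambda>x. - g x"] sq_int_minus by simp

lemma sq_int_0 [simp]: "sq_int (\<lambda>x. 0)"
  by (simp add: sq_int_def)

lemma l2_0 [simp]: "l2 (\<lambda>x. 0) = 0"
  by (simp add: l2_def)

lemma l2_scale: "l2 (\<lambda>x. c * f x) = \<bar>c\<bar> * l2 f"
  by (simp add: l2_def power_mult_distrib real_sqrt_mult)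

lemma l2_Cauchy_Schwarz:
  assumes "sq_int f" "sq_int g"
  shows "\<bar>LBINT x. f x * g x\<bar> \<le> l2 f * l2 g"
proof -
  define A where "A = (LBINT x. (f x)\<^sup>2)"
  define B where "B = (LBINT x. f x * g x)"
  define C where "C = (LBINT x. (g x)\<^sup>2)"
  have *: "0 \<le> A - 2 * t * B + t\<^sup>2 * C" for t
  proof -
    have "0 \<le> (LBINT x. (f x - t * g x)\<^sup>2)" by simp
    also have "(\<lambda>x. (f x - t * g x)\<^sup>2) = (\<lambda>x. (f x)\<^sup>2 - 2 * t * (f x * g x) + t\<^sup>2 * (g x)\<^sup>2)"
      by (simp add: power2_diff power_mult_distrib algebra_simps)
    also have "(LBINT x. (f x)\<^sup>2 - 2 * t * (f x * g x) + t\<^sup>2 * (g x)\<^sup>2) = A - 2 * t * B + t\<^sup>2 * C"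
      unfolding A_def B_def C_def
      using assms sq_int_mult[OF assms] by (simp add: sq_int_integrable)
    finally show ?thesis .
  qed
  have "C \<ge> 0" "A \<ge> 0" by (simp_all add: A_def C_def)
  have "B\<^sup>2 \<le> A * C"
  proof (cases "C = 0")
    case True
    have "B = 0"
    proof (rule ccontr)
      assume "B \<noteq> 0"
      \<comment> \<open>With \<open>C = 0\<close> the quadratic is affine in \<open>t\<close>, and
        this \<open>t\<close> gives it the value -1.\<close>
      then show False using *[of "(A + 1) / (2 * B)"] True by simp
    qed
    then show ?thesis using True by simp
  next
    case False
    then have "C > 0" using \<open>C \<ge> 0\<close> by simp
    have "0 \<le> A - B\<^sup>2 / C"
      using *[of "B / C"] False by (simp add: field_simps power2_eq_square)
    then show ?thesis using \<open>C > 0\<close> by (simp add: field_simps)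
  qed
  then have "sqrt (B\<^sup>2) \<le> sqrt (A * C)" by (rule real_sqrt_le_mono)
  then show ?thesis by (simp add: A_def B_def C_def l2_def real_sqrt_mult)
qed

lemma l2_triangle:
  assumes "sq_int f" "sq_int g"
  shows "l2 (\<lambda>x. f x + g x) \<le> l2 f + l2 g"
proof -
  have "(l2 (\<lambda>x. f x + g x))\<^sup>2 = (l2 f)\<^sup>2 + (l2 g)\<^sup>2 + 2 * (LBINT x. f x * g x)"
    using assms sq_int_mult[OF assms] by (simp add: l2_sq power2_sum mult.assoc sq_int_integrable)
  also have "\<dots> \<le> (l2 f)\<^sup>2 + (l2 g)\<^sup>2 + 2 * (l2 f * l2 g)"
    using l2_Cauchy_Schwarz[OF assms] by simp
  also have "\<dots> = (l2 f + l2 g)\<^sup>2" by (simp add: power2_sum)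
  finally show ?thesis by (rule power2_le_imp_le) simp
qed

text \<open>Square integrability of the limit is a conclusion here; completeness of
  \<open>cl2\<close> and the cut-off argument in \<open>decay_eq_sq_int\<close> obtain it this way.
  The bound is asked only from \<open>N\<close> on, to fit the tail of a Cauchy sequence.\<close>

lemma l2_Fatou:
  assumes f: "\<And>m. sq_int (f m)" and lim: "\<And>x. (\<lambda>m. f m x) \<longlonglongrightarrow> g x"
    and bd: "\<And>m. m \<ge> (N::nat) \<Longrightarrow> l2 (f m) \<le> C"
  shows "sq_int g" "l2 g \<le> C"
proof -
  have [measurable]: "\<And>m. f m \<in> borel_measurable borel" using f by (simp add: sq_int_def)
  have meas: "g \<in> borel_measurable borel"
    by (rule borel_measurable_LIMSEQ_real[where u = f]) (use f lim in \<open>auto simp: sq_int_def\<close>)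
  have C: "C \<ge> 0" using bd[of N] l2_nonneg[of "f N"] by linarith
  have "(\<integral>\<^sup>+x. ennreal ((g x)\<^sup>2) \<partial>lborel) = (\<integral>\<^sup>+x. liminf (\<lambda>m. ennreal ((f m x)\<^sup>2)) \<partial>lborel)"
  proof (rule nn_integral_cong)
    fix x
    have "(\<lambda>m. ennreal ((f m x)\<^sup>2)) \<longlonglongrightarrow> ennreal ((g x)\<^sup>2)"
      by (intro tendsto_intros lim)
    then show "ennreal ((g x)\<^sup>2) = liminf (\<lambda>m. ennreal ((f m x)\<^sup>2))"
      using lim_imp_Liminf[OF trivial_limit_sequentially, symmetric] by blast
  qed
  also have "\<dots> \<le> liminf (\<lambda>m. \<integral>\<^sup>+x. ennreal ((f m x)\<^sup>2) \<partial>lborel)"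
    by (rule nn_integral_liminf) simp
  also have "\<dots> \<le> ennreal (C\<^sup>2)"
  proof (rule Liminf_le)
    show "\<forall>\<^sub>F m in sequentially. (\<integral>\<^sup>+x. ennreal ((f m x)\<^sup>2) \<partial>lborel) \<le> ennreal (C\<^sup>2)"
    proof (rule eventually_sequentiallyI)
      fix m assume "m \<ge> N"
      have "(\<integral>\<^sup>+x. ennreal ((f m x)\<^sup>2) \<partial>lborel) = ennreal ((l2 (f m))\<^sup>2)"
        unfolding l2_sq by (rule nn_integral_eq_integral) (use f in \<open>auto simp: sq_int_def\<close>)
      then show "(\<integral>\<^sup>+x. ennreal ((f m x)\<^sup>2) \<partial>lborel) \<le> ennreal (C\<^sup>2)"
        using bd[OF \<open>m \<ge> N\<close>] by (simp add: ennreal_leI power_mono)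
    qed
  qed simp
  finally have le: "(\<integral>\<^sup>+x. ennreal ((g x)\<^sup>2) \<partial>lborel) \<le> ennreal (C\<^sup>2)" .
  have "integrable lborel (\<lambda>x. (g x)\<^sup>2)"
    by (rule integrableI_bounded) (use meas le in \<open>auto simp: ennreal_power intro: le_less_trans\<close>)
  then show "sq_int g" using meas by (simp add: sq_int_def)
  then have "ennreal (LBINT x. (g x)\<^sup>2) \<le> ennreal (C\<^sup>2)"
    using le by (subst (asm) nn_integral_eq_integral) (auto simp: sq_int_def)
  then have "(LBINT x. (g x)\<^sup>2) \<le> C\<^sup>2" by (simp add: ennreal_le_iff)
  then show "l2 g \<le> C" using C by (simp add: l2_def real_le_lsqrt)
qed

lemma l2_eq_0_continuous:
  assumes "sq_int f" "continuous_on UNIV f" "l2 f = 0"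
  shows "f x = 0"
proof -
  have "AE x in lborel. (f x)\<^sup>2 = 0"
    using assms by (subst integral_nonneg_eq_0_iff_AE[symmetric]) (auto simp: sq_int_def l2_def)
  then have "AE x in lborel. x \<in> {x. f x = 0}" by simp
  moreover have "closed {x. f x = 0}"
    using assms(2) by (intro closed_Collect_eq continuous_on_const) auto
  ultimately show ?thesis using mem_closed_if_AE_lebesgue[of "{x. f x = 0}" x]
    by (simp add: AE_completion)
qed

text \<open>The sup norm is part of the norm because the coefficient of the elliptic problem is a
  nonlinear function of the unknown: its Lipschitz dependence is needed in the uniform norm
  and in the square mean at the same time.\<close>

typedef cl2 = "{f :: real \<Rightarrow>\<^sub>C real. sq_int (apply_bcontfun f)}"
  morphisms bcf_of Abs_cl2
  by (rule exI[of _ 0]) simp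

setup_lifting type_definition_cl2

definition ap :: "cl2 \<Rightarrow> real \<Rightarrow> real" where
  "ap f = apply_bcontfun (bcf_of f)"

lemma cl2_eqI: "(\<And>x. ap f x = ap g x) \<Longrightarrow> f = g"
  unfolding ap_def by (metis bcontfun_eqI bcf_of_inject)

instantiation cl2 :: real_vector
begin

lift_definition uminus_cl2 :: "cl2 \<Rightarrow> cl2" is uminus
  by (simp add: sq_int_minus)
lift_definition plus_cl2 :: "cl2 \<Rightarrow> cl2 \<Rightarrow> cl2" is plus
  by (simp add: sq_int_add)
lift_definition minus_cl2 :: "cl2 \<Rightarrow> cl2 \<Rightarrow> cl2" is minus
  by (simp add: sq_int_diff)
lift_definition zero_cl2 :: cl2 is 0
  by simp
lift_definition scaleR_cl2 :: "real \<Rightarrow> cl2 \<Rightarrow> cl2" is scaleR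
  by (simp add: sq_int_scale)

instance
  by standard (transfer; simp add: algebra_simps)+

end

lemma ap_simps [simp]:
  "ap (f + g) x = ap f x + ap g x" "ap (f - g) x = ap f x - ap g x"
  "ap (- f) x = - ap f x" "ap 0 x = 0" "ap (c *\<^sub>R f) x = c * ap f x"
  by (simp_all add: ap_def plus_cl2.rep_eq minus_cl2.rep_eq uminus_cl2.rep_eq zero_cl2.rep_eq
      scaleR_cl2.rep_eq)

lemma sq_int_ap [simp, intro]: "sq_int (ap f)"
  using bcf_of[of f] by (simp add: ap_def)

lemma continuous_ap [simp, intro]: "continuous_on S (ap f)"
  by (simp add: ap_def)

lemma borel_measurable_ap [measurable, simp]: "ap f \<in> borel_measurable borel"
  using sq_int_ap sq_int_measurable by blast

instantiation cl2 :: real_normed_vector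
begin

definition norm_cl2 :: "cl2 \<Rightarrow> real" where
  "norm_cl2 f = norm (bcf_of f) + l2 (ap f)"
definition dist_cl2 :: "cl2 \<Rightarrow> cl2 \<Rightarrow> real" where
  "dist_cl2 f g = norm (f - g)"
definition sgn_cl2 :: "cl2 \<Rightarrow> cl2" where
  "sgn_cl2 f = f /\<^sub>R norm f"
definition uniformity_cl2 :: "(cl2 \<times> cl2) filter" where
  "uniformity_cl2 = (INF e\<in>{0<..}. principal {(x, y). dist x y < e})"
definition open_cl2 :: "cl2 set \<Rightarrow> bool" where
  "open_cl2 U = (\<forall>x\<in>U. \<forall>\<^sub>F (x', y) in uniformity. x' = x \<longrightarrow> y \<in> U)"

instance
proof
  fix f g :: cl2 and a :: real
  show "(norm f = 0) = (f = 0)"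
  proof
    assume "norm f = 0"
    then have "norm (bcf_of f) = 0"
      using l2_nonneg[of "ap f"] norm_ge_zero[of "bcf_of f"] unfolding norm_cl2_def by linarith
    then show "f = 0" by (intro cl2_eqI) (simp add: ap_def zero_cl2.rep_eq)
  qed (simp add: norm_cl2_def zero_cl2.rep_eq ap_def)
  have "ap (f + g) = (\<lambda>x. ap f x + ap g x)" by auto
  then have "l2 (ap (f + g)) \<le> l2 (ap f) + l2 (ap g)" using l2_triangle by simp
  then show "norm (f + g) \<le> norm f + norm g"
    using norm_triangle_ineq[of "bcf_of f" "bcf_of g"] by (simp add: norm_cl2_def plus_cl2.rep_eq)
  have "ap (a *\<^sub>R f) = (\<lambda>x. a * ap f x)" by auto
  then show "norm (a *\<^sub>R f) = \<bar>a\<bar> * norm f"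
    by (simp add: norm_cl2_def scaleR_cl2.rep_eq l2_scale distrib_left)
qed (simp_all add: dist_cl2_def sgn_cl2_def uniformity_cl2_def open_cl2_def)

end

lemma abs_ap_le: "\<bar>ap f x\<bar> \<le> norm f"
  using norm_bounded[of "bcf_of f" x] by (simp add: norm_cl2_def ap_def add_increasing2)

lemma l2_ap_le: "l2 (ap f) \<le> norm f"
  by (simp add: norm_cl2_def)

lemma ex_cl2:
  assumes "continuous_on UNIV f" "\<And>x. \<bar>f x\<bar> \<le> C" "sq_int f"
  shows "\<exists>F. ap F = f \<and> norm F \<le> C + l2 f"
proof -
  have f: "f \<in> bcontfun" by (rule bcontfun_normI) (use assms in auto)
  define G where "G = Bcontfun f"
  have G: "apply_bcontfun G = f" using f by (simp add: G_def Bcontfun_inverse)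
  have b: "bcf_of (Abs_cl2 G) = G" by (rule Abs_cl2_inverse) (use G assms in simp)
  have "norm G \<le> C" by (rule norm_bound) (use G assms in simp)
  then show ?thesis by (intro exI[of _ "Abs_cl2 G"]) (auto simp: ap_def norm_cl2_def b G)
qed

instance cl2 :: banach
proof
  fix X :: "nat \<Rightarrow> cl2"
  assume X: "Cauchy X"
  have "Cauchy (\<lambda>n. bcf_of (X n))"
  proof (rule metric_CauchyI)
    fix e :: real assume "e > 0"
    then obtain N where N: "\<And>m n. m \<ge> N \<Longrightarrow> n \<ge> N \<Longrightarrow> dist (X m) (X n) < e"
      using X unfolding Cauchy_def by blast
    have "dist (bcf_of (X m)) (bcf_of (X n)) \<le> dist (X m) (X n)" for m n
      by (simp add: dist_norm norm_cl2_def minus_cl2.rep_eq)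
    then show "\<exists>M. \<forall>m\<ge>M. \<forall>n\<ge>M. dist (bcf_of (X m)) (bcf_of (X n)) < e"
      using N le_less_trans by blast
  qed
  then obtain F where F: "(\<lambda>n. bcf_of (X n)) \<longlonglongrightarrow> F"
    using Cauchy_convergent_iff convergent_def by blast
  have pw: "(\<lambda>n. ap (X n) x) \<longlonglongrightarrow> apply_bcontfun F x" for x
    using tendsto_uniform_limitI[OF tendsto_bcontfun_uniform_limit[OF F]] by (simp add: ap_def)
  \<comment> \<open>The uniform limit is already the candidate. Letting \<open>m\<close> tend to
    infinity in the Cauchy estimate for \<open>X n - X m\<close> makes it the limit in the square
    mean as well, by \<open>l2_Fatou\<close>.\<close>
  have close: "\<exists>N. \<forall>n\<ge>N. sq_int (\<lambda>x. ap (X n) x - apply_bcontfun F x)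
      \<and> l2 (\<lambda>x. ap (X n) x - apply_bcontfun F x) \<le> e" if e: "e > 0" for e
  proof -
    obtain N where N: "\<And>m n. m \<ge> N \<Longrightarrow> n \<ge> N \<Longrightarrow> dist (X m) (X n) < e"
      using X e unfolding Cauchy_def by blast
    have "sq_int (\<lambda>x. ap (X n) x - apply_bcontfun F x)
        \<and> l2 (\<lambda>x. ap (X n) x - apply_bcontfun F x) \<le> e" if n: "n \<ge> N" for n
    proof -
      have 1: "\<And>m. sq_int (\<lambda>x. ap (X n) x - ap (X m) x)" by (rule sq_int_diff) auto
      have 2: "(\<lambda>m. ap (X n) x - ap (X m) x) \<longlonglongrightarrow> ap (X n) x - apply_bcontfun F x" for x
        by (intro tendsto_intros pw)
      have 3: "l2 (\<lambda>x. ap (X n) x - ap (X m) x) \<le> e" if "m \<ge> N" for m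
      proof -
        have "(\<lambda>x. ap (X n) x - ap (X m) x) = ap (X n - X m)" by auto
        then show ?thesis using l2_ap_le[of "X n - X m"] N[OF n that] by (simp add: dist_norm)
      qed
      show ?thesis using l2_Fatou[OF 1 2 3] by blast
    qed
    then show ?thesis by blast
  qed
  have "sq_int (apply_bcontfun F)"
  proof -
    obtain N where "sq_int (\<lambda>x. ap (X N) x - apply_bcontfun F x)" using close[of 1] by auto
    from sq_int_diff[OF sq_int_ap[of "X N"] this] show ?thesis by simp
  qed
  then have bF: "bcf_of (Abs_cl2 F) = F" by (simp add: Abs_cl2_inverse)
  have "X \<longlonglongrightarrow> Abs_cl2 F"
  proof (rule LIMSEQ_I)
    fix r :: real assume r: "r > 0"
    obtain N1 where N1: "\<And>n. n \<ge> N1 \<Longrightarrow> norm (bcf_of (X n) - F) < r / 2"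
      using LIMSEQ_D[OF F, of "r / 2"] r by auto
    obtain N2 where N2: "\<And>n. n \<ge> N2 \<Longrightarrow> l2 (\<lambda>x. ap (X n) x - apply_bcontfun F x) \<le> r / 2"
      using close[of "r / 2"] r by auto
    have "norm (X n - Abs_cl2 F) < r" if "n \<ge> max N1 N2" for n
    proof -
      have "ap (X n - Abs_cl2 F) = (\<lambda>x. ap (X n) x - apply_bcontfun F x)"
        by (auto simp: ap_def minus_cl2.rep_eq bF)
      then show ?thesis using N1[of n] N2[of n] that
        by (simp add: norm_cl2_def minus_cl2.rep_eq bF)
    qed
    then show "\<exists>no. \<forall>n\<ge>no. norm (X n - Abs_cl2 F) < r" by blast
  qed
  then show "convergent X" by (auto simp: convergent_def)
qed

section \<open>Absolutely continuous functions\<close>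

text \<open>The derivative \<open>g\<close> is carried along instead of being recovered by
  differentiating \<open>f\<close>; \<open>ac_unique\<close> determines it up to a null set.
  Lebesgue integrability on compact intervals allows the gauge integral on the right to be exchanged
  with the Lebesgue integral.\<close>

definition ac :: "(real \<Rightarrow> real) \<Rightarrow> (real \<Rightarrow> real) \<Rightarrow> bool" where
  "ac f g \<longleftrightarrow>
     (\<forall>a b. a \<le> b \<longrightarrow> set_integrable lborel {a..b} g \<and> f b - f a = integral {a..b} g)"

lemma acD: "ac f g \<Longrightarrow> a \<le> b \<Longrightarrow> set_integrable lborel {a..b} g"
  "ac f g \<Longrightarrow> a \<le> b \<Longrightarrow> f b - f a = integral {a..b} g"
  by (auto simp: ac_def)

lemma ac_integrable_on: "ac f g \<Longrightarrow> g integrable_on {a..b}"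
  by (cases "a \<le> b") (auto dest: acD(1) set_borel_integral_eq_integral(1))

lemma ac_C1:
  assumes "\<And>x. (f has_real_derivative g x) (at x)" "continuous_on UNIV g"
  shows "ac f g"
  unfolding ac_def
proof (intro allI impI conjI)
  fix a b :: real assume ab: "a \<le> b"
  have g: "continuous_on {a..b} g" using assms(2) continuous_on_subset by blast
  then show "set_integrable lborel {a..b} g" by (rule borel_integrable_atLeastAtMost')
  have "(g has_integral (f b - f a)) {a..b}"
    using ab assms(1) by (intro fundamental_theorem_of_calculus)
      (auto simp: has_real_derivative_iff_has_vector_derivative[symmetric] intro: DERIV_subset)
  then show "f b - f a = integral {a..b} g" by (simp add: integral_unique)
qed

lemma ac_continuous:
  assumes "ac f g"
  shows "continuous_on UNIV f"
proof -
  have "isCont f x" for x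
  proof -
    have "continuous_on {x - 1..x + 1} (\<lambda>y. f (x - 1) + integral {x - 1..y} g)"
      by (intro continuous_intros indefinite_integral_continuous_1 ac_integrable_on[OF assms])
    moreover have "f (x - 1) + integral {x - 1..y} g = f y" if "y \<in> {x - 1..x + 1}" for y
      using acD(2)[OF assms, of "x - 1" y] that by simp
    ultimately have "continuous_on {x - 1..x + 1} f" by (rule continuous_on_eq)
    then show ?thesis by (rule continuous_on_interior) simp
  qed
  then show ?thesis by (simp add: continuous_at_imp_continuous_on)
qed

lemma ac_add:
  assumes "ac f1 g1" "ac f2 g2"
  shows "ac (\<lambda>x. f1 x + f2 x) (\<lambda>x. g1 x + g2 x)"
  unfolding ac_def
proof (intro allI impI conjI)
  fix a b :: real assume ab: "a \<le> b"
  show "set_integrable lborel {a..b} (\<lambda>x. g1 x + g2 x)"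
    using assms ab by (intro set_integral_add) (auto dest: acD)
  have "integral {a..b} (\<lambda>x. g1 x + g2 x) = integral {a..b} g1 + integral {a..b} g2"
    using assms by (intro integral_add) (auto dest: ac_integrable_on)
  then show "f1 b + f2 b - (f1 a + f2 a) = integral {a..b} (\<lambda>x. g1 x + g2 x)"
    using assms ab by (simp add: acD(2)[symmetric])
qed

lemma ac_scale:
  assumes "ac f g"
  shows "ac (\<lambda>x. c * f x) (\<lambda>x. c * g x)"
  unfolding ac_def
proof (intro allI impI conjI)
  fix a b :: real assume ab: "a \<le> b"
  show "set_integrable lborel {a..b} (\<lambda>x. c * g x)"
    using assms ab by (auto dest: acD)
  show "c * f b - c * f a = integral {a..b} (\<lambda>x. c * g x)"
    using assms ab by (simp add: acD(2)[symmetric] right_diff_distrib)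
qed

lemma ac_const: "ac (\<lambda>x. c) (\<lambda>x. 0)"
  by (rule ac_C1) auto

lemma ac_diff:
  assumes "ac f1 g1" "ac f2 g2"
  shows "ac (\<lambda>x. f1 x - f2 x) (\<lambda>x. g1 x - g2 x)"
  using ac_add[OF assms(1) ac_scale[OF assms(2), of "-1"]] by simp

lemma set_integrable_continuous_mult:
  fixes h g :: "real \<Rightarrow> real"
  assumes h: "continuous_on UNIV h" and g: "set_integrable lborel {a..b} g"
  shows "set_integrable lborel {a..b} (\<lambda>x. h x * g x)"
proof -
  have "bounded (h ` {a..b})"
    using h by (intro compact_imp_bounded compact_continuous_image) (auto intro: continuous_on_subset)
  then obtain C where C: "\<And>x. x \<in> {a..b} \<Longrightarrow> \<bar>h x\<bar> \<le> C"
    unfolding bounded_iff by force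
  have gm: "(\<lambda>x. indicator {a..b} x * g x) \<in> borel_measurable lborel"
    using g by (auto simp: set_integrable_def dest: borel_measurable_integrable)
  have hm: "h \<in> borel_measurable lborel" using h by (simp add: borel_measurable_continuous_onI)
  have "integrable lborel (\<lambda>x. h x * (indicator {a..b} x * g x))"
  proof (rule Bochner_Integration.integrable_bound)
    show "integrable lborel (\<lambda>x. C * (indicator {a..b} x * g x))"
      using g by (auto simp: set_integrable_def)
    show "(\<lambda>x. h x * (indicator {a..b} x * g x)) \<in> borel_measurable lborel"
      by (rule borel_measurable_times[OF hm gm])
    have "\<bar>h x * (indicator {a..b} x * g x)\<bar> \<le> \<bar>C * (indicator {a..b} x * g x)\<bar>" for x
    proof (cases "x \<in> {a..b}")
      case True
      have "\<bar>h x\<bar> \<le> \<bar>C\<bar>" using C[OF True] by simp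
      then show ?thesis unfolding abs_mult by (intro mult_right_mono) auto
    qed simp
    then show "AE x in lborel. norm (h x * (indicator {a..b} x * g x))
        \<le> norm (C * (indicator {a..b} x * g x))" by simp
  qed
  then show ?thesis by (simp add: set_integrable_def mult.left_commute)
qed

lemma DERIV_mean_value_between:
  fixes H :: "real \<Rightarrow> real"
  assumes "\<And>y. (H has_real_derivative H' y) (at y)"
  shows "\<exists>\<xi>. min u v \<le> \<xi> \<and> \<xi> \<le> max u v \<and> H v - H u = H' \<xi> * (v - u)"
proof (cases u v rule: linorder_cases)
  case less
  then obtain z where "u < z" "z < v" "H v - H u = (v - u) * H' z"
    using MVT2[of u v H H'] assms by blast
  then show ?thesis by (intro exI[of _ z]) auto
next
  case equal
  then show ?thesis by (intro exI[of _ u]) auto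
next
  case greater
  then obtain z where "v < z" "z < u" "H u - H v = (u - v) * H' z"
    using MVT2[of v u H H'] assms by blast
  then show ?thesis by (intro exI[of _ z]) (auto simp: algebra_simps)
qed

lemma DERIV_mean_value:
  fixes H :: "real \<Rightarrow> real"
  assumes "\<And>y. (H has_real_derivative H' y) (at y)"
  shows "\<exists>\<xi>. \<bar>\<xi> - u\<bar> \<le> \<bar>v - u\<bar> \<and> H v - H u = H' \<xi> * (v - u)"
proof -
  obtain \<xi> where \<xi>: "min u v \<le> \<xi>" "\<xi> \<le> max u v" "H v - H u = H' \<xi> * (v - u)"
    using DERIV_mean_value_between[of H H' u v] assms by blast
  then have "\<bar>\<xi> - u\<bar> \<le> \<bar>v - u\<bar>" by (cases "u \<le> v") auto
  with \<xi>(3) show ?thesis by blast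
qed

text \<open>On a short interval the defect of the chain rule is at most \<open>\<epsilon>\<close> times the
  integral of \<open>\<bar>g\<bar>\<close>, a bound that adds up over adjacent intervals; no
  differentiability almost everywhere is needed.\<close>

lemma ac_chain:
  assumes f: "ac f g" and H: "\<And>y. (H has_real_derivative H' y) (at y)"
    and H': "continuous_on UNIV H'"
  shows "ac (\<lambda>x. H (f x)) (\<lambda>x. H' (f x) * g x)"
  unfolding ac_def
proof (intro allI impI conjI)
  fix a b :: real assume ab: "a \<le> b"
  have cf: "continuous_on UNIV f" by (rule ac_continuous[OF f])
  have cH: "continuous_on UNIV (\<lambda>x. H' (f x))"
    using continuous_on_compose2[OF H' cf] by simp
  have int: "set_integrable lborel {x..y} (\<lambda>x. H' (f x) * g x)" for x y
  proof (cases "x \<le> y")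
    case True
    then show ?thesis by (intro set_integrable_continuous_mult[OF cH] acD(1)[OF f])
  qed (simp add: set_integrable_def)
  then show "set_integrable lborel {a..b} (\<lambda>x. H' (f x) * g x)" .
  have int': "(\<lambda>x. H' (f x) * g x) integrable_on {x..y}" for x y
    using int set_borel_integral_eq_integral(1) by blast
  have inta: "(\<lambda>x. \<bar>g x\<bar>) integrable_on {x..y}" for x y
  proof (cases "x \<le> y")
    case True
    then show ?thesis
      using set_integrable_abs[OF acD(1)[OF f True]] set_borel_integral_eq_integral(1) by blast
  qed auto
  have intg: "g integrable_on {x..y}" for x y by (rule ac_integrable_on[OF f])
  have intc: "(\<lambda>s. c * g s) integrable_on {x..y}" for c x y
    using integrable_cmul[OF intg, of c] by simp
  define D where "D x y = H (f y) - H (f x) - integral {x..y} (\<lambda>x. H' (f x) * g x)" for x y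
  have key: "\<bar>D a b\<bar> \<le> e * integral {a..b} (\<lambda>x. \<bar>g x\<bar>)" if e: "e > 0" for e
  proof -
    define P where "P x y \<longleftrightarrow> (x \<le> y \<longrightarrow> \<bar>D x y\<bar> \<le> e * integral {x..y} (\<lambda>x. \<bar>g x\<bar>))" for x y
    have "P a b" using ab
    proof (induction rule: Bolzano)
      case (trans x y z)
      have "integral {x..y} (\<lambda>x. \<bar>g x\<bar>) + integral {y..z} (\<lambda>x. \<bar>g x\<bar>) = integral {x..z} (\<lambda>x. \<bar>g x\<bar>)"
        using trans(3,4) inta by (rule Henstock_Kurzweil_Integration.integral_combine)
      moreover have "integral {x..y} (\<lambda>x. H' (f x) * g x) + integral {y..z} (\<lambda>x. H' (f x) * g x)
          = integral {x..z} (\<lambda>x. H' (f x) * g x)"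
        using trans(3,4) int' by (rule Henstock_Kurzweil_Integration.integral_combine)
      ultimately have "D x z = D x y + D y z"
        "e * integral {x..z} (\<lambda>x. \<bar>g x\<bar>)
          = e * integral {x..y} (\<lambda>x. \<bar>g x\<bar>) + e * integral {y..z} (\<lambda>x. \<bar>g x\<bar>)"
        by (simp_all add: D_def flip: distrib_left)
      then show ?case using trans by (auto simp: P_def)
    next
      case (local x)
      have "isCont H' (f x)" using H' by (simp add: continuous_on_eq_continuous_at)
      then obtain r where r: "r > 0" "\<And>u. \<bar>u - f x\<bar> < r \<Longrightarrow> \<bar>H' u - H' (f x)\<bar> < e / 2"
        using e unfolding continuous_at_eps_delta dist_real_def by (meson half_gt_zero)
      have "isCont f x" using cf by (simp add: continuous_on_eq_continuous_at)
      \<comment> \<open>A third, because \<open>\<xi>\<close> is within \<open>2 r / 3\<close> of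
        \<open>f y\<close>, which is itself within \<open>r / 3\<close> of
        \<open>f x\<close>.\<close>
      then obtain d where d: "d > 0" "\<And>s. \<bar>s - x\<bar> < d \<Longrightarrow> \<bar>f s - f x\<bar> < r / 3"
        using r(1) unfolding continuous_at_eps_delta dist_real_def
        by (metis divide_pos_pos zero_less_numeral)
      have "P y z" if yz: "y \<le> x" "x \<le> z" "z - y < d" for y z
      proof -
        have near: "\<bar>f s - f x\<bar> < r / 3" if "s \<in> {y..z}" for s
          using that yz by (intro d(2)) auto
        have "y \<le> z" using yz by simp
        \<comment> \<open>A single frozen slope \<open>H' \<xi>\<close> represents the whole
          increment, so the defect becomes the integral of
          \<open>(H' \<xi> - H' (f s)) * g s\<close>, whose first factor is small.\<close>
        obtain \<xi> where \<xi>: "\<bar>\<xi> - f y\<bar> \<le> \<bar>f z - f y\<bar>" "H (f z) - H (f y) = H' \<xi> * (f z - f y)"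
          using DERIV_mean_value[of H H' "f y" "f z"] H by blast
        have "\<bar>\<xi> - f x\<bar> < r"
        proof -
          have "\<bar>f y - f x\<bar> < r / 3" "\<bar>f z - f x\<bar> < r / 3" using near \<open>y \<le> z\<close> by auto
          then show ?thesis using \<xi>(1) by linarith
        qed
        then have \<xi>': "\<bar>H' \<xi> - H' (f x)\<bar> < e / 2" by (rule r(2))
        have "D y z = integral {y..z} (\<lambda>s. H' \<xi> * g s) - integral {y..z} (\<lambda>s. H' (f s) * g s)"
          using \<xi>(2) acD(2)[OF f \<open>y \<le> z\<close>] by (simp add: D_def)
        also have "\<dots> = integral {y..z} (\<lambda>s. H' \<xi> * g s - H' (f s) * g s)"
          using intc int' by (intro Henstock_Kurzweil_Integration.integral_diff[symmetric])
        finally have D: "D y z = integral {y..z} (\<lambda>s. H' \<xi> * g s - H' (f s) * g s)" .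
        have "norm (integral {y..z} (\<lambda>s. H' \<xi> * g s - H' (f s) * g s))
            \<le> integral {y..z} (\<lambda>s. e * \<bar>g s\<bar>)"
        proof (rule integral_norm_bound_integral)
          show "(\<lambda>s. H' \<xi> * g s - H' (f s) * g s) integrable_on {y..z}"
            using intc int' by (intro integrable_diff)
          show "(\<lambda>s. e * \<bar>g s\<bar>) integrable_on {y..z}"
            using integrable_cmul[OF inta, of e] by simp
          fix s assume "s \<in> {y..z}"
          then have "\<bar>f s - f x\<bar> < r" using near[of s] r(1) by auto
          then have "\<bar>H' (f s) - H' (f x)\<bar> < e / 2" by (rule r(2))
          then have "\<bar>H' \<xi> - H' (f s)\<bar> \<le> e" using \<xi>' by linarith
          then have "\<bar>H' \<xi> - H' (f s)\<bar> * \<bar>g s\<bar> \<le> e * \<bar>g s\<bar>" by (rule mult_right_mono) simp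
          then show "norm (H' \<xi> * g s - H' (f s) * g s) \<le> e * \<bar>g s\<bar>"
            by (simp add: abs_mult flip: left_diff_distrib)
        qed
        then show ?thesis using D by (simp add: P_def)
      qed
      then show ?case using d(1) by blast
    qed
    then show ?thesis using ab by (simp add: P_def)
  qed
  have "D a b = 0"
  proof (rule ccontr)
    assume ne: "D a b \<noteq> 0"
    define I where "I = integral {a..b} (\<lambda>x. \<bar>g x\<bar>)"
    have "I \<ge> 0" unfolding I_def by (rule Henstock_Kurzweil_Integration.integral_nonneg[OF inta]) simp
    \<comment> \<open>This tolerance makes the right side at most half of the left; the summand 1
      covers \<open>I = 0\<close>.\<close>
    have "\<bar>D a b\<bar> \<le> \<bar>D a b\<bar> / (2 * (I + 1)) * I"
      using ne \<open>I \<ge> 0\<close> unfolding I_def by (intro key) (simp add: I_def[symmetric])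
    then have "I * \<bar>D a b\<bar> + 2 * \<bar>D a b\<bar> \<le> 0" using \<open>I \<ge> 0\<close> by (simp add: field_simps)
    moreover have "I * \<bar>D a b\<bar> \<ge> 0" using \<open>I \<ge> 0\<close> by simp
    ultimately show False using ne by linarith
  qed
  then show "H (f b) - H (f a) = integral {a..b} (\<lambda>x. H' (f x) * g x)" by (simp add: D_def)
qed

text \<open>Polarisation reduces the product rule to the chain rule for squares.\<close>

lemma ac_mult:
  assumes f: "ac f1 g1" "ac f2 g2"
  shows "ac (\<lambda>x. f1 x * f2 x) (\<lambda>x. g1 x * f2 x + f1 x * g2 x)"
proof -
  have sq: "ac (\<lambda>x. (f x)\<^sup>2) (\<lambda>x. 2 * f x * g x)" if "ac f g" for f g
    by (rule ac_chain[OF that, of "\<lambda>y. y\<^sup>2" "\<lambda>y. 2 * y"])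
      (auto intro!: derivative_eq_intros continuous_intros)
  have "ac (\<lambda>x. (1/2) * ((f1 x + f2 x)\<^sup>2 - (f1 x)\<^sup>2 - (f2 x)\<^sup>2))
     (\<lambda>x. (1/2) * (2 * (f1 x + f2 x) * (g1 x + g2 x) - 2 * f1 x * g1 x - 2 * f2 x * g2 x))"
    by (intro ac_scale ac_diff sq ac_add f)
  moreover have "(\<lambda>x. (1/2) * ((f1 x + f2 x)\<^sup>2 - (f1 x)\<^sup>2 - (f2 x)\<^sup>2)) = (\<lambda>x. f1 x * f2 x)"
    by (simp add: power2_sum)
  moreover have "(\<lambda>x. (1/2) * (2 * (f1 x + f2 x) * (g1 x + g2 x) - 2 * f1 x * g1 x - 2 * f2 x * g2 x))
      = (\<lambda>x. g1 x * f2 x + f1 x * g2 x)"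
    by (simp add: algebra_simps)
  ultimately show ?thesis by simp
qed

text \<open>A square integrable function need not tend to zero, but by Chebyshev it is small
  somewhere in every interval of one fixed length. This replaces decay at infinity
  throughout.\<close>

lemma sq_int_small_at:
  assumes f: "sq_int f" and e: "e > 0"
  shows "\<exists>N::nat. \<forall>a. \<exists>x\<in>{a..a + real N}. \<bar>f x\<bar> < e"
proof (rule ccontr)
  assume "\<not> ?thesis"
  then have *: "\<exists>a. \<forall>x\<in>{a..a + real N}. \<bar>f x\<bar> \<ge> e" for N :: nat by (meson not_le)
  have "real N * e\<^sup>2 \<le> (LBINT x. (f x)\<^sup>2)" for N :: nat
  proof -
    obtain a where a: "\<And>x. x \<in> {a..a + real N} \<Longrightarrow> \<bar>f x\<bar> \<ge> e" using * by blast
    have "(LBINT x. indicator {a..a + real N} x * e\<^sup>2) \<le> (LBINT x. (f x)\<^sup>2)"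
    proof (rule integral_mono)
      show "integrable lborel (\<lambda>x. (f x)\<^sup>2)" using f by (rule sq_int_integrable)
      have "e\<^sup>2 \<le> (f x)\<^sup>2" if "x \<in> {a..a + real N}" for x
        using power_mono[OF a[OF that], of 2] e by simp
      then show "indicator {a..a + real N} x * e\<^sup>2 \<le> (f x)\<^sup>2" for x
        by (cases "x \<in> {a..a + real N}") auto
      show "integrable lborel (\<lambda>x. indicator {a..a + real N} x * e\<^sup>2)" by simp
    qed
    then show ?thesis by simp
  qed
  then have "real N \<le> (LBINT x. (f x)\<^sup>2) / e\<^sup>2" for N :: nat
    using e by (simp add: field_simps)
  then show False by (meson not_le reals_Archimedean2)
qed

text \<open>Every integration by parts on the whole line goes through this statement:
  \<open>f\<close> is the boundary term, and it is evaluated only at points far out where it is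
  small.\<close>

lemma ac_integral_eq_0:
  assumes f: "ac f j" and j: "integrable lborel j" and sq: "sq_int f"
  shows "(LBINT x. j x) = 0"
proof (rule ccontr)
  assume ne: "(LBINT x. j x) \<noteq> 0"
  define d where "d = \<bar>LBINT x. j x\<bar>"
  have d: "d > 0" using ne by (simp add: d_def)
  \<comment> \<open>The end points are free beyond \<open>- n\<close> and \<open>n\<close>, so that
    they can be placed where \<open>f\<close> is small.\<close>
  have lim: "(\<lambda>n. LBINT x. indicator {u n..v n} x * j x) \<longlonglongrightarrow> (LBINT x. j x)"
    if u: "\<And>n. u n \<le> - real n" and v: "\<And>n. real n \<le> v n" for u v :: "nat \<Rightarrow> real"
  proof (rule integral_dominated_convergence)
    show "j \<in> borel_measurable lborel" using j by auto
    then show "(\<lambda>x. indicator {u n..v n} x * j x) \<in> borel_measurable lborel" for n by measurable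
    show "integrable lborel (\<lambda>x. norm (j x))" using j by auto
    show "AE x in lborel. norm (indicator {u n..v n} x * j x) \<le> norm (j x)" for n
      by (auto simp: indicator_def)
    show "AE x in lborel. (\<lambda>n. indicator {u n..v n} x * j x) \<longlonglongrightarrow> j x"
    proof (intro AE_I2 tendsto_eventually)
      fix x :: real
      obtain N :: nat where N: "\<bar>x\<bar> \<le> real N" using real_arch_simple by blast
      show "\<forall>\<^sub>F n in sequentially. indicator {u n..v n} x * j x = j x"
      proof (rule eventually_sequentiallyI[of N])
        fix n assume "n \<ge> N"
        then have "x \<in> {u n..v n}" using N u[of n] v[of n] by auto
        then show "indicator {u n..v n} x * j x = j x" by simp
      qed
    qed
  qed
  obtain N :: nat where N: "\<And>a. \<exists>x\<in>{a..a + real N}. \<bar>f x\<bar> < d / 4"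
    using sq_int_small_at[OF sq, of "d / 4"] d by auto
  have "\<forall>n::nat. \<exists>x\<in>{real n..real n + real N}. \<bar>f x\<bar> < d / 4" using N by blast
  then obtain v where v: "\<And>n::nat. v n \<in> {real n..real n + real N}" "\<And>n. \<bar>f (v n)\<bar> < d / 4"
    by metis
  have "\<forall>n::nat. \<exists>x\<in>{(- real n - real N)..(- real n - real N) + real N}. \<bar>f x\<bar> < d / 4"
    using N by blast
  then obtain u where u: "\<And>n::nat. u n \<in> {(- real n - real N)..(- real n - real N) + real N}"
    "\<And>n. \<bar>f (u n)\<bar> < d / 4" by metis
  have "(\<lambda>n. LBINT x. indicator {u n..v n} x * j x) \<longlonglongrightarrow> (LBINT x. j x)"
    using u(1) v(1) by (intro lim) auto
  moreover have "(LBINT x. indicator {u n..v n} x * j x) = f (v n) - f (u n)" for n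
  proof -
    have "u n \<le> v n" using u(1)[of n] v(1)[of n] by auto
    then show ?thesis
      using set_borel_integral_eq_integral(2)[OF acD(1)[OF f]] acD(2)[OF f]
      by (simp add: set_lebesgue_integral_def)
  qed
  ultimately have L: "(\<lambda>n. f (v n) - f (u n)) \<longlonglongrightarrow> (LBINT x. j x)" by simp
  have "\<bar>f (v n) - f (u n)\<bar> \<le> d / 2" for n using u(2)[of n] v(2)[of n] by linarith
  then have "d \<le> d / 2"
    unfolding d_def by (intro Lim_bounded[OF tendsto_rabs[OF L]]) auto
  then show False using d by simp
qed

lemma ex_antiderivative:
  fixes f :: "real \<Rightarrow> real"
  assumes "continuous_on UNIV f"
  shows "\<exists>F. F c = 0 \<and> (\<forall>x. (F has_real_derivative f x) (at x))"
proof -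
  have "\<exists>F. \<forall>x::real. (-\<infinity>::ereal) < ereal x \<longrightarrow> ereal x < \<infinity> \<longrightarrow> (F has_vector_derivative f x) (at x)"
    using assms by (intro einterval_antiderivative) (auto simp: continuous_on_eq_continuous_at)
  then obtain F where F: "\<And>x::real. (F has_real_derivative f x) (at x)"
    by (auto simp: has_real_derivative_iff_has_vector_derivative)
  then show ?thesis
    by (intro exI[of _ "\<lambda>x. F x - F c"]) (auto intro!: derivative_eq_intros)
qed

section \<open>The resolvent of the second derivative on the line\<close>

abbreviation supn :: "cl2 \<Rightarrow> real" where
  "supn f \<equiv> norm (bcf_of f)"

lemma abs_ap_le_supn: "\<bar>ap f x\<bar> \<le> supn f"
  using norm_bounded[of "bcf_of f" x] by (simp add: ap_def)

lemma supn_le: "(\<And>x. \<bar>ap f x\<bar> \<le> C) \<Longrightarrow> supn f \<le> C"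
  by (rule norm_bound) (simp add: ap_def)

text \<open>The difference of two solutions is a multiple of \<open>exp (- k x)\<close>, which is
  unbounded near minus infinity unless the multiple is zero.\<close>

lemma decay_eq_unique:
  assumes g: "\<And>x. (ap g has_real_derivative h x - k * ap g x) (at x)"
    and g': "\<And>x. (ap g' has_real_derivative h x - k * ap g' x) (at x)" and k: "k > 0"
  shows "g = g'"
proof (rule cl2_eqI)
  fix x
  define d where "d y = ap g y - ap g' y" for y
  have dd: "((\<lambda>y. exp (k * y) * d y) has_real_derivative 0) (at y)" for y
    unfolding d_def by (rule derivative_eq_intros g g' refl | simp add: algebra_simps)+
  have const: "exp (k * y) * d y = exp (k * x) * d x" for y
    using DERIV_const_ratio_const[of y x "\<lambda>y. exp (k * y) * d y" 0] dd
    by (cases "y = x") auto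
  have "((\<lambda>y. exp (k * y) * d y) \<longlongrightarrow> 0) at_bot"
  proof (rule Lim_null_comparison)
    have "\<bar>d y\<bar> \<le> norm g + norm g'" for y
      using abs_ap_le[of g y] abs_ap_le[of g' y] by (simp add: d_def)
    then have "norm (exp (k * y) * d y) \<le> exp (k * y) * (norm g + norm g')" for y
      by (simp add: abs_mult)
    then show "\<forall>\<^sub>F y in at_bot. norm (exp (k * y) * d y) \<le> exp (k * y) * (norm g + norm g')"
      by simp
    have "filterlim (\<lambda>y. k * y) at_bot at_bot"
      using k by (simp add: filterlim_tendsto_pos_mult_at_bot[OF tendsto_const] filterlim_ident)
    then have "((\<lambda>y. exp (k * y)) \<longlongrightarrow> 0) at_bot"
      by (rule filterlim_compose[OF exp_at_bot])
    then show "((\<lambda>y. exp (k * y) * (norm g + norm g')) \<longlongrightarrow> 0) at_bot"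
      by (rule tendsto_mult_left_zero)
  qed
  then have "((\<lambda>y::real. exp (k * x) * d x) \<longlongrightarrow> 0) at_bot"
    using ext[of "\<lambda>y. exp (k * y) * d y" "\<lambda>y. exp (k * x) * d x", OF const] by metis
  then have "exp (k * x) * d x = 0"
    using tendsto_const_iff trivial_limit_at_bot_linorder by blast
  then show "ap g x = ap g' x" by (simp add: d_def)
qed

text \<open>The solution is \<open>exp (- k x)\<close> times the integral of
  \<open>exp (k y) * h y\<close> from minus infinity. Convergence of this improper integral comes
  from monotonicity: for a primitive \<open>G\<close> of the integrand and a primitive
  \<open>E\<close> of its majorant, both \<open>E + G\<close> and \<open>E - G\<close> are
  nondecreasing.\<close>

lemma decay_eq_bounded_ex:
  fixes h :: "real \<Rightarrow> real"
  assumes h: "continuous_on UNIV h" and C: "\<And>x. \<bar>h x\<bar> \<le> C" and k: "k > 0"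
  shows "\<exists>g. (\<forall>x. (g has_real_derivative h x - k * g x) (at x)) \<and> (\<forall>x. \<bar>g x\<bar> \<le> C / k)"
proof -
  have "continuous_on UNIV (\<lambda>y. exp (k * y) * h y)" by (intro continuous_intros h)
  then obtain G where G: "\<And>x. (G has_real_derivative exp (k * x) * h x) (at x)"
    using ex_antiderivative by blast
  define E where "E x = C / k * exp (k * x)" for x
  have E: "(E has_real_derivative C * exp (k * x)) (at x)" for x
    unfolding E_def using k by (auto intro!: derivative_eq_intros)
  have p: "E x + G x \<le> E y + G y" if "x \<le> y" for x y
  proof (rule DERIV_nonneg_imp_nondecreasing[OF that])
    fix z
    have "C * exp (k * z) + exp (k * z) * h z = exp (k * z) * (C + h z)" by (simp add: algebra_simps)
    also have "\<dots> \<ge> 0" using C[of z] by (intro mult_nonneg_nonneg) auto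
    finally show "\<exists>w. ((\<lambda>a. E a + G a) has_real_derivative w) (at z) \<and> 0 \<le> w"
      using DERIV_add[OF E G] by blast
  qed
  have m: "E x - G x \<le> E y - G y" if "x \<le> y" for x y
  proof (rule DERIV_nonneg_imp_nondecreasing[OF that])
    fix z
    have "C * exp (k * z) - exp (k * z) * h z = exp (k * z) * (C - h z)" by (simp add: algebra_simps)
    also have "\<dots> \<ge> 0" using C[of z] by (intro mult_nonneg_nonneg) auto
    finally show "\<exists>w. ((\<lambda>a. E a - G a) has_real_derivative w) (at z) \<and> 0 \<le> w"
      using DERIV_diff[OF E G] by blast
  qed
  have C0: "C \<ge> 0" using C[of 0] by linarith
  have E0: "E x \<ge> 0" for x using C0 k by (simp add: E_def)
  \<comment> \<open>\<open>s\<close> decreases because \<open>E + G\<close> is nondecreasing, and it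
    is bounded below because \<open>E - G\<close> is nondecreasing; so \<open>G\<close> has a limit
    \<open>L\<close> along \<open>- n\<close>.\<close>
  define s where "s n = E (- real n) + G (- real n)" for n
  have "decseq s" unfolding s_def decseq_def using p by simp
  moreover have "s n \<ge> G 0 - E 0" for n
    using m[of "- real n" 0] E0[of "- real n"] by (simp add: s_def)
  ultimately obtain L where L: "s \<longlonglongrightarrow> L" using decseq_convergent by blast
  have "filterlim (\<lambda>n. - real n) at_bot sequentially"
    using filterlim_real_sequentially by (simp add: filterlim_uminus_at_top)
  then have "filterlim (\<lambda>n. k * - real n) at_bot sequentially"
    using k filterlim_tendsto_pos_mult_at_bot[OF tendsto_const] by blast
  then have "(\<lambda>n. exp (k * - real n)) \<longlonglongrightarrow> 0" by (rule filterlim_compose[OF exp_at_bot])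
  then have "(\<lambda>n. C / k * exp (k * - real n)) \<longlonglongrightarrow> 0" by (rule tendsto_mult_right_zero)
  then have En: "(\<lambda>n. E (- real n)) \<longlonglongrightarrow> 0" by (simp add: E_def)
  have GL: "(\<lambda>n. G (- real n)) \<longlonglongrightarrow> L"
    using tendsto_diff[OF L En] by (simp add: s_def)
  have bd: "\<bar>G x - L\<bar> \<le> E x" for x
  proof -
    have lim: "(\<lambda>n. \<bar>G x - G (- real n)\<bar>) \<longlonglongrightarrow> \<bar>G x - L\<bar>"
      by (intro tendsto_intros GL)
    obtain N :: nat where N: "- x \<le> real N" using real_arch_simple by blast
    have "\<bar>G x - G (- real n)\<bar> \<le> E x" if "n \<ge> N" for n
    proof -
      have "- real n \<le> x" using that N by linarith
      from p[OF this] m[OF this] E0[of "- real n"] show ?thesis by linarith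
    qed
    then show ?thesis by (intro Lim_bounded[OF lim]) auto
  qed
  \<comment> \<open>Subtracting \<open>L\<close> selects the one solution that stays bounded at
    minus infinity.\<close>
  define g where "g x = exp (- (k * x)) * (G x - L)" for x
  have "(g has_real_derivative h x - k * g x) (at x)" for x
    unfolding g_def by (rule derivative_eq_intros G refl | simp add: algebra_simps exp_minus)+
  moreover have "\<bar>g x\<bar> \<le> C / k" for x
  proof -
    have "\<bar>g x\<bar> \<le> exp (- (k * x)) * E x" unfolding g_def abs_mult using bd[of x] by simp
    also have "\<dots> = C / k" by (simp add: E_def exp_minus)
    finally show ?thesis .
  qed
  ultimately show ?thesis by blast
qed

text \<open>Multiplying the equation by \<open>g\<close> gives
  \<open>(g^2 / 2)' = h g - k g^2\<close>. On bounded intervals the sup bound controls the boundary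
  terms, which yields square integrability with a crude constant. Only then can the identity be
  integrated over the whole line, where the boundary terms vanish and the constant becomes
  \<open>1 / k\<close>.\<close>

lemma decay_eq_sq_int:
  fixes h g :: "real \<Rightarrow> real"
  assumes g: "\<And>x. (g has_real_derivative h x - k * g x) (at x)" and h: "continuous_on UNIV h"
    and C: "\<And>x. \<bar>g x\<bar> \<le> C" and hsq: "sq_int h" and k: "k > 0"
  shows "sq_int g" "l2 g \<le> l2 h / k"
proof -
  have cg: "continuous_on UNIV g"
    using g by (meson DERIV_isCont continuous_at_imp_continuous_on)
  have gm [measurable]: "g \<in> borel_measurable borel" using cg by (rule borel_measurable_continuous_onI)
  have hm [measurable]: "h \<in> borel_measurable borel" using hsq by (simp add: sq_int_def)
  have ac: "ac (\<lambda>x. (1/2) * (g x)\<^sup>2) (\<lambda>x. h x * g x - k * (g x)\<^sup>2)"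
  proof (rule ac_C1)
    fix x
    have "((\<lambda>x. (1/2) * (g x)\<^sup>2) has_real_derivative (1/2) * (2 * (g x * (h x - k * g x)))) (at x)"
      by (intro DERIV_cmult) (auto intro!: derivative_eq_intros g)
    moreover have "(1/2) * (2 * (g x * (h x - k * g x))) = h x * g x - k * (g x)\<^sup>2"
      by (simp add: power2_eq_square right_diff_distrib)
    ultimately show "((\<lambda>x. (1/2) * (g x)\<^sup>2) has_real_derivative h x * g x - k * (g x)\<^sup>2) (at x)"
      by simp
  qed (intro continuous_intros cg h)
  have k': "2 * k \<noteq> 0" "k \<noteq> 0" using k by auto
  \<comment> \<open>From Young's inequality \<open>h g - k g^2 \<le> h^2 / (2 k) - k g^2 / 2\<close>
    and a boundary loss of at most \<open>C^2 / 2\<close>, multiplied by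
    \<open>2 / k\<close>.\<close>
  define M where "M = (LBINT x. (h x)\<^sup>2) / k\<^sup>2 + C\<^sup>2 / k"
  define f where "f m x = indicator {- real m..real m} x * g x" for m x
  have int: "integrable lborel (\<lambda>x. indicator {- real m..real m} x * u x)"
    if "continuous_on UNIV u" for u :: "real \<Rightarrow> real" and m
    using borel_integrable_atLeastAtMost'[of "- real m" "real m" u] that
    by (auto simp: set_integrable_def intro: continuous_on_subset)
  have f2: "(f m x)\<^sup>2 = indicator {- real m..real m} x * (g x)\<^sup>2" for m x
    by (auto simp: f_def indicator_def)
  have fs: "sq_int (f m)" for m
  proof -
    have "(\<lambda>x. f m x) \<in> borel_measurable borel" unfolding f_def by measurable
    moreover have "integrable lborel (\<lambda>x. indicator {- real m..real m} x * (g x)\<^sup>2)"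
      by (intro int continuous_intros cg)
    ultimately show ?thesis by (simp add: sq_int_def f2)
  qed
  have fl: "l2 (f m) \<le> sqrt M" for m
  proof -
    define I where "I u = (LBINT x. indicator {- real m..real m} x * u x)" for u :: "real \<Rightarrow> real"
    have "I (\<lambda>x. h x * g x - k * (g x)\<^sup>2) = (1/2) * (g (real m))\<^sup>2 - (1/2) * (g (- real m))\<^sup>2"
      using set_borel_integral_eq_integral(2)[OF acD(1)[OF ac]] acD(2)[OF ac]
      by (simp add: I_def set_lebesgue_integral_def)
    also have "\<dots> \<ge> - (1/2) * C\<^sup>2"
    proof -
      have "(g (- real m))\<^sup>2 \<le> C\<^sup>2" using power_mono[OF C[of "- real m"], of 2] by simp
      moreover have "(g (real m))\<^sup>2 \<ge> 0" by simp
      ultimately show ?thesis by linarith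
    qed
    finally have 1: "I (\<lambda>x. h x * g x - k * (g x)\<^sup>2) \<ge> - (1/2) * C\<^sup>2" .
    have "I (\<lambda>x. h x * g x - k * (g x)\<^sup>2) \<le> I (\<lambda>x. (1 / (2 * k)) * (h x)\<^sup>2 - (k / 2) * (g x)\<^sup>2)"
      unfolding I_def
    proof (intro integral_mono int)
      show "continuous_on UNIV (\<lambda>x. h x * g x - k * (g x)\<^sup>2)"
        "continuous_on UNIV (\<lambda>x. (1 / (2 * k)) * (h x)\<^sup>2 - (k / 2) * (g x)\<^sup>2)"
        using k by (auto intro!: continuous_intros h cg)
      have "h x * g x - k * (g x)\<^sup>2 \<le> (1 / (2 * k)) * (h x)\<^sup>2 - (k / 2) * (g x)\<^sup>2" for x
      proof -
        have "0 \<le> (h x - k * g x)\<^sup>2 / (2 * k)" using k by simp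
        also have "\<dots> = (1 / (2 * k)) * (h x)\<^sup>2 + (k / 2) * (g x)\<^sup>2 - h x * g x"
          using k by (simp add: power2_diff field_simps power2_eq_square)
        finally show ?thesis by simp
      qed
      then show "indicator {- real m..real m} x * (h x * g x - k * (g x)\<^sup>2)
          \<le> indicator {- real m..real m} x * ((1 / (2 * k)) * (h x)\<^sup>2 - (k / 2) * (g x)\<^sup>2)" for x
        by (auto simp: indicator_def)
    qed
    also have "\<dots> = I (\<lambda>x. (1 / (2 * k)) * (h x)\<^sup>2) - I (\<lambda>x. (k / 2) * (g x)\<^sup>2)"
      unfolding I_def right_diff_distrib
      using k' by (intro Bochner_Integration.integral_diff int) (auto intro!: continuous_intros h cg)
    also have "I (\<lambda>x. (1 / (2 * k)) * (h x)\<^sup>2) \<le> (LBINT x. (1 / (2 * k)) * (h x)\<^sup>2)"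
      unfolding I_def using k hsq
      by (intro integral_mono int)
         (auto simp: indicator_def sq_int_def k' intro!: continuous_intros h)
    also have "I (\<lambda>x. (k / 2) * (g x)\<^sup>2) = (k / 2) * (l2 (f m))\<^sup>2"
    proof -
      have "(\<lambda>x. indicator {- real m..real m} x * ((k / 2) * (g x)\<^sup>2))
          = (\<lambda>x. (k / 2) * (indicator {- real m..real m} x * (g x)\<^sup>2))"
        by (auto simp: indicator_def)
      then show ?thesis unfolding I_def l2_sq f2 by (simp only: integral_mult_right_zero)
    qed
    finally have "(k / 2) * (l2 (f m))\<^sup>2 \<le> (1 / (2 * k)) * (LBINT x. (h x)\<^sup>2) + (1/2) * C\<^sup>2"
      using 1 by simp
    then have "(2 / k) * ((k / 2) * (l2 (f m))\<^sup>2)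
        \<le> (2 / k) * ((1 / (2 * k)) * (LBINT x. (h x)\<^sup>2) + (1/2) * C\<^sup>2)"
      using k by (intro mult_left_mono) auto
    moreover have "(2 / k) * ((k / 2) * (l2 (f m))\<^sup>2) = (l2 (f m))\<^sup>2" using k by simp
    moreover have "(2 / k) * ((1 / (2 * k)) * (LBINT x. (h x)\<^sup>2) + (1/2) * C\<^sup>2) = M"
      by (simp add: M_def distrib_left power2_eq_square)
    ultimately have "(l2 (f m))\<^sup>2 \<le> M" by (simp only:)
    then show ?thesis by (simp add: real_le_rsqrt)
  qed
  have flim: "(\<lambda>m. f m x) \<longlonglongrightarrow> g x" for x
  proof (rule tendsto_eventually)
    obtain N :: nat where N: "\<bar>x\<bar> \<le> real N" using real_arch_simple by blast
    show "\<forall>\<^sub>F m in sequentially. f m x = g x"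
    proof (rule eventually_sequentiallyI[of N])
      fix m assume "N \<le> m"
      then have "x \<in> {- real m..real m}" using N by auto
      then show "f m x = g x" by (simp add: f_def)
    qed
  qed
  show sq: "sq_int g" by (rule l2_Fatou[OF fs flim fl])
  have "(LBINT x. h x * g x - k * (g x)\<^sup>2) = 0"
  proof (rule ac_integral_eq_0[OF ac])
    show "integrable lborel (\<lambda>x. h x * g x - k * (g x)\<^sup>2)"
      using sq_int_mult[OF hsq sq] sq_int_integrable[OF sq] by simp
    have "\<bar>1/2 * (g x)\<^sup>2\<bar> \<le> C / 2 * \<bar>g x\<bar>" for x
      using mult_right_mono[OF C[of x], of "\<bar>g x\<bar>"] by (simp add: power2_eq_square abs_mult)
    then show "sq_int (\<lambda>x. 1/2 * (g x)\<^sup>2)"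
      by (intro sq_int_bound[OF sq, where C = "C / 2"]) auto
  qed
  then have "k * (l2 g)\<^sup>2 = (LBINT x. h x * g x)"
    using sq_int_mult[OF hsq sq] sq_int_integrable[OF sq] by (simp add: l2_sq)
  also have "\<dots> \<le> l2 h * l2 g" using l2_Cauchy_Schwarz[OF hsq sq] by simp
  finally have "(k * l2 g) * l2 g \<le> l2 h * l2 g" by (simp add: power2_eq_square mult.assoc)
  then have "k * l2 g \<le> l2 h"
    using l2_nonneg[of g] l2_nonneg[of h] by (cases "l2 g = 0") (auto simp: mult_le_cancel_right)
  then show "l2 g \<le> l2 h / k" using k by (simp add: field_simps)
qed

text \<open>The inverse of \<open>d/dx + k\<close>, that is, convolution with
  \<open>exp (- k x)\<close> restricted to the positive half line.\<close>

definition decay :: "real \<Rightarrow> cl2 \<Rightarrow> cl2" where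
  "decay k h = (THE g. \<forall>x. (ap g has_real_derivative ap h x - k * ap g x) (at x))"

lemma decay:
  assumes k: "k > 0"
  shows decay_deriv: "(ap (decay k h) has_real_derivative ap h x - k * ap (decay k h) x) (at x)"
    and decay_supn: "supn (decay k h) \<le> supn h / k"
    and decay_l2: "l2 (ap (decay k h)) \<le> l2 (ap h) / k"
proof -
  obtain g where g: "\<And>x. (g has_real_derivative ap h x - k * g x) (at x)"
    "\<And>x. \<bar>g x\<bar> \<le> supn h / k"
    using decay_eq_bounded_ex[OF continuous_ap abs_ap_le_supn k] by blast
  have "sq_int g" "l2 g \<le> l2 (ap h) / k"
    using decay_eq_sq_int[OF g(1) continuous_ap g(2) sq_int_ap k] .
  moreover have "continuous_on UNIV g"
    using g(1) by (meson DERIV_isCont continuous_at_imp_continuous_on)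
  ultimately obtain G where G: "ap G = g" using ex_cl2 g(2) by blast
  have "decay k h = G"
    unfolding decay_def
  proof (rule the_equality)
    show G': "\<forall>x. (ap G has_real_derivative ap h x - k * ap G x) (at x)"
      using g(1) by (simp add: G)
    fix g' assume "\<forall>x. (ap g' has_real_derivative ap h x - k * ap g' x) (at x)"
    then show "g' = G"
      using G' by (intro decay_eq_unique[of g' "ap h" k G]) (simp_all add: k)
  qed
  with G g(1) \<open>l2 g \<le> l2 (ap h) / k\<close>
  show "(ap (decay k h) has_real_derivative ap h x - k * ap (decay k h) x) (at x)"
    "l2 (ap (decay k h)) \<le> l2 (ap h) / k" by simp_all
  show "supn (decay k h) \<le> supn h / k"
    by (rule supn_le) (use g(2) G \<open>decay k h = G\<close> in simp)
qed

lemma decay_diff: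
  assumes k: "k > 0"
  shows "decay k (f - g) = decay k f - decay k g"
proof -
  have 1: "(ap (decay k (f - g)) has_real_derivative ap (f - g) x - k * ap (decay k (f - g)) x) (at x)"
    for x by (rule decay_deriv[OF k])
  have D: "((\<lambda>x. ap (decay k f) x - ap (decay k g) x) has_real_derivative
      (ap f x - k * ap (decay k f) x) - (ap g x - k * ap (decay k g) x)) (at x)" for x
    by (rule DERIV_diff[OF decay_deriv[OF k] decay_deriv[OF k]])
  have e1: "ap (decay k f - decay k g) = (\<lambda>x. ap (decay k f) x - ap (decay k g) x)"
    by (rule ext) (rule ap_simps(2))
  have e2: "ap (f - g) x - k * ap (decay k f - decay k g) x
      = (ap f x - k * ap (decay k f) x) - (ap g x - k * ap (decay k g) x)" for x
    unfolding ap_simps by (simp add: algebra_simps)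
  have 2: "(ap (decay k f - decay k g) has_real_derivative
      ap (f - g) x - k * ap (decay k f - decay k g) x) (at x)" for x
    unfolding e2 unfolding e1 by (rule D)
  show ?thesis
    by (rule decay_eq_unique[of "decay k (f - g)" "ap (f - g)" k "decay k f - decay k g", OF 1 2 k])
qed

lemma sq_int_reflect:
  assumes "sq_int f"
  shows "sq_int (\<lambda>x. f (- x))" "l2 (\<lambda>x. f (- x)) = l2 f"
proof -
  show "sq_int (\<lambda>x. f (- x))"
    using assms lborel_integrable_real_affine[of "\<lambda>x. (f x)\<^sup>2" "-1" 0]
    by (auto simp: sq_int_def)
  show "l2 (\<lambda>x. f (- x)) = l2 f"
    using lborel_integral_real_affine[of "-1" "\<lambda>x. (f x)\<^sup>2" 0] by (simp add: l2_def)
qed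

lemma ex_reflect: "\<exists>g. \<forall>x. ap g x = ap f (- x)"
proof -
  have "continuous_on UNIV (\<lambda>x. ap f (- x))"
    by (rule continuous_on_compose2[OF continuous_ap[of UNIV]]) (auto intro: continuous_intros)
  then show ?thesis using ex_cl2[of "\<lambda>x. ap f (- x)"] abs_ap_le sq_int_reflect[OF sq_int_ap]
    by metis
qed

definition reflect :: "cl2 \<Rightarrow> cl2" where
  "reflect f = (SOME g. \<forall>x. ap g x = ap f (- x))"

lemma ap_reflect [simp]: "ap (reflect f) x = ap f (- x)"
  using someI_ex[OF ex_reflect] unfolding reflect_def by blast

lemma l2_reflect [simp]: "l2 (ap (reflect f)) = l2 (ap f)"
proof -
  have "ap (reflect f) = (\<lambda>x. ap f (- x))" by auto
  then show ?thesis using sq_int_reflect(2)[OF sq_int_ap] by simp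
qed

lemma supn_reflect: "supn (reflect f) \<le> supn f"
  by (rule supn_le) (simp add: abs_ap_le_supn)

lemma reflect_diff: "reflect (f - g) = reflect f - reflect g"
  by (rule cl2_eqI) simp

text \<open>Convolution with the Green function
  \<open>exp (- sqrt B * \<bar>x\<bar>) / (2 * sqrt B)\<close> of \<open>B - d^2/dx^2\<close>, split
  into its two one-sided halves; conjugation by \<open>reflect\<close> turns the inverse of
  \<open>d/dx + k\<close> into that of \<open>k - d/dx\<close>.\<close>

definition resolvent :: "real \<Rightarrow> cl2 \<Rightarrow> cl2" where
  "resolvent B h =
     (1 / (2 * sqrt B)) *\<^sub>R (decay (sqrt B) h + reflect (decay (sqrt B) (reflect h)))"

definition resolvent_deriv :: "real \<Rightarrow> cl2 \<Rightarrow> cl2" where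
  "resolvent_deriv B h =
     (1 / 2) *\<^sub>R (reflect (decay (sqrt B) (reflect h)) - decay (sqrt B) h)"

lemma reflect_decay_deriv:
  assumes "k > 0"
  shows "(ap (reflect (decay k (reflect h))) has_real_derivative
     k * ap (reflect (decay k (reflect h))) x - ap h x) (at x)"
proof -
  have "((\<lambda>x. ap (decay k (reflect h)) (- x)) has_real_derivative
      (ap (reflect h) (- x) - k * ap (decay k (reflect h)) (- x)) * (- 1)) (at x)"
    by (rule DERIV_chain2[OF decay_deriv[OF assms]]) (auto intro!: derivative_eq_intros)
  moreover have "ap (reflect (decay k (reflect h))) = (\<lambda>x. ap (decay k (reflect h)) (- x))" by auto
  ultimately show ?thesis by simp
qed

lemma resolvent_has_deriv:
  assumes "B > 0"
  shows "(ap (resolvent B h) has_real_derivative ap (resolvent_deriv B h) x) (at x)"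
proof -
  have k: "sqrt B > 0" using assms by simp
  have "((\<lambda>x. 1 / (2 * sqrt B) * (ap (decay (sqrt B) h) x + ap (reflect (decay (sqrt B) (reflect h))) x))
     has_real_derivative 1 / (2 * sqrt B) * (ap h x - sqrt B * ap (decay (sqrt B) h) x
       + (sqrt B * ap (reflect (decay (sqrt B) (reflect h))) x - ap h x))) (at x)"
    by (intro DERIV_cmult DERIV_add decay_deriv reflect_decay_deriv k)
  moreover have "ap (resolvent B h) = (\<lambda>x. 1 / (2 * sqrt B) *
      (ap (decay (sqrt B) h) x + ap (reflect (decay (sqrt B) (reflect h))) x))"
    by (rule ext) (simp add: resolvent_def)
  moreover have "1 / (2 * sqrt B) * (ap h x - sqrt B * ap (decay (sqrt B) h) x
       + (sqrt B * ap (reflect (decay (sqrt B) (reflect h))) x - ap h x)) = ap (resolvent_deriv B h) x"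
    using k by (simp add: resolvent_deriv_def field_simps)
  ultimately show ?thesis by simp
qed

lemma resolvent_deriv_has_deriv:
  assumes "B > 0"
  shows "(ap (resolvent_deriv B h) has_real_derivative B * ap (resolvent B h) x - ap h x) (at x)"
proof -
  have k: "sqrt B > 0" using assms by simp
  have sq: "sqrt B * sqrt B = B" using assms by simp
  have "((\<lambda>x. 1 / 2 * (ap (reflect (decay (sqrt B) (reflect h))) x - ap (decay (sqrt B) h) x))
     has_real_derivative 1 / 2 * ((sqrt B * ap (reflect (decay (sqrt B) (reflect h))) x - ap h x)
       - (ap h x - sqrt B * ap (decay (sqrt B) h) x))) (at x)"
    by (intro DERIV_cmult DERIV_diff decay_deriv reflect_decay_deriv k)
  moreover have "ap (resolvent_deriv B h) = (\<lambda>x. 1 / 2 *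
      (ap (reflect (decay (sqrt B) (reflect h))) x - ap (decay (sqrt B) h) x))"
    by (rule ext) (simp add: resolvent_deriv_def)
  moreover have gen: "(c * c) * (1 / (2 * c) * y) = c / 2 * y" if "c > 0" for c y :: real
    using that by (simp add: field_simps)
  have "B * ap (resolvent B h) x = sqrt B / 2 *
      (ap (decay (sqrt B) h) x + ap (reflect (decay (sqrt B) (reflect h))) x)"
    using gen[OF k] unfolding sq by (simp only: resolvent_def ap_simps)
  then have "1 / 2 * ((sqrt B * ap (reflect (decay (sqrt B) (reflect h))) x - ap h x)
       - (ap h x - sqrt B * ap (decay (sqrt B) h) x)) = B * ap (resolvent B h) x - ap h x"
    by (simp add: algebra_simps)
  ultimately show ?thesis by (simp only:)
qed

lemma resolvent_diff: "B > 0 \<Longrightarrow> resolvent B (f - g) = resolvent B f - resolvent B g"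
  by (simp add: resolvent_def decay_diff reflect_diff algebra_simps)

lemma resolvent_deriv_diff:
  "B > 0 \<Longrightarrow> resolvent_deriv B (f - g) = resolvent_deriv B f - resolvent_deriv B g"
  by (simp add: resolvent_deriv_def decay_diff reflect_diff algebra_simps)

lemma l2_ap_add: "l2 (ap (f + g)) \<le> l2 (ap f) + l2 (ap g)"
proof -
  have "ap (f + g) = (\<lambda>x. ap f x + ap g x)" by auto
  then show ?thesis using l2_triangle[OF sq_int_ap sq_int_ap] by simp
qed

lemma l2_ap_scaleR: "l2 (ap (c *\<^sub>R f)) = \<bar>c\<bar> * l2 (ap f)"
proof -
  have "ap (c *\<^sub>R f) = (\<lambda>x. c * ap f x)" by auto
  then show ?thesis by (simp add: l2_scale)
qed

text \<open>Each half of the kernel contributes \<open>1 / sqrt B\<close>. The value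
  \<open>1 / B\<close> of the first two constants matters: against the factor \<open>B - B1\<close>
  of the source a larger constant could destroy the contraction in \<open>sol\<close>.\<close>

lemma resolvent_bounds:
  assumes B: "B > 0"
  shows "supn (resolvent B h) \<le> supn h / B" "l2 (ap (resolvent B h)) \<le> l2 (ap h) / B"
    "norm (resolvent_deriv B h) \<le> norm h / sqrt B"
proof -
  let ?k = "sqrt B"
  have k: "?k > 0" using B by simp
  have sq: "?k * ?k = B" using B by simp
  define f where "f = decay ?k h"
  define g where "g = reflect (decay ?k (reflect h))"
  have fs: "supn f \<le> supn h / ?k" and fl: "l2 (ap f) \<le> l2 (ap h) / ?k"
    using decay_supn[OF k] decay_l2[OF k] by (auto simp: f_def)
  have gs: "supn g \<le> supn h / ?k"
    using supn_reflect[of "decay ?k (reflect h)"] decay_supn[OF k, of "reflect h"]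
      divide_right_mono[OF supn_reflect[of h], of ?k] k by (simp add: g_def)
  have gl: "l2 (ap g) \<le> l2 (ap h) / ?k"
    using decay_l2[OF k, of "reflect h"] by (simp add: g_def)
  have kk: "1 / (2 * ?k) * (2 * (a / ?k)) = a / B" for a
    using k sq by (simp add: field_simps)
  have "supn (f + g) \<le> 2 * (supn h / ?k)"
    using norm_triangle_ineq[of "bcf_of f" "bcf_of g"] fs gs by (simp add: plus_cl2.rep_eq)
  then have "1 / (2 * ?k) * supn (f + g) \<le> 1 / (2 * ?k) * (2 * (supn h / ?k))"
    using k by (intro mult_left_mono) auto
  then show "supn (resolvent B h) \<le> supn h / B"
    unfolding kk using B by (simp add: resolvent_def scaleR_cl2.rep_eq f_def g_def)
  have "l2 (ap (f + g)) \<le> 2 * (l2 (ap h) / ?k)"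
    using l2_ap_add[of f g] fl gl by simp
  then have "1 / (2 * ?k) * l2 (ap (f + g)) \<le> 1 / (2 * ?k) * (2 * (l2 (ap h) / ?k))"
    using k by (intro mult_left_mono) auto
  then show "l2 (ap (resolvent B h)) \<le> l2 (ap h) / B"
    unfolding kk using B by (simp add: resolvent_def l2_ap_scaleR f_def g_def)
  have "norm (g - f) \<le> norm g + norm f" by (rule norm_triangle_ineq4)
  also have "\<dots> \<le> 2 * (norm h / ?k)"
    using fs gs fl gl by (simp add: norm_cl2_def add_divide_distrib)
  finally show "norm (resolvent_deriv B h) \<le> norm h / ?k"
    by (simp add: resolvent_deriv_def f_def g_def mult.commute)
qed

section \<open>The elliptic problem and the evolution equation\<close>

lemma seminorms_le:
  assumes "\<And>x. \<bar>ap f x\<bar> \<le> a * \<bar>ap g x\<bar> + c * \<bar>ap h x\<bar>" "a \<ge> 0" "c \<ge> 0"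
  shows "supn f \<le> a * supn g + c * supn h" "l2 (ap f) \<le> a * l2 (ap g) + c * l2 (ap h)"
    "norm f \<le> a * norm g + c * norm h"
proof -
  show s: "supn f \<le> a * supn g + c * supn h"
  proof (rule supn_le)
    fix x
    have "\<bar>ap f x\<bar> \<le> a * \<bar>ap g x\<bar> + c * \<bar>ap h x\<bar>" by (rule assms)
    also have "\<dots> \<le> a * supn g + c * supn h"
      using assms by (intro add_mono mult_left_mono abs_ap_le_supn)
    finally show "\<bar>ap f x\<bar> \<le> a * supn g + c * supn h" .
  qed
  have sq: "sq_int (\<lambda>x. \<bar>ap u x\<bar>)" "l2 (\<lambda>x. \<bar>ap u x\<bar>) = l2 (ap u)" for u
    using sq_int_ap[of u] by (auto simp: sq_int_def l2_def)
  have sq': "sq_int (\<lambda>x. e * \<bar>ap u x\<bar>)" for e u by (intro sq_int_scale sq)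
  have "l2 (ap f) \<le> 1 * l2 (\<lambda>x. a * \<bar>ap g x\<bar> + c * \<bar>ap h x\<bar>)"
  proof (rule l2_bound)
    show "\<bar>ap f x\<bar> \<le> 1 * \<bar>a * \<bar>ap g x\<bar> + c * \<bar>ap h x\<bar>\<bar>" for x
      unfolding mult_1 by (rule order_trans[OF assms(1) abs_ge_self])
  qed (auto intro!: sq_int_add sq')
  also have "\<dots> \<le> l2 (\<lambda>x. a * \<bar>ap g x\<bar>) + l2 (\<lambda>x. c * \<bar>ap h x\<bar>)"
    using l2_triangle[OF sq' sq'] by simp
  also have "\<dots> = a * l2 (ap g) + c * l2 (ap h)"
    using assms by (simp add: l2_scale sq)
  finally show l: "l2 (ap f) \<le> a * l2 (ap g) + c * l2 (ap h)" .
  show "norm f \<le> a * norm g + c * norm h"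
    using s l by (simp add: norm_cl2_def algebra_simps)
qed

text \<open>A model of the truncated \<open>\<phi> powr (- n)\<close>. Because of
  \<open>\<beta> 1 = 1\<close> the Lipschitz bound gives
  \<open>\<bar>coef w x - 1\<bar> \<le> L * \<bar>ap w x\<bar>\<close>, so the inhomogeneity
  \<open>coef w - 1\<close> is square integrable.\<close>

locale coefficient =
  fixes \<beta> :: "real \<Rightarrow> real" and B1 B L :: real
  assumes B1: "B1 > 0" and \<beta>_ge: "\<And>y. B1 \<le> \<beta> y" and \<beta>_le: "\<And>y. \<beta> y \<le> B"
    and \<beta>_1: "\<beta> 1 = 1" and \<beta>_Lipschitz: "\<And>x y. \<bar>\<beta> x - \<beta> y\<bar> \<le> L * \<bar>x - y\<bar>"
begin

lemma B1_le_B: "B1 \<le> B"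
  using \<beta>_ge[of 0] \<beta>_le[of 0] by simp

lemma B_pos: "B > 0"
  using B1 B1_le_B by simp

lemma L_nonneg: "L \<ge> 0"
proof -
  have "0 \<le> L * \<bar>1 - 0\<bar>" using \<beta>_Lipschitz[of 1 0] abs_ge_zero[of "\<beta> 1 - \<beta> 0"] by linarith
  then show ?thesis by simp
qed

lemma continuous_\<beta>: "continuous_on UNIV \<beta>"
proof -
  have "L-lipschitz_on UNIV \<beta>"
    by (rule lipschitz_onI) (use \<beta>_Lipschitz L_nonneg in \<open>auto simp: dist_real_def\<close>)
  then show ?thesis by (rule lipschitz_on_continuous_on)
qed

definition coef :: "cl2 \<Rightarrow> real \<Rightarrow> real" where
  "coef w x = \<beta> (1 + ap w x)"

lemma continuous_coef: "continuous_on S (coef w)"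
  unfolding coef_def
  by (rule continuous_on_compose2[OF continuous_\<beta>]) (auto intro!: continuous_intros)

lemma coef_bounds: "B1 \<le> coef w x" "coef w x \<le> B" "0 < coef w x"
  using \<beta>_ge[of "1 + ap w x"] \<beta>_le[of "1 + ap w x"] B1 unfolding coef_def by linarith+

lemma coef_diff: "\<bar>coef w x - coef w' x\<bar> \<le> L * \<bar>ap (w - w') x\<bar>"
  using \<beta>_Lipschitz[of "1 + ap w x" "1 + ap w' x"] by (simp add: coef_def)

lemma coef_minus_1: "\<bar>coef w x - 1\<bar> \<le> L * \<bar>ap w x\<bar>"
  using \<beta>_Lipschitz[of "1 + ap w x" 1] by (simp add: coef_def \<beta>_1)

lemma ex_src: "\<exists>g. \<forall>x. ap g x = (B - coef w x) * ap p x + (coef w x - 1)"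
proof -
  have [measurable]: "coef w \<in> borel_measurable borel"
    by (intro borel_measurable_continuous_onI continuous_coef)
  define f where "f x = (B - coef w x) * ap p x + (coef w x - 1)" for x
  have c: "continuous_on UNIV f"
    unfolding f_def by (intro continuous_intros continuous_coef continuous_ap)
  have 1: "\<bar>(B - coef w x) * ap p x\<bar> \<le> B * \<bar>ap p x\<bar>" for x
    using coef_bounds[of w x] B_pos by (auto simp: abs_mult intro!: mult_right_mono)
  have "\<bar>f x\<bar> \<le> B * norm p + L * norm w" for x
  proof -
    have "B * \<bar>ap p x\<bar> \<le> B * norm p" "L * \<bar>ap w x\<bar> \<le> L * norm w"
      using B_pos L_nonneg by (auto intro!: mult_left_mono abs_ap_le)
    then show ?thesis
      using 1[of x] coef_minus_1[of w x] unfolding f_def by linarith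
  qed
  moreover have "sq_int f"
    unfolding f_def
    by (intro sq_int_add sq_int_bound[OF sq_int_ap _ 1] sq_int_bound[OF sq_int_ap _ coef_minus_1]) simp_all
  ultimately have "\<exists>F. ap F = f \<and> norm F \<le> (B * norm p + L * norm w) + l2 f"
    using ex_cl2[OF c] by blast
  then show ?thesis unfolding f_def by metis
qed

text \<open>The equation \<open>- p'' + coef w * p = coef w - 1\<close> with
  \<open>(B - coef w) * p\<close> added to both sides. The operator on the left then has constant
  coefficients and \<open>p\<close> is a fixed point of \<open>resolvent B\<close> after
  \<open>src w\<close>.\<close>

definition src :: "cl2 \<Rightarrow> cl2 \<Rightarrow> cl2" where
  "src w p = (SOME g. \<forall>x. ap g x = (B - coef w x) * ap p x + (coef w x - 1))"

lemma ap_src: "ap (src w p) x = (B - coef w x) * ap p x + (coef w x - 1)"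
  using someI_ex[OF ex_src] unfolding src_def by blast

text \<open>The difference is split so that \<open>w - w'\<close> is multiplied by
  \<open>1 - p'\<close>. Hence \<open>p'\<close> enters through its sup norm only, the quantity that
  \<open>supn_sol\<close> bounds uniformly.\<close>

lemma src_diff_bound:
  "\<bar>ap (src w p - src w' p') x\<bar>
     \<le> (B - B1) * \<bar>ap (p - p') x\<bar> + L * (1 + supn p') * \<bar>ap (w - w') x\<bar>"
proof -
  have "ap (src w p - src w' p') x
      = (B - coef w x) * ap (p - p') x + (coef w x - coef w' x) * (1 - ap p' x)"
    by (simp add: ap_src algebra_simps)
  then have "\<bar>ap (src w p - src w' p') x\<bar>
      \<le> \<bar>B - coef w x\<bar> * \<bar>ap (p - p') x\<bar> + \<bar>coef w x - coef w' x\<bar> * \<bar>1 - ap p' x\<bar>"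
    using abs_triangle_ineq[of "(B - coef w x) * ap (p - p') x"
        "(coef w x - coef w' x) * (1 - ap p' x)"] by (simp only: abs_mult)
  also have "\<bar>B - coef w x\<bar> * \<bar>ap (p - p') x\<bar> \<le> (B - B1) * \<bar>ap (p - p') x\<bar>"
    using coef_bounds[of w x] by (intro mult_right_mono) auto
  also have "\<bar>coef w x - coef w' x\<bar> * \<bar>1 - ap p' x\<bar> \<le> (L * \<bar>ap (w - w') x\<bar>) * (1 + supn p')"
  proof (intro mult_mono coef_diff)
    show "\<bar>1 - ap p' x\<bar> \<le> 1 + supn p'" using abs_ap_le_supn[of p' x] by linarith
  qed (use L_nonneg in auto)
  finally show ?thesis by (simp add: mult_ac)
qed

lemma resolvent_norm: "norm (resolvent B h) \<le> norm h / B"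
  using resolvent_bounds[OF B_pos, of h] by (simp add: norm_cl2_def add_divide_distrib)

lemma src_diff:
  "norm (src w p - src w' p') \<le> (B - B1) * norm (p - p') + L * (1 + supn p') * norm (w - w')"
  using B1_le_B L_nonneg by (intro seminorms_le(3)[OF src_diff_bound]) auto

definition sol :: "cl2 \<Rightarrow> cl2" where
  "sol w = (THE p. resolvent B (src w p) = p)"

text \<open>A contraction in the full norm of \<open>cl2\<close>: the source contributes the factor
  \<open>B - B1\<close> and the resolvent \<open>1 / B\<close>, and the product is below 1 because
  \<open>B1 > 0\<close>.\<close>

lemma sol: "resolvent B (src w (sol w)) = sol w"
proof -
  have "\<exists>!p. resolvent B (src w p) = p"
  proof (rule banach_fix_type)
    show "0 \<le> (B - B1) / B" "(B - B1) / B < 1" using B1 B1_le_B B_pos by auto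
    have "dist (resolvent B (src w p)) (resolvent B (src w q)) \<le> (B - B1) / B * dist p q" for p q
    proof -
      have "norm (resolvent B (src w p) - resolvent B (src w q)) \<le> norm (src w p - src w q) / B"
        unfolding resolvent_diff[OF B_pos, symmetric] by (rule resolvent_norm)
      also have "\<dots> \<le> ((B - B1) * norm (p - q)) / B"
        using src_diff[of w p w q] B_pos by (intro divide_right_mono) auto
      finally show ?thesis by (simp add: dist_norm)
    qed
    then show "\<forall>p q. dist (resolvent B (src w p)) (resolvent B (src w q)) \<le> (B - B1) / B * dist p q"
      by blast
  qed
  then show ?thesis unfolding sol_def by (rule theI')
qed

text \<open>This bound does not depend on \<open>w\<close>; it is what makes \<open>sol\<close> globally
  Lipschitz.\<close>

lemma supn_sol: "supn (sol w) \<le> (B + 1) / B1"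
proof -
  have "supn (src w (sol w)) \<le> (B - B1) * supn (sol w) + (B + 1)"
  proof (rule supn_le)
    fix x
    have "\<bar>ap (src w (sol w)) x\<bar> \<le> \<bar>(B - coef w x) * ap (sol w) x\<bar> + \<bar>coef w x - 1\<bar>"
      unfolding ap_src by (rule abs_triangle_ineq)
    also have "\<bar>coef w x - 1\<bar> \<le> B + 1" using coef_bounds[of w x] by simp
    also have "\<bar>(B - coef w x) * ap (sol w) x\<bar> \<le> (B - B1) * supn (sol w)"
      unfolding abs_mult using coef_bounds[of w x] by (intro mult_mono abs_ap_le_supn) auto
    finally show "\<bar>ap (src w (sol w)) x\<bar> \<le> (B - B1) * supn (sol w) + (B + 1)" by simp
  qed
  then have "supn (src w (sol w)) / B \<le> ((B - B1) * supn (sol w) + (B + 1)) / B"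
    using B_pos by (intro divide_right_mono) auto
  with resolvent_bounds(1)[OF B_pos, of "src w (sol w)"]
  have "supn (sol w) \<le> ((B - B1) * supn (sol w) + (B + 1)) / B" unfolding sol by linarith
  then show ?thesis using B_pos B1 by (simp add: field_simps)
qed

text \<open>The factor \<open>L * (1 + supn p')\<close> of \<open>src_diff\<close> with the bound
  \<open>supn_sol\<close> inserted.\<close>

definition Lsrc :: real where
  "Lsrc = L * (1 + (B + 1) / B1)"

lemma Lsrc_nonneg: "Lsrc \<ge> 0"
  unfolding Lsrc_def using L_nonneg B1 B_pos by simp

lemma src_sol_diff:
  "norm (src w (sol w) - src w' (sol w'))
     \<le> (B - B1) * norm (sol w - sol w') + Lsrc * norm (w - w')"
proof -
  have "L * (1 + supn (sol w')) * norm (w - w') \<le> Lsrc * norm (w - w')"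
    unfolding Lsrc_def using supn_sol[of w'] L_nonneg by (intro mult_right_mono mult_left_mono) auto
  then show ?thesis using src_diff[of w "sol w" w' "sol w'"] by linarith
qed

text \<open>Absorbing the share \<open>(B - B1) / B\<close> on the left leaves
  \<open>B1 / B\<close>, whence the division by \<open>B1\<close>.\<close>

lemma sol_diff: "norm (sol w - sol w') \<le> Lsrc / B1 * norm (w - w')"
proof -
  have "norm (sol w - sol w') \<le> norm (src w (sol w) - src w' (sol w')) / B"
    using resolvent_norm[of "src w (sol w) - src w' (sol w')"]
    unfolding resolvent_diff[OF B_pos] sol .
  also have "\<dots> \<le> ((B - B1) * norm (sol w - sol w') + Lsrc * norm (w - w')) / B"
    using src_sol_diff B_pos by (intro divide_right_mono) auto
  finally show ?thesis using B_pos B1 by (simp add: field_simps)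
qed

definition LN :: real where
  "LN = (B - B1) * (Lsrc / B1) + Lsrc"

lemma LN_nonneg: "LN \<ge> 0"
  unfolding LN_def using Lsrc_nonneg B1 B1_le_B by simp

lemma src_sol_Lipschitz: "norm (src w (sol w) - src w' (sol w')) \<le> LN * norm (w - w')"
proof -
  have "(B - B1) * norm (sol w - sol w') \<le> (B - B1) * (Lsrc / B1 * norm (w - w'))"
    using B1_le_B by (intro mult_left_mono sol_diff) auto
  then show ?thesis
    using src_sol_diff[of w w'] by (simp add: LN_def distrib_right mult.assoc)
qed

definition vel :: "cl2 \<Rightarrow> cl2" where
  "vel w = resolvent_deriv B (src w (sol w))"

text \<open>\<open>p'' = u_z\<close>, read off from the equation for \<open>p\<close>. It therefore
  lies in \<open>cl2\<close> and depends on \<open>w\<close> in a Lipschitz way, although the phase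
  space does not control derivatives.\<close>

definition vel_z :: "cl2 \<Rightarrow> cl2" where
  "vel_z w = B *\<^sub>R sol w - src w (sol w)"

lemma ap_vel_z: "ap (vel_z w) x = coef w x * ap (sol w) x + 1 - coef w x"
  by (simp add: vel_z_def ap_src algebra_simps)

lemma sol_has_deriv: "(ap (sol w) has_real_derivative ap (vel w) x) (at x)"
  using resolvent_has_deriv[OF B_pos, of "src w (sol w)"] unfolding sol vel_def .

lemma vel_has_deriv: "(ap (vel w) has_real_derivative ap (vel_z w) x) (at x)"
proof -
  have "ap (vel_z w) x = B * ap (sol w) x - ap (src w (sol w)) x" by (simp add: vel_z_def)
  then show ?thesis
    using resolvent_deriv_has_deriv[OF B_pos, of "src w (sol w)" x] unfolding sol vel_def by simp
qed

lemma vel_Lipschitz: "norm (vel w - vel w') \<le> LN / sqrt B * norm (w - w')"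
proof -
  have "norm (vel w - vel w') \<le> norm (src w (sol w) - src w' (sol w')) / sqrt B"
    using resolvent_bounds(3)[OF B_pos, of "src w (sol w) - src w' (sol w')"]
    unfolding resolvent_deriv_diff[OF B_pos] vel_def .
  also have "\<dots> \<le> (LN * norm (w - w')) / sqrt B"
    using src_sol_Lipschitz B_pos by (intro divide_right_mono) auto
  finally show ?thesis by simp
qed

lemma vel_z_Lipschitz: "norm (vel_z w - vel_z w') \<le> (B * (Lsrc / B1) + LN) * norm (w - w')"
proof -
  have "vel_z w - vel_z w' = B *\<^sub>R (sol w - sol w') - (src w (sol w) - src w' (sol w'))"
    by (simp add: vel_z_def algebra_simps)
  then have "norm (vel_z w - vel_z w')
      \<le> norm (B *\<^sub>R (sol w - sol w')) + norm (src w (sol w) - src w' (sol w'))"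
    by (simp only: norm_triangle_ineq4)
  also have "norm (B *\<^sub>R (sol w - sol w')) = B * norm (sol w - sol w')" using B_pos by simp
  also have "\<dots> \<le> B * (Lsrc / B1 * norm (w - w'))"
    using B_pos by (intro mult_left_mono sol_diff) auto
  finally show ?thesis using src_sol_Lipschitz[of w w'] by (simp add: algebra_simps)
qed

end

text \<open>Banach's fixed point theorem applied to \<open>exp (- 2 K t) *\<^sub>R y t\<close>: the weight turns
  the Picard operator into a contraction on the whole half line at once.\<close>

lemma global_Picard:
  fixes F :: "'a::banach \<Rightarrow> 'a"
  assumes F: "\<And>x y. norm (F x - F y) \<le> K * norm (x - y)" and K: "K > 0"
  shows "\<exists>y. y 0 = x0 \<and> (\<forall>t\<ge>0. (y has_vector_derivative F (y t)) (at t within {0..}))"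
proof -
  \<comment> \<open>Freezes negative times at 0, where the operator \<open>T\<close> takes the value
    \<open>x0\<close>; the fixed point can then be sought among bounded continuous functions on the
    whole line.\<close>
  define pos where "pos t = max 0 (t::real)" for t
  have pos0: "pos t \<ge> 0" for t by (simp add: pos_def)
  have cF: "continuous_on UNIV F"
  proof -
    have "K-lipschitz_on UNIV F" by (rule lipschitz_onI) (use F K in \<open>auto simp: dist_norm\<close>)
    then show ?thesis by (rule lipschitz_on_continuous_on)
  qed
  \<comment> \<open>\<open>\<psi>\<close> stands for the weighted solution, so the weight is removed
    before \<open>F\<close> is applied and restored in \<open>T\<close>.\<close>
  define G where "G \<psi> s = F (exp (2 * K * s) *\<^sub>R \<psi> s)" for \<psi> :: "real \<Rightarrow> 'a" and s
  define T where "T \<psi> t = exp (- (2 * K * pos t)) *\<^sub>R (x0 + integral {0..pos t} (G \<psi>))"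
    for \<psi> :: "real \<Rightarrow> 'a" and t
  have cG: "continuous_on S (G \<psi>)" if "continuous_on UNIV \<psi>" for \<psi> S
  proof -
    have "continuous_on S \<psi>" using that continuous_on_subset by blast
    then show ?thesis unfolding G_def
      by (intro continuous_on_compose2[OF cF] continuous_intros) auto
  qed
  have intG: "G \<psi> integrable_on {a..b}" if "continuous_on UNIV \<psi>" for \<psi> a b
    using cG[OF that] by (rule integrable_continuous_real)
  have expint: "((\<lambda>s. c * exp (2 * K * s)) has_integral c / (2 * K) * (exp (2 * K * t) - 1)) {0..t}"
    if "t \<ge> 0" for c t
  proof -
    have "((\<lambda>s. c * exp (2 * K * s)) has_integral
        c / (2 * K) * exp (2 * K * t) - c / (2 * K) * exp (2 * K * 0)) {0..t}"
      using that K
      by (intro fundamental_theorem_of_calculus)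
        (auto intro!: derivative_eq_intros simp: has_real_derivative_iff_has_vector_derivative[symmetric])
    then show ?thesis by (simp add: right_diff_distrib)
  qed
  \<comment> \<open>An integrand of size \<open>c * exp (2 * K * s)\<close> contributes at most
    \<open>c / (2 * K)\<close> after weighting. With \<open>c = K * dist \<psi> \<psi>'\<close> this
    is the contraction factor 1/2, uniformly in time.\<close>
  have weight: "exp (- (2 * K * t)) * (c / (2 * K) * (exp (2 * K * t) - 1)) \<le> c / (2 * K)"
    if "t \<ge> 0" "c \<ge> 0" for c t
  proof -
    have "exp (- (2 * K * t)) * (c / (2 * K) * (exp (2 * K * t) - 1))
        = c / (2 * K) * (1 - exp (- (2 * K * t)))"
      by (simp add: exp_minus field_simps)
    also have "\<dots> \<le> c / (2 * K) * 1" using that K by (intro mult_left_mono) auto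
    finally show ?thesis by simp
  qed
  have contT: "continuous_on UNIV (T \<psi>)" if \<psi>: "continuous_on UNIV \<psi>" for \<psi>
  proof -
    have "isCont (\<lambda>t. integral {0..pos t} (G \<psi>)) t" for t
    proof -
      have "continuous_on {..<\<bar>t\<bar> + 1} (\<lambda>t. integral {0..pos t} (G \<psi>))"
        by (rule continuous_on_compose2[OF indefinite_integral_continuous_1[OF intG[OF \<psi>],
              of 0 "\<bar>t\<bar> + 1"]])
          (auto simp: pos_def intro!: continuous_intros)
      then show ?thesis by (rule continuous_on_interior) (auto simp: interior_open)
    qed
    then have "continuous_on UNIV (\<lambda>t. integral {0..pos t} (G \<psi>))"
      by (simp add: continuous_at_imp_continuous_on)
    then show ?thesis unfolding T_def pos_def by (intro continuous_intros) auto
  qed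
  have boundT: "norm (T \<psi> t) \<le> norm x0 + (norm (F 0) + K * M) / (2 * K)"
    if \<psi>: "continuous_on UNIV \<psi>" and M: "\<And>t. norm (\<psi> t) \<le> M" for \<psi> M t
  proof -
    have M0: "M \<ge> 0" using M[of 0] norm_ge_zero[of "\<psi> 0"] by linarith
    define c where "c = norm (F 0) + K * M"
    have c: "c \<ge> 0" using M0 K by (simp add: c_def)
    have G: "norm (G \<psi> s) \<le> c * exp (2 * K * s)" if "s \<in> {0..pos t}" for s
    proof -
      have "norm (G \<psi> s) \<le> norm (F 0) + norm (G \<psi> s - F 0)" by (metis norm_triangle_sub)
      also have "norm (G \<psi> s - F 0) \<le> K * (exp (2 * K * s) * norm (\<psi> s))"
        using F[of "exp (2 * K * s) *\<^sub>R \<psi> s" 0] by (simp add: G_def)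
      also have "\<dots> \<le> K * (exp (2 * K * s) * M)"
        using K M by (intro mult_left_mono) auto
      also have "norm (F 0) \<le> norm (F 0) * exp (2 * K * s)"
        using that K by (intro mult_right_le_one_le[THEN order_trans] mult_le_cancel_left1[THEN iffD2]) auto
      finally show ?thesis by (simp add: c_def algebra_simps)
    qed
    have "norm (integral {0..pos t} (G \<psi>)) \<le> c / (2 * K) * (exp (2 * K * pos t) - 1)"
      using integral_norm_bound_integral[OF intG[OF \<psi>] has_integral_integrable[OF expint[OF pos0]] G]
        integral_unique[OF expint[OF pos0]] by metis
    then have "exp (- (2 * K * pos t)) * norm (integral {0..pos t} (G \<psi>))
        \<le> exp (- (2 * K * pos t)) * (c / (2 * K) * (exp (2 * K * pos t) - 1))"
      by (intro mult_left_mono) auto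
    also have "\<dots> \<le> c / (2 * K)" by (rule weight[OF pos0 c])
    finally have 1: "exp (- (2 * K * pos t)) * norm (integral {0..pos t} (G \<psi>)) \<le> c / (2 * K)" .
    have "norm (T \<psi> t) \<le> exp (- (2 * K * pos t)) * (norm x0 + norm (integral {0..pos t} (G \<psi>)))"
      unfolding T_def by (simp add: norm_triangle_ineq)
    also have "\<dots> \<le> norm x0 + c / (2 * K)"
    proof -
      have "exp (- (2 * K * pos t)) * norm x0 \<le> 1 * norm x0"
        using K pos0 by (intro mult_right_mono) auto
      then show ?thesis using 1 by (simp add: distrib_left)
    qed
    finally show ?thesis by (simp add: c_def)
  qed
  have TB: "T (apply_bcontfun \<psi>) \<in> bcontfun" for \<psi>
    by (rule bcontfun_normI[OF contT boundT]) (auto intro: norm_bounded)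
  have diffT: "norm (T (apply_bcontfun \<psi>) t - T (apply_bcontfun \<psi>') t) \<le> 1/2 * dist \<psi> \<psi>'" for \<psi> \<psi>' t
  proof -
    let ?G = "G (apply_bcontfun \<psi>)" and ?G' = "G (apply_bcontfun \<psi>')"
    define c where "c = K * dist \<psi> \<psi>'"
    have c: "c \<ge> 0" using K by (simp add: c_def)
    have i: "?G integrable_on {0..pos t}" "?G' integrable_on {0..pos t}" by (auto intro: intG)
    have G: "norm (?G s - ?G' s) \<le> c * exp (2 * K * s)" if "s \<in> {0..pos t}" for s
    proof -
      have "norm (?G s - ?G' s) \<le> K * (exp (2 * K * s) * dist (apply_bcontfun \<psi> s) (apply_bcontfun \<psi>' s))"
        using F[of "exp (2 * K * s) *\<^sub>R apply_bcontfun \<psi> s" "exp (2 * K * s) *\<^sub>R apply_bcontfun \<psi>' s"]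
        by (simp add: G_def dist_norm flip: scaleR_diff_right)
      also have "\<dots> \<le> K * (exp (2 * K * s) * dist \<psi> \<psi>')"
        using K dist_bounded by (intro mult_left_mono) auto
      finally show ?thesis by (simp add: c_def algebra_simps)
    qed
    have "norm (integral {0..pos t} (\<lambda>s. ?G s - ?G' s)) \<le> c / (2 * K) * (exp (2 * K * pos t) - 1)"
      using integral_norm_bound_integral[OF integrable_diff[OF i] has_integral_integrable[OF expint[OF pos0]] G]
        integral_unique[OF expint[OF pos0]] by metis
    then have "exp (- (2 * K * pos t)) * norm (integral {0..pos t} (\<lambda>s. ?G s - ?G' s))
        \<le> exp (- (2 * K * pos t)) * (c / (2 * K) * (exp (2 * K * pos t) - 1))"
      by (intro mult_left_mono) auto
    also have "\<dots> \<le> c / (2 * K)" by (rule weight[OF pos0 c])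
    also have "\<dots> = 1/2 * dist \<psi> \<psi>'" using K by (simp add: c_def)
    finally have 1: "exp (- (2 * K * pos t)) * norm (integral {0..pos t} (\<lambda>s. ?G s - ?G' s))
        \<le> 1/2 * dist \<psi> \<psi>'" .
    have "T (apply_bcontfun \<psi>) t - T (apply_bcontfun \<psi>') t
        = exp (- (2 * K * pos t)) *\<^sub>R integral {0..pos t} (\<lambda>s. ?G s - ?G' s)"
      unfolding T_def using Henstock_Kurzweil_Integration.integral_diff[OF i]
      by (simp flip: scaleR_diff_right)
    then show ?thesis using 1 by simp
  qed
  have "\<exists>!\<psi>. Bcontfun (T (apply_bcontfun \<psi>)) = \<psi>"
  proof (rule banach_fix_type[of "1/2"])
    have "dist (Bcontfun (T (apply_bcontfun \<psi>))) (Bcontfun (T (apply_bcontfun \<psi>'))) \<le> 1/2 * dist \<psi> \<psi>'"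
      for \<psi> \<psi>'
      by (rule dist_bound) (use diffT TB in \<open>simp add: Bcontfun_inverse dist_norm\<close>)
    then show "\<forall>\<psi> \<psi>'. dist (Bcontfun (T (apply_bcontfun \<psi>))) (Bcontfun (T (apply_bcontfun \<psi>')))
        \<le> 1/2 * dist \<psi> \<psi>'" by blast
  qed auto
  then obtain \<psi> where \<psi>: "Bcontfun (T (apply_bcontfun \<psi>)) = \<psi>" by blast
  have fp: "T (apply_bcontfun \<psi>) = apply_bcontfun \<psi>"
    using Bcontfun_inverse[OF TB, of \<psi>] unfolding \<psi> by simp
  \<comment> \<open>For nonnegative \<open>t\<close> this is
    \<open>exp (2 * K * t) *\<^sub>R \<psi> t\<close>; written as an integral it is differentiable
    by the fundamental theorem.\<close>
  define y where "y t = x0 + integral {0..t} (G (apply_bcontfun \<psi>))" for t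
  have y: "G (apply_bcontfun \<psi>) t = F (y t)" if "t \<ge> 0" for t
  proof -
    have "apply_bcontfun \<psi> t = exp (- (2 * K * t)) *\<^sub>R y t"
      using fun_cong[OF fp, of t] that by (simp add: T_def pos_def y_def)
    then show ?thesis by (simp add: G_def flip: exp_add)
  qed
  have "(y has_vector_derivative F (y t)) (at t within {0..})" if t: "t \<ge> 0" for t
  proof -
    have "((\<lambda>t. integral {0..t} (G (apply_bcontfun \<psi>))) has_vector_derivative
        G (apply_bcontfun \<psi>) t) (at t within {0..t + 1})"
      using t by (intro integral_has_vector_derivative cG) auto
    then have "(y has_vector_derivative F (y t)) (at t within {0..t + 1})"
      unfolding y_def y[OF t, unfolded y_def, symmetric]
      by (intro has_vector_derivative_add[of "\<lambda>_. x0" 0, simplified]) auto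
    moreover have "at t within {0..t + 1} = at t within {0..}"
      by (rule at_within_nhd[of t "{..<t + 1}"]) auto
    ultimately show ?thesis by simp
  qed
  moreover have "y 0 = x0" by (simp add: y_def)
  ultimately show ?thesis by blast
qed

section \<open>Test functions and the lemma of du Bois-Reymond\<close>

text \<open>The classical \<open>exp (- 1 / x)\<close> is the case \<open>k = 0\<close>; the powers
  of \<open>1 / x\<close> are included so that derivatives are linear combinations of members of the
  family.\<close>

definition flat :: "nat \<Rightarrow> real \<Rightarrow> real" where
  "flat k x = (if x > 0 then inverse x ^ k / exp (inverse x) else 0)"

lemma flat_has_deriv:
  "(flat k has_real_derivative flat (k + 2) x - real k * flat (k + 1) x) (at x)"
proof (cases x "0::real" rule: linorder_cases)
  case less
  have "((\<lambda>x. 0) has_real_derivative 0) (at x)" by simp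
  then have "(flat k has_real_derivative 0) (at x)"
    by (rule has_field_derivative_transform_within_open[of _ _ _ "{..<0}"])
      (use less in \<open>auto simp: flat_def\<close>)
  then show ?thesis using less by (simp add: flat_def)
next
  case greater
  have "((\<lambda>x. inverse x ^ k / exp (inverse x)) has_real_derivative
      flat (k + 2) x - real k * flat (k + 1) x) (at x)"
  proof -
    have "((\<lambda>x. inverse x ^ k / exp (inverse x)) has_real_derivative
      (real k * inverse x ^ (k - 1) * (- (inverse x ^ 2)) * exp (inverse x)
        - inverse x ^ k * (exp (inverse x) * (- (inverse x ^ 2)))) / (exp (inverse x) * exp (inverse x))) (at x)"
      using greater by (auto intro!: derivative_eq_intros simp: power2_eq_square)
    also have "(real k * inverse x ^ (k - 1) * (- (inverse x ^ 2)) * exp (inverse x)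
        - inverse x ^ k * (exp (inverse x) * (- (inverse x ^ 2)))) / (exp (inverse x) * exp (inverse x))
        = (inverse x ^ k * inverse x ^ 2 - real k * inverse x ^ (k - 1) * (inverse x ^ 2)) / exp (inverse x)"
      by (simp add: field_simps)
    also have "real k * inverse x ^ (k - 1) * (inverse x ^ 2) = real k * inverse x ^ (k + 1)"
      by (cases k) (simp_all add: power2_eq_square)
    finally show ?thesis
      using greater by (simp add: flat_def diff_divide_distrib power_add power2_eq_square mult_ac)
  qed
  then show ?thesis
    by (rule has_field_derivative_transform_within_open[of _ _ _ "{0<..}"])
      (use greater in \<open>auto simp: flat_def\<close>)
next
  case equal
  \<comment> \<open>For positive \<open>y\<close> the difference quotient at 0 is the same
    expression with exponent \<open>Suc k\<close>, and the exponential beats every power.\<close>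
  have lim: "((\<lambda>y. inverse y ^ Suc k / exp (inverse y)) \<longlongrightarrow> 0) (at_right (0::real))"
    by (rule filterlim_compose[OF tendsto_power_div_exp_0 filterlim_inverse_at_top_right])
  have "((\<lambda>y. (flat k y - flat k 0) / (y - 0)) \<longlongrightarrow> 0) (at 0)"
  proof (rule filterlim_split_at)
    have "\<forall>\<^sub>F y in at_left (0::real). (flat k y - flat k 0) / (y - 0) = 0"
      by (auto simp: flat_def eventually_at_filter)
    then show "((\<lambda>y. (flat k y - flat k 0) / (y - 0)) \<longlongrightarrow> 0) (at_left 0)"
      by (rule tendsto_eventually)
    have "\<forall>\<^sub>F y in at_right (0::real).
        inverse y ^ Suc k / exp (inverse y) = (flat k y - flat k 0) / (y - 0)"
      by (auto simp: flat_def eventually_at_filter field_simps)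
    then show "((\<lambda>y. (flat k y - flat k 0) / (y - 0)) \<longlongrightarrow> 0) (at_right 0)"
      by (rule Lim_transform_eventually[OF lim])
  qed
  then show ?thesis using equal by (simp add: has_field_derivative_iff flat_def)
qed

text \<open>A class closed under differentiation by induction on its rules, so that all iterated
  derivatives exist without being computed. The rule for antiderivatives admits the ramp
  below.\<close>

inductive smooth :: "(real \<Rightarrow> real) \<Rightarrow> bool" where
  const: "smooth (\<lambda>x. c)"
| flat: "smooth (flat k)"
| add: "smooth f \<Longrightarrow> smooth g \<Longrightarrow> smooth (\<lambda>x. f x + g x)"
| mult: "smooth f \<Longrightarrow> smooth g \<Longrightarrow> smooth (\<lambda>x. f x * g x)"
| affine: "smooth f \<Longrightarrow> smooth (\<lambda>x. f (c * x + d))"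
| antiderivative: "smooth f \<Longrightarrow> (\<And>x. (F has_real_derivative f x) (at x)) \<Longrightarrow> smooth F"

lemma smooth_has_deriv:
  "smooth f \<Longrightarrow> \<exists>f'. smooth f' \<and> (\<forall>x. (f has_real_derivative f' x) (at x))"
proof (induction rule: smooth.induct)
  case (const c)
  then show ?case by (intro exI[of _ "\<lambda>x. 0"]) (auto intro: smooth.const)
next
  case (flat k)
  have "smooth (\<lambda>x. flat (k + 2) x + (- real k) * flat (k + 1) x)"
    by (intro smooth.intros)
  then show ?case using flat_has_deriv[of k]
    by (intro exI[of _ "\<lambda>x. flat (k + 2) x + (- real k) * flat (k + 1) x"]) simp
next
  case (add f g)
  then obtain f' g' where "smooth f'" "smooth g'" "\<And>x. (f has_real_derivative f' x) (at x)"
    "\<And>x. (g has_real_derivative g' x) (at x)" by blast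
  then show ?case
    by (intro exI[of _ "\<lambda>x. f' x + g' x"]) (auto intro!: smooth.add derivative_eq_intros)
next
  case (mult f g)
  then obtain f' g' where "smooth f'" "smooth g'" "\<And>x. (f has_real_derivative f' x) (at x)"
    "\<And>x. (g has_real_derivative g' x) (at x)" by blast
  then show ?case using mult.hyps
    by (intro exI[of _ "\<lambda>x. f' x * g x + f x * g' x"])
      (auto intro!: smooth.add smooth.mult derivative_eq_intros)
next
  case (affine f c d)
  then obtain f' where f': "smooth f'" "\<And>x. (f has_real_derivative f' x) (at x)" by blast
  have "((\<lambda>x. f (c * x + d)) has_real_derivative f' (c * x + d) * c) (at x)" for x
    by (rule DERIV_chain2[OF f'(2)]) (auto intro!: derivative_eq_intros)
  moreover have "smooth (\<lambda>x. f' (c * x + d) * c)"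
    by (rule smooth.mult[OF smooth.affine[OF f'(1)] smooth.const])
  ultimately show ?case by blast
qed blast

lemma smooth_deriv: "smooth f \<Longrightarrow> smooth (deriv f)"
  using smooth_has_deriv[of f] DERIV_imp_deriv by (metis ext)

lemma smooth_test_function:
  assumes "smooth f" "\<And>x. x \<notin> {a..b} \<Longrightarrow> f x = 0"
  shows "test_function f"
proof -
  have "smooth ((deriv ^^ k) f)" for k
    by (induction k) (use assms(1) smooth_deriv in auto)
  then have "(deriv ^^ k) f field_differentiable at x" for k x
    using smooth_has_deriv field_differentiable_def by blast
  moreover have "bounded {x. f x \<noteq> 0}"
    by (rule bounded_subset[of "{a..b}"]) (simp, use assms(2) in blast)
  ultimately show ?thesis by (simp add: test_function_def compact_closure)
qed

text \<open>A smooth version of the positive part: \<open>s\<close> is the normalised primitive of a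
  bump on the unit interval, and \<open>T\<close> is a primitive of \<open>s\<close>. The lag
  \<open>\<kappa>\<close> of \<open>T\<close> behind \<open>x\<close> cancels in the combinations
  formed later.\<close>

lemma ex_ramp:
  "\<exists>T s \<kappa>. smooth T \<and> continuous_on UNIV s \<and> (\<forall>x. (T has_real_derivative s x) (at x)) \<and> (\<forall>x. 0 \<le> s x \<and> s x \<le> 1)
     \<and> (\<forall>x\<le>0. T x = 0 \<and> s x = 0) \<and> (\<forall>x\<ge>1. T x = x - \<kappa> \<and> s x = (1::real))"
proof -
  define e where "e x = flat 0 x * flat 0 (-1 * x + 1)" for x
  have se: "smooth e" unfolding e_def by (intro smooth.intros)
  have cont: "continuous_on UNIV f" if "smooth f" for f
    using smooth_has_deriv[OF that] by (meson DERIV_isCont continuous_at_imp_continuous_on)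
  have e0: "e x \<ge> 0" for x by (simp add: e_def flat_def)
  have epos: "e x > 0" if "0 < x" "x < 1" for x using that by (simp add: e_def flat_def)
  have eout: "e x = 0" if "x \<le> 0 \<or> 1 \<le> x" for x using that by (auto simp: e_def flat_def)
  obtain S where S: "S 0 = 0" "\<And>x. (S has_real_derivative e x) (at x)"
    using ex_antiderivative[OF cont[OF se], of 0] by blast
  have left: "S x = 0" if "x \<le> 0" for x
  proof -
    obtain z where "\<bar>z - x\<bar> \<le> \<bar>0 - x\<bar>" "S 0 - S x = e z * (0 - x)"
      using DERIV_mean_value[OF S(2)] by blast
    moreover from this have "z \<le> 0" using that by linarith
    ultimately show ?thesis using eout[of z] S(1) by simp
  qed
  have right: "S x = S 1" if "x \<ge> 1" for x
  proof -
    obtain z where "\<bar>z - x\<bar> \<le> \<bar>1 - x\<bar>" "S 1 - S x = e z * (1 - x)"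
      using DERIV_mean_value[OF S(2)] by blast
    moreover from this have "z \<ge> 1" using that by linarith
    ultimately show ?thesis using eout[of z] by simp
  qed
  have c: "S 1 > 0"
  proof -
    obtain z where "0 < z" "z < 1" "S 1 - S 0 = (1 - 0) * e z"
      using MVT2[of 0 1 S e] S(2) by auto
    then show ?thesis using epos S(1) by simp
  qed
  have mono: "S x \<le> S y" if "x \<le> y" for x y
    by (rule DERIV_nonneg_imp_nondecreasing[OF that]) (use S(2) e0 in blast)
  define s where "s x = S x * (1 / S 1)" for x
  have sS: "smooth S" by (rule smooth.antiderivative[OF se S(2)])
  have ss: "smooth s" unfolding s_def by (intro smooth.mult sS smooth.const)
  have "S x \<ge> 0" "S x \<le> S 1" for x
    using mono[of 0 x] left[of x] S(1) mono[of x 1] right[of x] by (cases "x \<le> 0"; cases "x \<le> 1"; simp)+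
  then have s01: "0 \<le> s x \<and> s x \<le> 1" for x using c by (simp add: s_def)
  have sl: "s x = 0" if "x \<le> 0" for x using left that by (simp add: s_def)
  have sr: "s x = 1" if "x \<ge> 1" for x using right[OF that] c by (simp add: s_def)
  obtain T where T: "T 0 = 0" "\<And>x. (T has_real_derivative s x) (at x)"
    using ex_antiderivative[OF cont[OF ss], of 0] by blast
  have "T x = 0" if "x \<le> 0" for x
  proof -
    obtain z where "\<bar>z - x\<bar> \<le> \<bar>0 - x\<bar>" "T 0 - T x = s z * (0 - x)"
      using DERIV_mean_value[OF T(2)] by blast
    moreover from this have "z \<le> 0" using that by linarith
    ultimately show ?thesis using sl[of z] T(1) by simp
  qed
  moreover have "T x = x - (1 - T 1)" if "x \<ge> 1" for x
  proof -
    obtain z where "\<bar>z - x\<bar> \<le> \<bar>1 - x\<bar>" "T 1 - T x = s z * (1 - x)"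
      using DERIV_mean_value[OF T(2)] by blast
    moreover from this have "z \<ge> 1" using that by linarith
    ultimately show ?thesis using sr[of z] by simp
  qed
  ultimately show ?thesis
    using T(2) s01 sl sr smooth.antiderivative[OF ss T(2)] cont[OF ss]
    by blast
qed

lemma test_function_C1:
  assumes "test_function \<psi>"
  shows "(\<psi> has_real_derivative deriv \<psi> x) (at x)" "continuous_on UNIV (deriv \<psi>)"
    "continuous_on UNIV \<psi>"
proof -
  have d: "(deriv ^^ k) \<psi> field_differentiable at x" for k x
    using assms by (auto simp: test_function_def)
  show "(\<psi> has_real_derivative deriv \<psi> x) (at x)"
    using d[of 0 x] by (simp add: field_differentiable_derivI)
  show "continuous_on UNIV (deriv \<psi>)" "continuous_on UNIV \<psi>"
    using d[of 1] d[of 0]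
    by (auto intro!: continuous_at_imp_continuous_on field_differentiable_imp_continuous_at)
qed

lemma test_function_support:
  assumes "test_function \<psi>"
  shows "\<exists>R>0. \<psi> (-R) = 0 \<and> \<psi> R = 0 \<and> (\<forall>x. x \<notin> {-R..R} \<longrightarrow> \<psi> x = 0 \<and> deriv \<psi> x = 0)"
proof -
  have "bounded {x. \<psi> x \<noteq> 0}"
    using assms by (auto simp: test_function_def compact_eq_bounded_closed intro: bounded_subset[OF _ closure_subset])
  then obtain R where R: "R > 0" "\<And>x. \<psi> x \<noteq> 0 \<Longrightarrow> \<bar>x\<bar> \<le> R"
    unfolding bounded_pos by auto
  have z: "\<psi> x = 0" if "x \<notin> {-R..R}" for x
    by (rule ccontr) (use R(2)[of x] that in auto)
  have z': "deriv \<psi> x = 0" if "x \<notin> {-R..R}" for x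
  proof -
    have "((\<lambda>x. 0) has_real_derivative 0) (at x)" by simp
    then have "(\<psi> has_real_derivative 0) (at x)"
    proof (rule has_field_derivative_transform_within_open[of _ _ _ "- {-R..R}"])
      show "x \<in> - {-R..R}" using that by simp
      show "0 = \<psi> y" if "y \<in> - {-R..R}" for y using z[of y] that by simp
    qed auto
    then show ?thesis by (rule DERIV_imp_deriv)
  qed
  \<comment> \<open>The zeros are known strictly outside \<open>{-R..R}\<close> only; enlarging the
    radius by 1 puts the end points among them.\<close>
  have "\<psi> (- (R + 1)) = 0" "\<psi> (R + 1) = 0" using z R(1) by auto
  moreover have "\<psi> x = 0 \<and> deriv \<psi> x = 0" if "x \<notin> {- (R + 1)..R + 1}" for x
    using that by (intro conjI z z') auto
  ultimately show ?thesis using R(1) by (intro exI[of _ "R + 1"]) simp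
qed

lemma lborel_integral_support:
  fixes h :: "real \<Rightarrow> real"
  assumes "\<And>x. x \<notin> {a..b} \<Longrightarrow> h x = 0" "set_integrable lborel {a..b} h"
  shows "integrable lborel h" "(LBINT x. h x) = integral {a..b} h"
proof -
  have eq: "h = (\<lambda>x. indicator {a..b} x *\<^sub>R h x)"
  proof
    fix x show "h x = indicator {a..b} x *\<^sub>R h x" using assms(1)[of x] by (cases "x \<in> {a..b}") auto
  qed
  show "integrable lborel h" using assms(2) unfolding set_integrable_def eq[symmetric] .
  show "(LBINT x. h x) = integral {a..b} h"
    using set_borel_integral_eq_integral(2)[OF assms(2)]
    unfolding set_lebesgue_integral_def eq[symmetric] .
qed

lemma integral_by_parts_test:
  assumes F: "ac F g" and \<psi>: "test_function \<psi>"
  shows "integrable lborel (\<lambda>x. F x * deriv \<psi> x)" "integrable lborel (\<lambda>x. g x * \<psi> x)"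
    "(LBINT x. F x * deriv \<psi> x) = - (LBINT x. g x * \<psi> x)"
proof -
  obtain R where R: "R > 0" "\<And>x. x \<notin> {-R..R} \<Longrightarrow> \<psi> x = 0" "\<And>x. x \<notin> {-R..R} \<Longrightarrow> deriv \<psi> x = 0"
    "\<psi> (-R) = 0" "\<psi> R = 0"
    using test_function_support[OF \<psi>] by blast
  note C1 = test_function_C1[OF \<psi>]
  have i1: "set_integrable lborel {-R..R} (\<lambda>x. F x * deriv \<psi> x)"
    by (intro borel_integrable_atLeastAtMost' continuous_on_mult)
      (use ac_continuous[OF F] C1(2) continuous_on_subset in blast)+
  have i2: "set_integrable lborel {-R..R} (\<lambda>x. g x * \<psi> x)"
    using set_integrable_continuous_mult[OF C1(3) acD(1)[OF F, of "-R" R]] R(1)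
    by (simp add: mult.commute)
  show I1: "integrable lborel (\<lambda>x. F x * deriv \<psi> x)" "integrable lborel (\<lambda>x. g x * \<psi> x)"
    using lborel_integral_support(1)[OF _ i1] lborel_integral_support(1)[OF _ i2] R(2,3) by auto
  have "ac (\<lambda>x. F x * \<psi> x) (\<lambda>x. g x * \<psi> x + F x * deriv \<psi> x)"
    by (intro ac_mult F ac_C1 C1)
  from acD(2)[OF this, of "-R" R] R(1,4,5)
  have "integral {-R..R} (\<lambda>x. g x * \<psi> x + F x * deriv \<psi> x) = 0" by simp
  also have "integral {-R..R} (\<lambda>x. g x * \<psi> x + F x * deriv \<psi> x)
      = integral {-R..R} (\<lambda>x. g x * \<psi> x) + integral {-R..R} (\<lambda>x. F x * deriv \<psi> x)"
    using set_borel_integral_eq_integral(1)[OF i1] set_borel_integral_eq_integral(1)[OF i2]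
    by (intro Henstock_Kurzweil_Integration.integral_add)
  also have "\<dots> = (LBINT x. g x * \<psi> x) + (LBINT x. F x * deriv \<psi> x)"
    using lborel_integral_support(2)[OF _ i1] lborel_integral_support(2)[OF _ i2] R(2,3) by auto
  finally show "(LBINT x. F x * deriv \<psi> x) = - (LBINT x. g x * \<psi> x)" by simp
qed

section \<open>Primitives of locally integrable functions and Lebesgue points\<close>

lemma ex_ac:
  assumes g: "\<And>a b. set_integrable lborel {a..b} g"
  shows "\<exists>G. ac G g"
proof -
  have i: "g integrable_on {a..b}" for a b using set_borel_integral_eq_integral(1)[OF g] .
  define G where "G x = (if x \<ge> 0 then integral {0..x} g else - integral {x..0} g)" for x
  have "G b - G a = integral {a..b} g" if "a \<le> b" for a b
    using Henstock_Kurzweil_Integration.integral_combine[of 0 a b g, OF _ that i]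
      Henstock_Kurzweil_Integration.integral_combine[of a 0 b g, OF _ _ i]
      Henstock_Kurzweil_Integration.integral_combine[of a b 0 g, OF that _ i] that
    by (auto simp: G_def)
  then show ?thesis using g by (auto simp: ac_def)
qed

lemma sq_int_set_integrable:
  assumes "sq_int g"
  shows "set_integrable lborel {a..b} g"
proof -
  have "sq_int (indicator {a..b} :: real \<Rightarrow> real)"
  proof -
    have "(\<lambda>x. (indicator {a..b} x :: real)\<^sup>2) = indicator {a..b}" by (auto simp: indicator_def)
    moreover have "integrable lborel (indicator {a..b} :: real \<Rightarrow> real)"
      by (rule integrable_real_indicator) (auto simp: emeasure_lborel_Icc_eq)
    ultimately show ?thesis by (simp add: sq_int_def)
  qed
  from sq_int_mult[OF this assms] show ?thesis by (simp add: set_integrable_def)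
qed

lemma Lebesgue_points:
  fixes d :: "real \<Rightarrow> real"
  assumes "\<And>a b. d integrable_on {a..b}"
  obtains N where "negligible N"
    "\<And>x. x \<notin> N \<Longrightarrow> ((\<lambda>h. integral {x..x + h} d / h) \<longlongrightarrow> d x) (at_right 0)"
proof -
  obtain N where N: "negligible N" "\<And>x e. \<lbrakk>x \<notin> N; 0 < e\<rbrakk> \<Longrightarrow>
      \<exists>r>0. \<forall>h. 0 < h \<and> h < r \<longrightarrow> norm (integral (cbox x (x + h *\<^sub>R One)) d /\<^sub>R h ^ DIM(real) - d x) < e"
    using integrable_ccontinuous_explicit[of d] assms by (auto simp: cbox_interval)
  have "((\<lambda>h. integral {x..x + h} d / h) \<longlongrightarrow> d x) (at_right 0)" if xN: "x \<notin> N" for x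
  proof (rule tendstoI)
    fix e :: real assume "e > 0"
    then obtain r where r: "r > 0" "\<And>h. 0 < h \<Longrightarrow> h < r \<Longrightarrow> \<bar>integral {x..x + h} d / h - d x\<bar> < e"
      using N(2)[OF xN \<open>e > 0\<close>] by (auto simp: cbox_interval divide_inverse mult.commute)
    then show "\<forall>\<^sub>F h in at_right 0. dist (integral {x..x + h} d / h) (d x) < e"
      unfolding eventually_at_right_field by (auto simp: dist_real_def intro!: exI[of _ r])
  qed
  then show ?thesis using N(1) that by blast
qed

lemma negligible_AE:
  assumes "negligible N" "\<And>x. x \<notin> N \<Longrightarrow> P x"
  shows "AE x in lborel. P x"
proof -
  have "AE x in lebesgue. x \<notin> N"
    using assms(1) by (simp add: AE_not_in negligible_iff_null_sets)
  then have "AE x in lebesgue. P x" using assms(2) by auto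
  then show ?thesis by (simp add: AE_completion_iff)
qed

lemma ac_unique:
  assumes "ac F g" "ac F g'"
  shows "AE x in lborel. g x = g' x"
proof -
  have ac: "ac (\<lambda>x. 0) (\<lambda>x. g x - g' x)" using ac_diff[OF assms] by simp
  obtain N where N: "negligible N"
    "\<And>x. x \<notin> N \<Longrightarrow> ((\<lambda>h. integral {x..x + h} (\<lambda>x. g x - g' x) / h) \<longlongrightarrow> g x - g' x) (at_right 0)"
    using Lebesgue_points[of "\<lambda>x. g x - g' x"] ac_integrable_on[OF ac] by blast
  have "g x = g' x" if "x \<notin> N" for x
  proof -
    have "\<forall>\<^sub>F h in at_right 0. integral {x..x + h} (\<lambda>x. g x - g' x) / h = 0"
      using acD(2)[OF ac, of x] by (auto simp: eventually_at_right_field intro!: exI[of _ 1])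
    then have "((\<lambda>h. integral {x..x + h} (\<lambda>x. g x - g' x) / h) \<longlongrightarrow> 0) (at_right 0)"
      by (rule tendsto_eventually)
    from tendsto_unique[OF _ N(2)[OF that] this] show ?thesis by simp
  qed
  then show ?thesis by (rule negligible_AE[OF N(1)])
qed

text \<open>Testing with smooth approximations of the trapezoid that rises on \<open>[a, b]\<close> and
  falls on \<open>[a + h, b + h]\<close> shows that the integrals of a function with weak
  derivative zero are translation invariant; at Lebesgue points it is therefore constant.\<close>

lemma weak_deriv_zero_translation:
  fixes d :: "real \<Rightarrow> real"
  assumes loc: "\<And>a b. set_integrable lborel {a..b} d"
    and weak: "\<And>\<psi>. test_function \<psi> \<Longrightarrow> (LBINT x. d x * deriv \<psi> x) = 0"
    and ab: "a < b" and h: "h > 0"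
  shows "integral {a..b} d = integral {a + h..b + h} d"
proof -
  obtain T s \<kappa> where T: "smooth T" and sm: "continuous_on UNIV s" and TD: "\<And>x. (T has_real_derivative s x) (at x)"
    and s01: "\<And>x. 0 \<le> s x" "\<And>x. s x \<le> 1" and left: "\<And>x. x \<le> 0 \<Longrightarrow> T x = 0" "\<And>x. x \<le> 0 \<Longrightarrow> s x = 0"
    and right: "\<And>x. x \<ge> 1 \<Longrightarrow> T x = x - \<kappa>" "\<And>x. x \<ge> 1 \<Longrightarrow> s x = (1::real)"
    using ex_ramp by blast
  \<comment> \<open>For \<open>x > c\<close> and every corner \<open>y \<le> b + h\<close> the
    distance \<open>x - y\<close> exceeds 1, so all ramps have reached their affine part, whatever
    \<open>k\<close>.\<close>
  define c where "c = b + h + 1"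
  define U where "U k y x = (1 / real (Suc k)) * T (real (Suc k) * x + (- real (Suc k) * y))" for k y x
  \<comment> \<open>\<open>U k y\<close> smooths the positive part of \<open>x - y\<close>. With
    these signs the affine parts and the lag cancel beyond \<open>c\<close>, as
    \<open>a - b - (a + h) + (b + h) = 0\<close>; hence the support is compact.\<close>
  define \<Psi> where "\<Psi> k x = (U k a x + (-1) * U k b x) + ((-1) * U k (a + h) x + U k (b + h) x)" for k x
  define V where "V k y x = s (real (Suc k) * x + (- real (Suc k) * y))" for k y x
  define v where "v k x = (V k a x - V k b x) - (V k (a + h) x - V k (b + h) x)" for k x
  have arg: "real (Suc k) * x + (- real (Suc k) * y) = real (Suc k) * (x - y)" for k x y
    using right_diff_distrib[of "real (Suc k)" x y] by linarith
  have U0: "U k y x = 0" "V k y x = 0" if "x \<le> y" for k y x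
  proof -
    have "real (Suc k) * x + (- real (Suc k) * y) \<le> 0"
      unfolding arg using that by (intro mult_nonneg_nonpos) auto
    then show "U k y x = 0" "V k y x = 0" unfolding U_def V_def by (simp_all only: left mult_zero_right)
  qed
  have U1: "U k y x = x - y - \<kappa> / real (Suc k)" "V k y x = 1" if "real (Suc k) * (x - y) \<ge> 1" for k y x
  proof -
    have *: "real (Suc k) * x + (- real (Suc k) * y) \<ge> 1" using that unfolding arg .
    show "V k y x = 1" unfolding V_def using right(2)[OF *] .
    show "U k y x = x - y - \<kappa> / real (Suc k)"
      unfolding U_def right(1)[OF *] by (simp add: field_simps)
  qed
  have far: "real (Suc k) * (x - y) \<ge> 1" if "x - y \<ge> 1" for k x y
    using mult_mono[of 1 "real (Suc k)" 1 "x - y"] that by simp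
  have UD: "(U k y has_real_derivative V k y x) (at x)" for k y x
  proof -
    have "(U k y has_real_derivative
        (1 / real (Suc k)) * (s (real (Suc k) * x + (- real (Suc k) * y)) * real (Suc k))) (at x)"
      unfolding U_def by (intro DERIV_cmult DERIV_chain2[OF TD]) (auto intro!: derivative_eq_intros)
    then show ?thesis by (simp add: V_def)
  qed
  have \<Psi>D: "deriv (\<Psi> k) x = v k x" for k x
  proof (rule DERIV_imp_deriv)
    have "(\<Psi> k has_real_derivative (V k a x + (-1) * V k b x)
        + ((-1) * V k (a + h) x + V k (b + h) x)) (at x)"
      unfolding \<Psi>_def by (intro DERIV_add DERIV_cmult UD)
    moreover have "(V k a x + (-1) * V k b x) + ((-1) * V k (a + h) x + V k (b + h) x) = v k x"
      by (simp add: v_def)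
    ultimately show "(\<Psi> k has_real_derivative v k x) (at x)" by (simp only:)
  qed
  have test: "test_function (\<Psi> k)" for k
  proof (rule smooth_test_function)
    show "smooth (\<Psi> k)"
      unfolding \<Psi>_def U_def by (intro smooth.add smooth.mult smooth.const smooth.affine T)
    fix x assume "x \<notin> {a..c}"
    then consider "x < a" | "x > c" by fastforce
    then show "\<Psi> k x = 0"
    proof cases
      case 1
      then show ?thesis using ab h by (simp add: \<Psi>_def U0)
    next
      case 2
      have "U k y x = x - y - \<kappa> / real (Suc k)" if "y \<le> b + h" for y
        using that 2 by (intro U1(1) far) (simp add: c_def)
      then show ?thesis using ab h by (simp add: \<Psi>_def)
    qed
  qed
  have v0: "v k x = 0" if "x \<notin> {a..c}" for k x
  proof -
    consider "x < a" | "x > c" using \<open>x \<notin> {a..c}\<close> by fastforce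
    then show ?thesis
    proof cases
      case 1
      then show ?thesis using ab h by (simp add: v_def U0)
    next
      case 2
      have "V k y x = 1" if "y \<le> b + h" for y
        using that 2 by (intro U1(2) far) (simp add: c_def)
      then show ?thesis using ab h by (simp add: v_def)
    qed
  qed
  have V01: "0 \<le> V k y x" "V k y x \<le> 1" for k y x using s01 by (auto simp: V_def)
  have v2: "\<bar>v k x\<bar> \<le> 2" for k x
    using V01[of k a x] V01[of k b x] V01[of k "a + h" x] V01[of k "b + h" x] by (simp add: v_def)
  define i where "i y x = (indicator {y<..} x :: real)" for y x :: real
  have Vlim: "(\<lambda>k. V k y x) \<longlonglongrightarrow> i y x" for y x
  proof (cases "x \<le> y")
    case True
    then show ?thesis using U0 by (simp add: i_def)
  next
    case False
    then obtain N where N: "real N * (x - y) > 1"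
      using ex_less_of_nat_mult[of "x - y" 1] by auto
    have "V k y x = 1" if "k \<ge> N" for k
    proof (rule U1(2))
      have "real N * (x - y) \<le> real (Suc k) * (x - y)" using that False by (intro mult_right_mono) auto
      then show "1 \<le> real (Suc k) * (x - y)" using N by simp
    qed
    then have "\<forall>\<^sub>F k in sequentially. V k y x = i y x"
      using False by (intro eventually_sequentiallyI[of N]) (simp add: i_def)
    then show ?thesis by (rule tendsto_eventually)
  qed
  define w where "w x = (i a x - i b x) - (i (a + h) x - i (b + h) x)" for x :: real
  have dI: "set_integrable lborel {a..c} d" by (rule loc)
  have dm: "(\<lambda>x. indicator {a..c} x * d x) \<in> borel_measurable lborel"
    using dI by (auto simp: set_integrable_def dest: borel_measurable_integrable)
  have im [measurable]: "i y \<in> borel_measurable borel" for y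
    unfolding i_def by measurable
  have wm: "w \<in> borel_measurable borel" unfolding w_def by measurable
  have vm: "v k \<in> borel_measurable borel" for k
    unfolding v_def V_def by (intro borel_measurable_continuous_onI continuous_intros
        continuous_on_compose2[OF sm]) auto
  have eqv: "d x * v k x = (indicator {a..c} x * d x) * v k x" for k x
    using v0[of x k] by (cases "x \<in> {a..c}") auto
  have "(\<lambda>k. LBINT x. (indicator {a..c} x * d x) * v k x)
      \<longlonglongrightarrow> (LBINT x. (indicator {a..c} x * d x) * w x)"
  proof (rule integral_dominated_convergence)
    show "(\<lambda>x. (indicator {a..c} x * d x) * v k x) \<in> borel_measurable lborel" for k
      by (rule borel_measurable_times[OF dm]) (use vm in simp)
    show "(\<lambda>x. (indicator {a..c} x * d x) * w x) \<in> borel_measurable lborel"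
      by (rule borel_measurable_times[OF dm]) (use wm in simp)
    show "integrable lborel (\<lambda>x. 2 * \<bar>indicator {a..c} x * d x\<bar>)"
      using dI by (simp add: set_integrable_def)
    show "AE x in lborel. norm (indicator {a..c} x * d x * v k x) \<le> 2 * \<bar>indicator {a..c} x * d x\<bar>" for k
    proof (rule AE_I2)
      fix x
      have "\<bar>indicator {a..c} x * d x\<bar> * \<bar>v k x\<bar> \<le> \<bar>indicator {a..c} x * d x\<bar> * 2"
        using v2 by (intro mult_left_mono) auto
      then show "norm (indicator {a..c} x * d x * v k x) \<le> 2 * \<bar>indicator {a..c} x * d x\<bar>"
        by (simp add: abs_mult)
    qed
    have "(\<lambda>k. v k x) \<longlonglongrightarrow> w x" for x unfolding v_def w_def by (intro tendsto_diff Vlim)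
    then show "AE x in lborel. (\<lambda>k. indicator {a..c} x * d x * v k x) \<longlonglongrightarrow> indicator {a..c} x * d x * w x"
      by (intro AE_I2 tendsto_mult tendsto_const)
  qed
  moreover have "(LBINT x. (indicator {a..c} x * d x) * v k x) = 0" for k
    using weak[OF test[of k]] unfolding \<Psi>D eqv .
  ultimately have 0: "(LBINT x. (indicator {a..c} x * d x) * w x) = 0"
    by (simp add: LIMSEQ_const_iff)
  have set: "(LBINT x. indicator {p..q} x * d x) = integral {p..q} d"
    "integrable lborel (\<lambda>x. indicator {p..q} x * d x)" for p q
    using set_borel_integral_eq_integral(2)[OF loc, of p q] loc[of p q]
    by (auto simp: set_lebesgue_integral_def set_integrable_def)
  have "(LBINT x. (indicator {a..c} x * d x) * w x)
      = (LBINT x. indicator {a..b} x * d x - indicator {a + h..b + h} x * d x)"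
  proof (rule integral_cong_AE)
    show "(\<lambda>x. (indicator {a..c} x * d x) * w x) \<in> borel_measurable lborel"
      by (rule borel_measurable_times[OF dm]) (use wm in simp)
    show "(\<lambda>x. indicator {a..b} x * d x - indicator {a + h..b + h} x * d x) \<in> borel_measurable lborel"
      using set(2) by (intro borel_measurable_diff borel_measurable_integrable)
    \<comment> \<open>The limits \<open>i\<close> give half-open intervals, which differ from the
      closed ones at the left end points only.\<close>
    have "AE x in lborel. x \<noteq> a \<and> x \<noteq> a + h"
      by (intro AE_conjI AE_lborel_singleton)
    then show "AE x in lborel. (indicator {a..c} x * d x) * w x
        = indicator {a..b} x * d x - indicator {a + h..b + h} x * d x"
    proof eventually_elim
      case (elim x)
      have "indicator {a..c} x * w x = (indicator {a..b} x - indicator {a + h..b + h} x :: real)"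
        using elim ab h by (auto simp: w_def i_def c_def indicator_def)
      then show ?case by (metis (no_types, opaque_lifting) left_diff_distrib mult.assoc mult.commute)
    qed
  qed
  also have "\<dots> = integral {a..b} d - integral {a + h..b + h} d"
    using set by simp
  finally show ?thesis using 0 by simp
qed

text \<open>After subtraction of a primitive of \<open>g\<close> the weak derivative is zero. By
  translation invariance the averages over intervals of equal length at two Lebesgue points agree,
  and so do the values there.\<close>

lemma du_Bois_Reymond:
  assumes f: "\<And>a b. set_integrable lborel {a..b} f" and g: "\<And>a b. set_integrable lborel {a..b} g"
    and weak: "\<And>\<psi>. test_function \<psi> \<Longrightarrow> (LBINT x. f x * deriv \<psi> x) = - (LBINT x. g x * \<psi> x)"
  shows "\<exists>F. ac F g \<and> (AE x in lborel. f x = F x)"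
proof -
  obtain G where G: "ac G g" using ex_ac[OF g] by blast
  define d where "d x = f x - G x" for x
  have Gi: "set_integrable lborel {a..b} G" for a b
    using ac_continuous[OF G] by (intro borel_integrable_atLeastAtMost') (rule continuous_on_subset, auto)
  have di: "set_integrable lborel {a..b} d" for a b
    unfolding d_def by (intro set_integral_diff f Gi)
  have dw: "(LBINT x. d x * deriv \<psi> x) = 0" if \<psi>: "test_function \<psi>" for \<psi>
  proof -
    obtain R where R: "\<And>x. x \<notin> {-R..R} \<Longrightarrow> deriv \<psi> x = 0"
      using test_function_support[OF \<psi>] by blast
    have "set_integrable lborel {-R..R} (\<lambda>x. deriv \<psi> x * f x)"
      by (rule set_integrable_continuous_mult[OF test_function_C1(2)[OF \<psi>] f])
    then have fi: "integrable lborel (\<lambda>x. f x * deriv \<psi> x)"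
      using R by (intro lborel_integral_support(1)[of "-R" R]) (auto simp: mult.commute)
    have "(LBINT x. d x * deriv \<psi> x) = (LBINT x. f x * deriv \<psi> x - G x * deriv \<psi> x)"
      by (simp add: d_def left_diff_distrib)
    also have "\<dots> = (LBINT x. f x * deriv \<psi> x) - (LBINT x. G x * deriv \<psi> x)"
      using fi integral_by_parts_test(1)[OF G \<psi>] by simp
    finally show ?thesis using weak[OF \<psi>] integral_by_parts_test(3)[OF G \<psi>] by simp
  qed
  obtain N where N: "negligible N"
    "\<And>x. x \<notin> N \<Longrightarrow> ((\<lambda>h. integral {x..x + h} d / h) \<longlongrightarrow> d x) (at_right 0)"
    using Lebesgue_points[of d] set_borel_integral_eq_integral(1)[OF di] by blast
  have le: "d x = d y" if "x \<notin> N" "y \<notin> N" "x < y" for x y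
  proof -
    have "integral {x..x + h} d = integral {y..y + h} d" if "h > 0" for h
      using weak_deriv_zero_translation[OF di dw, of x "x + h" "y - x"] that \<open>x < y\<close>
      by (simp add: algebra_simps)
    then have "\<forall>\<^sub>F h in at_right 0. integral {x..x + h} d / h = integral {y..y + h} d / h"
      by (auto simp: eventually_at_right_field intro!: exI[of _ 1])
    with N(2)[OF that(1)] have "((\<lambda>h. integral {y..y + h} d / h) \<longlongrightarrow> d x) (at_right 0)"
      by (rule Lim_transform_eventually)
    from tendsto_unique[OF _ this N(2)[OF that(2)]] show ?thesis by simp
  qed
  have "N \<noteq> UNIV" using N(1) non_negligible_UNIV by auto
  then obtain x0 where x0: "x0 \<notin> N" by blast
  have const: "f x = d x0 + G x" if "x \<notin> N" for x
  proof -
    have "d x = d x0"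
    proof (cases x x0 rule: linorder_cases)
      case less
      then show ?thesis by (rule le[OF that x0])
    next
      case equal
      then show ?thesis by (rule arg_cong)
    next
      case greater
      then show ?thesis by (rule le[OF x0 that, symmetric])
    qed
    then show ?thesis unfolding d_def[of x] by linarith
  qed
  have "AE x in lborel. f x = d x0 + G x"
    by (rule negligible_AE[OF N(1) const])
  moreover have "ac (\<lambda>x. d x0 + G x) g" using ac_add[OF ac_const G] by simp
  ultimately show ?thesis by blast
qed

section \<open>The space H1\<close>

lemma AE_lebesgue_iff: "(AE x in lebesgue. P x) \<longleftrightarrow> (AE x in lborel. P x)"
  by (rule AE_completion_iff)

text \<open>Lebesgue measurable members of \<open>L2\<close> are replaced by Borel representatives,
  to which the preceding theory applies.\<close>

lemma L2_ex_sq_int: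
  assumes "f \<in> L2"
  shows "\<exists>f'. sq_int f' \<and> (AE x in lebesgue. f x = f' x)"
proof -
  have f: "f \<in> borel_measurable lebesgue" "integrable lebesgue (\<lambda>x. (f x)\<^sup>2)"
    using assms by (auto simp: L2_def)
  obtain f' where f': "f' \<in> borel_measurable lborel" "AE x in lborel. f x = f' x"
    using completion_ex_borel_measurable_real[OF f(1)] by blast
  have ae: "AE x in lebesgue. f x = f' x" using f'(2) by (simp add: AE_lebesgue_iff)
  have fl: "f' \<in> borel_measurable lebesgue" using f'(1) by (rule measurable_completion)
  have fb: "f' \<in> borel_measurable borel" using f'(1) by simp
  have "integrable lebesgue (\<lambda>x. (f' x)\<^sup>2)"
    by (rule iffD1[OF integrable_cong_AE f(2)]) (use ae f(1) fl in auto)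
  moreover have "(\<lambda>x. (f' x)\<^sup>2) \<in> borel_measurable lborel"
    using fb by simp
  ultimately have "integrable lborel (\<lambda>x. (f' x)\<^sup>2)"
    by (simp add: integrable_completion)
  then show ?thesis using fb ae by (auto simp: sq_int_def)
qed

lemma AE_sq_int_L2:
  assumes f: "f \<in> borel_measurable lebesgue" and ae: "AE x in lebesgue. f x = F x" and F: "sq_int F"
  shows "f \<in> L2" "(\<integral>x. (f x)\<^sup>2 \<partial>lebesgue) = (l2 F)\<^sup>2"
proof -
  have Fb: "F \<in> borel_measurable borel" using F by (simp add: sq_int_def)
  then have Fl: "F \<in> borel_measurable lebesgue" by (intro measurable_completion) simp
  have F2: "(\<lambda>x. (F x)\<^sup>2) \<in> borel_measurable lborel" using Fb by simp
  have i: "integrable lebesgue (\<lambda>x. (F x)\<^sup>2)"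
    using F F2 by (simp add: sq_int_def integrable_completion)
  have "integrable lebesgue (\<lambda>x. (f x)\<^sup>2)"
    by (rule iffD1[OF integrable_cong_AE i]) (use ae f Fl in auto)
  then show "f \<in> L2" using f by (simp add: L2_def)
  have "(\<integral>x. (f x)\<^sup>2 \<partial>lebesgue) = (\<integral>x. (F x)\<^sup>2 \<partial>lebesgue)"
    by (rule integral_cong_AE) (use ae f Fl in auto)
  also have "\<dots> = (l2 F)\<^sup>2" using F2 by (simp add: integral_completion l2_sq)
  finally show "(\<integral>x. (f x)\<^sup>2 \<partial>lebesgue) = (l2 F)\<^sup>2" .
qed

lemma integral_lebesgue_cong:
  fixes f F h :: "real \<Rightarrow> real"
  assumes f: "f \<in> borel_measurable lebesgue" and ae: "AE x in lebesgue. f x = F x"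
    and F: "F \<in> borel_measurable borel" and h: "continuous_on UNIV h"
  shows "(\<integral>x. f x * h x \<partial>lebesgue) = (LBINT x. F x * h x)"
proof -
  have Fl: "F \<in> borel_measurable lebesgue" using F by (intro measurable_completion) simp
  have hb: "h \<in> borel_measurable borel" using h by (rule borel_measurable_continuous_onI)
  then have hl: "h \<in> borel_measurable lebesgue" by (intro measurable_completion) simp
  have Fh: "(\<lambda>x. F x * h x) \<in> borel_measurable lborel" using F hb by simp
  have "(\<integral>x. f x * h x \<partial>lebesgue) = (\<integral>x. F x * h x \<partial>lebesgue)"
    by (rule integral_cong_AE) (use ae f Fl hl in auto)
  also have "\<dots> = (LBINT x. F x * h x)" by (rule integral_completion[OF Fh])
  finally show ?thesis .
qed

lemma continuous_AE_eq:
  fixes F G :: "real \<Rightarrow> real"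
  assumes "continuous_on UNIV F" "continuous_on UNIV G" "AE x in lborel. F x = G x"
  shows "F x = G x"
proof -
  have "closed {x. F x = G x}" by (intro closed_Collect_eq assms)
  moreover have "AE x in lebesgue. x \<in> {x. F x = G x}" using assms(3) by (simp add: AE_lebesgue_iff)
  ultimately show ?thesis using mem_closed_if_AE_lebesgue by blast
qed

lemma weak_deriv_ex_ac:
  assumes f: "f \<in> borel_measurable lebesgue" "AE x in lebesgue. f x = f' x" "sq_int f'"
    and g: "g \<in> borel_measurable lebesgue" "AE x in lebesgue. g x = g' x" "sq_int g'"
    and weak: "has_weak_deriv f g"
  shows "\<exists>F. ac F g' \<and> (AE x in lborel. f' x = F x)"
proof (rule du_Bois_Reymond)
  fix \<psi> assume \<psi>: "test_function \<psi>"
  have "(LBINT x. f' x * deriv \<psi> x) = (\<integral>x. f x * deriv \<psi> x \<partial>lebesgue)"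
    using f test_function_C1(2)[OF \<psi>]
    by (intro integral_lebesgue_cong[symmetric]) (auto simp: sq_int_def)
  also have "\<dots> = - (\<integral>x. g x * \<psi> x \<partial>lebesgue)"
    using weak \<psi> by (simp add: has_weak_deriv_def)
  also have "(\<integral>x. g x * \<psi> x \<partial>lebesgue) = (LBINT x. g' x * \<psi> x)"
    using g test_function_C1(3)[OF \<psi>]
    by (intro integral_lebesgue_cong) (auto simp: sq_int_def)
  finally show "(LBINT x. f' x * deriv \<psi> x) = - (LBINT x. g' x * \<psi> x)" .
qed (use f(3) g(3) sq_int_set_integrable in auto)

lemma sq_int_AE_continuous:
  assumes "sq_int f" "AE x in lborel. f x = F x" "continuous_on UNIV F"
  shows "sq_int F"
proof -
  have F: "F \<in> borel_measurable borel" using assms(3) by (rule borel_measurable_continuous_onI)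
  have f: "f \<in> borel_measurable borel" using assms(1) by (simp add: sq_int_def)
  have "integrable lborel (\<lambda>x. (F x)\<^sup>2)"
    by (rule iffD1[OF integrable_cong_AE sq_int_integrable[OF assms(1)]])
       (use assms(2) f F in auto)
  then show ?thesis using F by (simp add: sq_int_def)
qed

lemma H1_ex_ac:
  assumes "f \<in> H1"
  shows "\<exists>F g. ac F g \<and> sq_int F \<and> sq_int g \<and> (AE x in lebesgue. f x = F x)"
proof -
  obtain g where g: "f \<in> L2" "g \<in> L2" "has_weak_deriv f g" using assms by (auto simp: H1_def)
  obtain f' g' where f': "sq_int f'" "AE x in lebesgue. f x = f' x"
    and g': "sq_int g'" "AE x in lebesgue. g x = g' x"
    using L2_ex_sq_int g by meson
  obtain F where F: "ac F g'" "AE x in lborel. f' x = F x"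
    using weak_deriv_ex_ac[of f f' g g'] f' g' g by (auto simp: L2_def)
  have "sq_int F" using sq_int_AE_continuous[OF f'(1) F(2) ac_continuous[OF F(1)]] .
  moreover have "AE x in lebesgue. f x = F x"
    using f'(2) F(2) unfolding AE_lebesgue_iff by eventually_elim simp
  ultimately show ?thesis using F(1) g'(1) by blast
qed

text \<open>\<open>wderiv\<close> is an arbitrary choice, so its identification with
  \<open>g\<close> needs uniqueness: the chosen derivative also has an absolutely continuous
  primitive equal to \<open>F\<close> almost everywhere, by continuity this primitive is
  \<open>F\<close>, and \<open>ac_unique\<close> applies.\<close>

lemma H1_I:
  assumes ac: "ac F g" and F: "sq_int F" and g: "sq_int g"
    and f: "f \<in> borel_measurable lebesgue" and ae: "AE x in lebesgue. f x = F x"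
  shows "f \<in> H1" "wderiv f \<in> borel_measurable lebesgue" "AE x in lebesgue. wderiv f x = g x"
    "H1_norm f = sqrt ((l2 F)\<^sup>2 + (l2 g)\<^sup>2)"
proof -
  have gb: "g \<in> borel_measurable borel" using g by (simp add: sq_int_def)
  then have gl: "g \<in> borel_measurable lebesgue" by (intro measurable_completion) simp
  have fL: "f \<in> L2" by (rule AE_sq_int_L2(1)[OF f ae F])
  have gL: "g \<in> L2" by (rule AE_sq_int_L2(1)[OF gl _ g]) simp
  have weak: "has_weak_deriv f g"
    unfolding has_weak_deriv_def
  proof (intro allI impI)
    fix \<psi> assume \<psi>: "test_function \<psi>"
    have "(\<integral>x. f x * deriv \<psi> x \<partial>lebesgue) = (LBINT x. F x * deriv \<psi> x)"
      using F test_function_C1(2)[OF \<psi>] by (intro integral_lebesgue_cong f ae) (auto simp: sq_int_def)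
    also have "\<dots> = - (LBINT x. g x * \<psi> x)" by (rule integral_by_parts_test(3)[OF ac \<psi>])
    also have "(LBINT x. g x * \<psi> x) = (\<integral>x. g x * \<psi> x \<partial>lebesgue)"
      using test_function_C1(3)[OF \<psi>] by (intro integral_lebesgue_cong[symmetric] gl gb) auto
    finally show "(\<integral>x. f x * deriv \<psi> x \<partial>lebesgue) = - (\<integral>x. g x * \<psi> x \<partial>lebesgue)" .
  qed
  show "f \<in> H1" using fL gL weak by (auto simp: H1_def)
  have w: "wderiv f \<in> L2 \<and> has_weak_deriv f (wderiv f)"
    unfolding wderiv_def by (rule someI[of _ g]) (use gL weak in simp)
  then show wm: "wderiv f \<in> borel_measurable lebesgue" by (simp add: L2_def)
  obtain g' where g': "sq_int g'" "AE x in lebesgue. wderiv f x = g' x"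
    using L2_ex_sq_int w by blast
  obtain F' where F': "ac F' g'" "AE x in lborel. F x = F' x"
    using weak_deriv_ex_ac[OF f ae F wm g'(2,1)] w by blast
  have "F = F'"
    using continuous_AE_eq[OF ac_continuous[OF ac] ac_continuous[OF F'(1)] F'(2)] by auto
  then have "AE x in lborel. g x = g' x" using ac_unique ac F'(1) by blast
  then show wae: "AE x in lebesgue. wderiv f x = g x"
    using g'(2) unfolding AE_lebesgue_iff by eventually_elim simp
  show "H1_norm f = sqrt ((l2 F)\<^sup>2 + (l2 g)\<^sup>2)"
    unfolding H1_norm_def using AE_sq_int_L2(2)[OF f ae F] AE_sq_int_L2(2)[OF wm wae g] by simp
qed

lemma ac_diff_bound:
  assumes "ac f j" "integrable lborel j"
  shows "\<bar>f x - f y\<bar> \<le> (LBINT x. \<bar>j x\<bar>)"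
proof -
  have *: "\<bar>f b - f a\<bar> \<le> (LBINT x. \<bar>j x\<bar>)" if "a \<le> b" for a b
  proof -
    have "f b - f a = (LBINT x. indicator {a..b} x * j x)"
      using set_borel_integral_eq_integral(2)[OF acD(1)[OF assms(1) that]] acD(2)[OF assms(1) that]
      by (simp add: set_lebesgue_integral_def)
    also have "\<bar>\<dots>\<bar> \<le> (LBINT x. \<bar>indicator {a..b} x * j x\<bar>)"
      by (rule integral_abs_bound)
    also have "\<dots> \<le> (LBINT x. \<bar>j x\<bar>)"
    proof (rule integral_mono)
      show "integrable lborel (\<lambda>x. \<bar>indicator {a..b} x * j x\<bar>)"
        using acD(1)[OF assms(1) that] by (auto simp: set_integrable_def)
    qed (use assms(2) in \<open>auto simp: indicator_def\<close>)
    finally show ?thesis .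
  qed
  show ?thesis using *[of x y] *[of y x] by (cases "x \<le> y") (simp_all add: abs_minus_commute)
qed

text \<open>The Sobolev embedding on the line: \<open>F^2\<close> has the integrable derivative
  \<open>2 F g\<close>, so its variation is finite.\<close>

lemma ac_sq_int_bounded:
  assumes ac: "ac F g" and F: "sq_int F" and g: "sq_int g"
  shows "\<exists>C. \<forall>x. \<bar>F x\<bar> \<le> C"
proof -
  have "ac (\<lambda>x. F x * F x) (\<lambda>x. g x * F x + F x * g x)" by (rule ac_mult[OF ac ac])
  moreover have "integrable lborel (\<lambda>x. g x * F x + F x * g x)"
    using sq_int_mult[OF F g] sq_int_mult[OF g F] by simp
  ultimately have b: "\<bar>F x * F x - F 0 * F 0\<bar> \<le> (LBINT x. \<bar>g x * F x + F x * g x\<bar>)" for x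
    by (rule ac_diff_bound)
  define C where "C = F 0 * F 0 + (LBINT x. \<bar>g x * F x + F x * g x\<bar>)"
  have "(F x)\<^sup>2 \<le> C" for x using b[of x] unfolding C_def power2_eq_square by linarith
  then have "\<bar>F x\<bar> \<le> sqrt C" for x using real_le_rsqrt[of "\<bar>F x\<bar>" C] by simp
  then show ?thesis by blast
qed

lemma ac_cong_AE:
  assumes "ac F g" "AE x in lborel. g x = g' x" "\<And>a b. set_integrable lborel {a..b} g'"
  shows "ac F g'"
  unfolding ac_def
proof (intro allI impI conjI)
  fix a b :: real assume ab: "a \<le> b"
  show i: "set_integrable lborel {a..b} g'" by (rule assms(3))
  have "(LINT x:{a..b}|lborel. g x) = (LINT x:{a..b}|lborel. g' x)"
    unfolding set_lebesgue_integral_def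
  proof (rule integral_cong_AE)
    show "(\<lambda>x. indicator {a..b} x *\<^sub>R g x) \<in> borel_measurable lborel"
      using acD(1)[OF assms(1) ab] unfolding set_integrable_def by (rule borel_measurable_integrable)
    show "(\<lambda>x. indicator {a..b} x *\<^sub>R g' x) \<in> borel_measurable lborel"
      using i unfolding set_integrable_def by (rule borel_measurable_integrable)
    show "AE x in lborel. indicator {a..b} x *\<^sub>R g x = indicator {a..b} x *\<^sub>R g' x"
      using assms(2) by eventually_elim simp
  qed
  then show "F b - F a = integral {a..b} g'"
    using set_borel_integral_eq_integral(2)[OF acD(1)[OF assms(1) ab]]
      set_borel_integral_eq_integral(2)[OF i] acD(2)[OF assms(1) ab] by simp
qed

text \<open>In terms of the flux potential \<open>p\<close>, which vanishes at infinity and satisfies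
  \<open>p' = u\<close>, the weak equation says \<open>\<phi>\<^sup>n (u_z - 1) = p - 1\<close>.\<close>

lemma flux_potential_unique_weak_solution:
  fixes b :: "real \<Rightarrow> real"
  assumes b: "continuous_on UNIV b" "\<And>x. c \<le> b x" "\<And>x. b x \<le> C" and c: "c > 0"
    and \<phi>: "\<And>x. \<phi> x powr n = 1 / b x"
    and p: "ac (ap p) (ap u)" and u: "ac (ap u) (ap d)"
    and d: "\<And>x. ap d x = b x * ap p x + 1 - b x"
  shows "unique_weak_solution n \<phi> (ap u)"
proof -
  have b0: "b x > 0" for x using b(2)[of x] c by simp
  define a where "a x = 1 / b x" for x
  have a: "continuous_on UNIV a" unfolding a_def using b0
    by (intro continuous_intros b(1)) (metis less_irrefl)
  have leb: "ap f \<in> borel_measurable lebesgue" for f by (intro measurable_completion) simp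
  have C1: "continuous_on UNIV (\<lambda>x. a x * deriv \<psi> x)" if "test_function \<psi>" for \<psi>
    by (intro continuous_on_mult a test_function_C1(2)[OF that])
  note uH = H1_I[OF u sq_int_ap sq_int_ap leb AE_I2]
  have u1: "ap u \<in> H1" and um: "wderiv (ap u) \<in> borel_measurable lebesgue"
    and uae: "AE x in lebesgue. wderiv (ap u) x = ap d x" using uH by auto
  \<comment> \<open>The flux relation \<open>a * (d - 1) = p - 1\<close> multiplied by
    \<open>y\<close>; the constant 1 drops out when \<open>y\<close> is the derivative of a test
    function.\<close>
  have flux: "ap d x * (a x * y) = ap p x * y - 1 * y + a x * y" for x y
    unfolding a_def d using b0[of x] by (simp add: field_simps)
  have int_a: "integrable lborel (\<lambda>x. a x * deriv \<psi> x)"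
    "(\<integral>x. \<phi> x powr n * deriv \<psi> x \<partial>lebesgue) = (LBINT x. a x * deriv \<psi> x)"
    if \<psi>: "test_function \<psi>" for \<psi>
  proof -
    obtain R where R: "\<And>x. x \<notin> {-R..R} \<Longrightarrow> deriv \<psi> x = 0"
      using test_function_support[OF \<psi>] by blast
    have "set_integrable lborel {-R..R} (\<lambda>x. a x * deriv \<psi> x)"
      by (rule borel_integrable_atLeastAtMost'[OF continuous_on_subset[OF C1[OF \<psi>]]]) simp
    then show "integrable lborel (\<lambda>x. a x * deriv \<psi> x)"
      using R by (intro lborel_integral_support(1)) auto
    have "(\<lambda>x. a x * deriv \<psi> x) \<in> borel_measurable lborel"
      using borel_measurable_continuous_onI[OF C1[OF \<psi>]] by simp
    from integral_completion[OF this]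
    show "(\<integral>x. \<phi> x powr n * deriv \<psi> x \<partial>lebesgue) = (LBINT x. a x * deriv \<psi> x)"
      unfolding \<phi> a_def .
  qed
  have weak_int: "(\<integral>x. \<phi> x powr n * w' x * deriv \<psi> x \<partial>lebesgue) = (LBINT x. g x * (a x * deriv \<psi> x))"
    if \<psi>: "test_function \<psi>" and w': "w' \<in> borel_measurable lebesgue" "AE x in lebesgue. w' x = g x"
      "g \<in> borel_measurable borel" for \<psi> w' g
  proof -
    have "(\<integral>x. \<phi> x powr n * w' x * deriv \<psi> x \<partial>lebesgue) = (\<integral>x. w' x * (a x * deriv \<psi> x) \<partial>lebesgue)"
      unfolding \<phi> a_def by (simp add: mult_ac)
    also have "\<dots> = (LBINT x. g x * (a x * deriv \<psi> x))"
      by (rule integral_lebesgue_cong[OF w' C1[OF \<psi>]])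
    finally show ?thesis .
  qed
  have weak_u: "(LBINT x. ap d x * (a x * deriv \<psi> x)) + (LBINT x. ap u x * \<psi> x)
      = (LBINT x. a x * deriv \<psi> x)" if \<psi>: "test_function \<psi>" for \<psi>
  proof -
    have "(LBINT x. ap d x * (a x * deriv \<psi> x))
        = (LBINT x. ap p x * deriv \<psi> x) - (LBINT x. 1 * deriv \<psi> x) + (LBINT x. a x * deriv \<psi> x)"
      unfolding flux using integral_by_parts_test(1)[OF p \<psi>] integral_by_parts_test(1)[OF ac_const[of 1] \<psi>]
        int_a(1)[OF \<psi>] by simp
    moreover have "(LBINT x. 1 * deriv \<psi> x) = 0"
      using integral_by_parts_test(3)[OF ac_const[of 1] \<psi>] by simp
    ultimately show ?thesis using integral_by_parts_test(3)[OF p \<psi>] by simp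
  qed
  have lebu: "(\<integral>x. f x * \<psi> x \<partial>lebesgue) = (LBINT x. F x * \<psi> x)"
    if "test_function \<psi>" "f \<in> borel_measurable lebesgue" "AE x in lebesgue. f x = F x"
      "F \<in> borel_measurable borel" for \<psi> f F
    using that test_function_C1(3) by (intro integral_lebesgue_cong) auto
  have "weak_solution n \<phi> (ap u)"
    unfolding weak_solution_def
  proof (intro conjI allI impI u1)
    fix \<psi> assume \<psi>: "test_function \<psi>"
    show "(\<integral>z. \<phi> z powr n * wderiv (ap u) z * deriv \<psi> z \<partial>lebesgue) + (\<integral>z. ap u z * \<psi> z \<partial>lebesgue)
        = (\<integral>z. \<phi> z powr n * deriv \<psi> z \<partial>lebesgue)"
      using weak_int[OF \<psi> um uae] lebu[OF \<psi> leb, of u "ap u"] int_a(2)[OF \<psi>] weak_u[OF \<psi>] by simp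
  qed
  moreover have "AE z in lebesgue. w z = ap u z" if w: "weak_solution n \<phi> w" for w
  proof -
    have wH: "w \<in> H1" using w by (simp add: weak_solution_def)
    then have wm: "w \<in> borel_measurable lebesgue" by (simp add: H1_def L2_def)
    obtain F g where F: "ac F g" "sq_int F" "sq_int g" "AE x in lebesgue. w x = F x"
      using H1_ex_ac[OF wH] by blast
    note wI = H1_I[OF F(1-3) wm F(4)]
    have gb: "g \<in> borel_measurable borel" and Fb: "F \<in> borel_measurable borel"
      using F by (auto simp: sq_int_def)
    \<comment> \<open>The difference of two solutions, with derivative \<open>e\<close>. Test
      functions have compact support, so \<open>v\<close> cannot be inserted into the weak equation;
      instead \<open>du_Bois_Reymond\<close> turns the equation into \<open>Q' = v\<close> for a
      continuous representative \<open>Q\<close> of the flux \<open>a * e\<close>.\<close>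
    define v where "v x = F x - ap u x" for x
    define e where "e x = g x - ap d x" for x
    have ve: "ac v e" unfolding v_def e_def by (rule ac_diff[OF F(1) u])
    have vs: "sq_int v" and es: "sq_int e" unfolding v_def e_def by (intro sq_int_diff F sq_int_ap)+
    have a_le: "\<bar>a x\<bar> \<le> 1 / c" for x
      using b0[of x] b(2)[of x] c by (simp add: a_def frac_le)
    have am: "a \<in> borel_measurable borel" using a by (rule borel_measurable_continuous_onI)
    have qs: "sq_int (\<lambda>x. a x * e x)"
    proof (rule sq_int_bound[OF es])
      show "(\<lambda>x. a x * e x) \<in> borel_measurable borel" using am es by (auto simp: sq_int_def)
      show "\<bar>a x * e x\<bar> \<le> 1 / c * \<bar>e x\<bar>" for x
        unfolding abs_mult using a_le by (intro mult_right_mono) auto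
    qed
    have "\<exists>Q. ac Q v \<and> (AE x in lborel. a x * e x = Q x)"
    proof (rule du_Bois_Reymond)
      fix \<psi> assume \<psi>: "test_function \<psi>"
      obtain R where R: "\<And>x. x \<notin> {-R..R} \<Longrightarrow> deriv \<psi> x = 0"
        using test_function_support[OF \<psi>] by blast
      have i: "integrable lborel (\<lambda>x. h x * (a x * deriv \<psi> x))" if "sq_int h" for h
      proof (rule lborel_integral_support(1)[of "-R" R])
        show "set_integrable lborel {-R..R} (\<lambda>x. h x * (a x * deriv \<psi> x))"
          using set_integrable_continuous_mult[OF C1[OF \<psi>] sq_int_set_integrable[OF that]]
          by (simp add: mult.commute)
      qed (use R in auto)
      have "(LBINT x. g x * (a x * deriv \<psi> x)) + (LBINT x. F x * \<psi> x)
          = (LBINT x. a x * deriv \<psi> x)"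
        using w \<psi> weak_int[OF \<psi> wI(2,3) gb] lebu[OF \<psi> wm F(4) Fb] int_a(2)[OF \<psi>]
        by (auto simp: weak_solution_def)
      with weak_u[OF \<psi>]
      have "(LBINT x. g x * (a x * deriv \<psi> x)) - (LBINT x. ap d x * (a x * deriv \<psi> x))
          = - ((LBINT x. F x * \<psi> x) - (LBINT x. ap u x * \<psi> x))" by simp
      moreover have "(LBINT x. g x * (a x * deriv \<psi> x)) - (LBINT x. ap d x * (a x * deriv \<psi> x))
          = (LBINT x. (a x * e x) * deriv \<psi> x)"
        using i[OF F(3)] i[OF sq_int_ap[of d]]
        by (subst Bochner_Integration.integral_diff[symmetric]) (auto simp: e_def algebra_simps)
      moreover have "(LBINT x. F x * \<psi> x) - (LBINT x. ap u x * \<psi> x) = (LBINT x. v x * \<psi> x)"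
        using integral_by_parts_test(2)[OF p \<psi>] integral_by_parts_test(2)[OF _ \<psi>, of _ F]
          ex_ac[OF sq_int_set_integrable[OF F(2)]]
        by (subst Bochner_Integration.integral_diff[symmetric]) (auto simp: v_def algebra_simps)
      ultimately show "(LBINT x. (a x * e x) * deriv \<psi> x) = - (LBINT x. v x * \<psi> x)" by simp
    qed (use qs vs sq_int_set_integrable in auto)
    then obtain Q where Q: "ac Q v" "AE x in lborel. a x * e x = Q x" by blast
    have cQ: "continuous_on UNIV Q" by (rule ac_continuous[OF Q(1)])
    have Qs: "sq_int Q" by (rule sq_int_AE_continuous[OF qs Q(2) cQ])
    have "AE x in lborel. e x = b x * Q x"
      using Q(2)
    proof eventually_elim
      case (elim x)
      then show ?case using b0[of x] by (simp add: a_def field_simps)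
    qed
    moreover have cb: "continuous_on UNIV (\<lambda>x. b x * Q x)" by (intro continuous_on_mult b(1) cQ)
    ultimately have vQ: "ac v (\<lambda>x. b x * Q x)"
      using ac_cong_AE[OF ve] borel_integrable_atLeastAtMost' continuous_on_subset[OF cb]
      by (metis subset_UNIV)
    have bQ: "sq_int (\<lambda>x. b x * Q x)"
    proof (rule sq_int_bound[OF Qs])
      show "(\<lambda>x. b x * Q x) \<in> borel_measurable borel" using cb by (rule borel_measurable_continuous_onI)
      show "\<bar>b x * Q x\<bar> \<le> C * \<bar>Q x\<bar>" for x
        unfolding abs_mult using b(3)[of x] b0[of x] by (intro mult_right_mono) auto
    qed
    obtain K where K: "\<And>x. \<bar>v x\<bar> \<le> K" using ac_sq_int_bounded[OF ve vs es] by blast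
    \<comment> \<open>From \<open>Q' = v\<close> and \<open>v' = b * Q\<close> the product
      \<open>Q * v\<close> has derivative \<open>v^2 + b * Q^2\<close>. This is nonnegative with
      integral zero, which forces \<open>v = 0\<close>.\<close>
    have ac: "ac (\<lambda>x. Q x * v x) (\<lambda>x. v x * v x + Q x * (b x * Q x))" by (rule ac_mult[OF Q(1) vQ])
    have i1: "integrable lborel (\<lambda>x. v x * v x)" and i2: "integrable lborel (\<lambda>x. Q x * (b x * Q x))"
      using sq_int_mult[OF vs vs] sq_int_mult[OF Qs bQ] by auto
    have "(LBINT x. v x * v x + Q x * (b x * Q x)) = 0"
    proof (rule ac_integral_eq_0[OF ac])
      show "sq_int (\<lambda>x. Q x * v x)"
      proof (rule sq_int_bound[OF Qs])
        show "(\<lambda>x. Q x * v x) \<in> borel_measurable borel"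
          using ac_continuous[OF ac] by (rule borel_measurable_continuous_onI)
        show "\<bar>Q x * v x\<bar> \<le> K * \<bar>Q x\<bar>" for x
          unfolding abs_mult using K[of x] by (subst mult.commute) (intro mult_right_mono, auto)
      qed
    qed (use i1 i2 in simp)
    moreover have "(LBINT x. Q x * (b x * Q x)) \<ge> 0"
    proof (rule integral_nonneg_AE, rule AE_I2)
      fix x
      have "Q x * (b x * Q x) = b x * (Q x)\<^sup>2" by (simp add: power2_eq_square)
      then show "0 \<le> Q x * (b x * Q x)" using b0[of x] by (simp only: zero_le_mult_iff) simp
    qed
    moreover have "(LBINT x. v x * v x) = (l2 v)\<^sup>2" unfolding l2_sq by (simp add: power2_eq_square)
    moreover note Bochner_Integration.integral_add[OF i1 i2]
    ultimately have "(l2 v)\<^sup>2 \<le> 0" by linarith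
    then have "l2 v = 0" by simp
    then have "v x = 0" for x using l2_eq_0_continuous[OF vs ac_continuous[OF ve]] by blast
    then have "F x = ap u x" for x unfolding v_def by (metis eq_iff_diff_eq_0)
    then show ?thesis using F(4) by simp
  qed
  ultimately show ?thesis by (simp add: unique_weak_solution_def)
qed

text \<open>The hypothesis bounds only the modulus away from zero. The sign comes from the other
  one: the continuous representative is positive where \<open>F\<close> is small, and by
  connectedness it cannot reach a negative value without a zero.\<close>

lemma positive_representative:
  assumes H1: "(\<lambda>z. \<phi>0 z - 1) \<in> H1" and sup: "esssup lebesgue (\<lambda>z. 1 / ennreal \<bar>\<phi>0 z\<bar>) < \<infinity>"
  shows "\<exists>w g c. ac (ap w) g \<and> sq_int g \<and> (AE z in lebesgue. \<phi>0 z - 1 = ap w z)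
     \<and> 0 < c \<and> (\<forall>z. c \<le> 1 + ap w z)"
proof -
  obtain F g where F: "ac F g" "sq_int F" "sq_int g" "AE x in lebesgue. \<phi>0 x - 1 = F x"
    using H1_ex_ac[OF H1] by blast
  obtain C where C: "\<And>x. \<bar>F x\<bar> \<le> C" using ac_sq_int_bounded[OF F(1-3)] by blast
  have cF: "continuous_on UNIV F" by (rule ac_continuous[OF F(1)])
  obtain w where w: "ap w = F" using ex_cl2[OF cF C F(2)] by blast
  define k where "k = enn2real (esssup lebesgue (\<lambda>z. 1 / ennreal \<bar>\<phi>0 z\<bar>))"
  have k: "esssup lebesgue (\<lambda>z. 1 / ennreal \<bar>\<phi>0 z\<bar>) = ennreal k" "k \<ge> 0"
    using sup by (simp_all add: k_def)
  \<comment> \<open>The summand 1 keeps the denominator positive without a separate proof of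
    \<open>k > 0\<close>.\<close>
  define c where "c = 1 / (k + 1)"
  have c: "c > 0" using k(2) by (simp add: c_def)
  have lower: "c \<le> \<bar>y\<bar>" if "1 / ennreal \<bar>y\<bar> \<le> ennreal k" for y
  proof (rule ccontr)
    assume "\<not> c \<le> \<bar>y\<bar>"
    then have y: "\<bar>y\<bar> < c" by simp
    show False
    proof (cases "y = 0")
      case True
      then show False using that by (simp add: top_unique)
    next
      case False
      have "1 / ennreal \<bar>y\<bar> = ennreal (1 / \<bar>y\<bar>)"
        using False divide_ennreal[of 1 "\<bar>y\<bar>"] by simp
      then have "1 / \<bar>y\<bar> \<le> k" using that k(2) by simp
      then have "1 \<le> k * \<bar>y\<bar>" using False by (simp add: field_simps)
      moreover have "(k + 1) * \<bar>y\<bar> < 1" using y k(2) by (simp add: c_def field_simps)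
      ultimately show False using abs_ge_zero[of y] by (simp add: distrib_right)
    qed
  qed
  have "AE z in lebesgue. 1 / ennreal \<bar>\<phi>0 z\<bar> \<le> ennreal k"
    using esssup_AE[of "\<lambda>z. 1 / ennreal \<bar>\<phi>0 z\<bar>" lebesgue] unfolding k(1) .
  then have "AE z in lebesgue. z \<in> {z. c \<le> \<bar>1 + F z\<bar>}"
    using F(4)
  proof eventually_elim
    case (elim z)
    then have "\<phi>0 z = 1 + F z" by simp
    then show ?case using lower[of "\<phi>0 z"] elim by simp
  qed
  moreover have "closed {z. c \<le> \<bar>1 + F z\<bar>}"
    by (intro closed_Collect_le continuous_intros cF)
  ultimately have abs: "c \<le> \<bar>1 + F z\<bar>" for z using mem_closed_if_AE_lebesgue by blast
  obtain x where x: "\<bar>F x\<bar> < 1" using sq_int_small_at[OF F(2), of 1] by auto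
  have "c \<le> 1 + F z" for z
  proof (rule ccontr)
    assume "\<not> c \<le> 1 + F z"
    then have z: "1 + F z < 0" using abs[of z] c by linarith
    have "connected (range (\<lambda>z. 1 + F z))"
      by (intro connected_continuous_image continuous_intros cF connected_UNIV)
    then have "0 \<in> range (\<lambda>z. 1 + F z)"
      using connectedD_interval[of "range (\<lambda>z. 1 + F z)" "1 + F z" "1 + F x" 0] z x by auto
    then obtain y where "1 + F y = 0" by auto
    then show False using abs[of y] c by simp
  qed
  then show ?thesis using F w c by metis
qed

section \<open>Conservation of energy\<close>

lemma bounded_linear_ap: "bounded_linear (\<lambda>f. ap f x)"
  by (rule bounded_linear_intro[of _ 1]) (auto simp: abs_ap_le)

lemma ap_integrable_on: "ap f integrable_on {a..b}"
  by (rule integrable_continuous_real) simp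

lemma bounded_linear_integral_ap:
  assumes "a \<le> b"
  shows "bounded_linear (\<lambda>f. integral {a..b} (ap f))"
proof (rule bounded_linear_intro[of _ "b - a"])
  fix f g :: cl2 and r :: real
  have "ap (f + g) = (\<lambda>x. ap f x + ap g x)" "ap (r *\<^sub>R f) = (\<lambda>x. r * ap f x)" by auto
  then show "integral {a..b} (ap (f + g)) = integral {a..b} (ap f) + integral {a..b} (ap g)"
    "integral {a..b} (ap (r *\<^sub>R f)) = r *\<^sub>R integral {a..b} (ap f)"
    by (simp_all add: Henstock_Kurzweil_Integration.integral_add ap_integrable_on)
  have "norm (integral {a..b} (ap f)) \<le> norm f * (b - a)"
    by (rule integral_bound[OF assms]) (auto simp: abs_ap_le)
  then show "norm (integral {a..b} (ap f)) \<le> norm f * (b - a)" .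
qed

lemma bounded_linear_inner_sq_int:
  assumes g: "sq_int g"
  shows "bounded_linear (\<lambda>f. LBINT x. g x * ap f x)"
proof (rule bounded_linear_intro[of _ "l2 g"])
  fix f h :: cl2 and r :: real
  note i = sq_int_mult[OF g sq_int_ap]
  show "(LBINT x. g x * ap (f + h) x) = (LBINT x. g x * ap f x) + (LBINT x. g x * ap h x)"
    using i by (simp add: distrib_left)
  show "(LBINT x. g x * ap (r *\<^sub>R f) x) = r *\<^sub>R (LBINT x. g x * ap f x)"
    by (simp add: mult.left_commute[of _ r])
  have "\<bar>LBINT x. g x * ap f x\<bar> \<le> l2 g * l2 (ap f)" by (rule l2_Cauchy_Schwarz[OF g sq_int_ap])
  also have "\<dots> \<le> l2 g * norm f" by (intro mult_left_mono l2_ap_le) simp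
  finally show "norm (LBINT x. g x * ap f x) \<le> norm f * l2 g" by (simp add: mult.commute)
qed

lemma bounded_bilinear_inner_cl2: "bounded_bilinear (\<lambda>f h. LBINT x. ap f x * ap h x)"
proof
  fix f f' h h' :: cl2 and r :: real
  note i = sq_int_mult[OF sq_int_ap sq_int_ap]
  show "(LBINT x. ap (f + f') x * ap h x) = (LBINT x. ap f x * ap h x) + (LBINT x. ap f' x * ap h x)"
    "(LBINT x. ap f x * ap (h + h') x) = (LBINT x. ap f x * ap h x) + (LBINT x. ap f x * ap h' x)"
    using i by (simp_all add: distrib_left distrib_right)
  show "(LBINT x. ap (r *\<^sub>R f) x * ap h x) = r *\<^sub>R (LBINT x. ap f x * ap h x)"
    "(LBINT x. ap f x * ap (r *\<^sub>R h) x) = r *\<^sub>R (LBINT x. ap f x * ap h x)"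
    by (simp_all add: mult.assoc mult.left_commute[of _ r])
  show "\<exists>K. \<forall>a b. norm (LBINT x. ap a x * ap b x) \<le> norm a * norm b * K"
  proof (intro exI[of _ 1] allI)
    fix a b :: cl2
    have "\<bar>LBINT x. ap a x * ap b x\<bar> \<le> l2 (ap a) * l2 (ap b)"
      by (rule l2_Cauchy_Schwarz[OF sq_int_ap sq_int_ap])
    also have "\<dots> \<le> norm a * norm b" by (intro mult_mono l2_ap_le) auto
    finally show "norm (LBINT x. ap a x * ap b x) \<le> norm a * norm b * 1" by simp
  qed
qed

section \<open>Potential energy as a functional on the phase space\<close>

context coefficient
begin

definition dpot :: "real \<Rightarrow> real" where
  "dpot = (SOME F. F 1 = 0 \<and> (\<forall>y. (F has_real_derivative \<beta> y) (at y)))"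

lemma dpot: "dpot 1 = 0" "(dpot has_real_derivative \<beta> y) (at y)"
  using someI_ex[OF ex_antiderivative[OF continuous_\<beta>, of 1]] unfolding dpot_def by blast+

lemma continuous_dpot: "continuous_on S dpot"
  using dpot(2) by (meson DERIV_isCont continuous_at_imp_continuous_on)

definition pot :: "real \<Rightarrow> real" where
  "pot = (SOME F. F 1 = 0 \<and> (\<forall>y. (F has_real_derivative dpot y) (at y)))"

lemma pot: "pot 1 = 0" "(pot has_real_derivative dpot y) (at y)"
  using someI_ex[OF ex_antiderivative[OF continuous_dpot, of 1]] unfolding pot_def by blast+

lemma continuous_pot: "continuous_on S pot"
  using pot(2) by (meson DERIV_isCont continuous_at_imp_continuous_on)

lemma dpot_diff: "\<bar>dpot x - dpot y\<bar> \<le> B * \<bar>x - y\<bar>"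
proof -
  obtain \<xi> where "dpot x - dpot y = \<beta> \<xi> * (x - y)"
    using DERIV_mean_value[of dpot \<beta> y x] dpot(2) by blast
  moreover have "\<bar>\<beta> \<xi>\<bar> \<le> B" using \<beta>_ge[of \<xi>] \<beta>_le[of \<xi>] B1 by simp
  ultimately show ?thesis by (simp add: abs_mult mult_right_mono)
qed

lemma abs_dpot_le: "\<bar>dpot (1 + x)\<bar> \<le> B * \<bar>x\<bar>"
  using dpot_diff[of "1 + x" 1] dpot(1) by simp

text \<open>The derivative \<open>dpot\<close> is Lipschitz with constant \<open>B\<close>, and the
  mean value theorem then gives a quadratic remainder. At the rest state 1 this bounds
  \<open>pot\<close> itself, so the potential energy is finite.\<close>

lemma pot_Taylor: "\<bar>pot (y + h) - pot y - dpot y * h\<bar> \<le> B * h\<^sup>2"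
proof -
  obtain \<xi> where \<xi>: "\<bar>\<xi> - y\<bar> \<le> \<bar>(y + h) - y\<bar>" "pot (y + h) - pot y = dpot \<xi> * ((y + h) - y)"
    using DERIV_mean_value[of pot dpot y "y + h"] pot(2) by blast
  have "pot (y + h) - pot y - dpot y * h = (dpot \<xi> - dpot y) * h"
    using \<xi>(2) by (simp add: left_diff_distrib)
  also have "\<bar>(dpot \<xi> - dpot y) * h\<bar> \<le> (B * \<bar>h\<bar>) * \<bar>h\<bar>"
    unfolding abs_mult
  proof (rule mult_right_mono)
    have "B * \<bar>\<xi> - y\<bar> \<le> B * \<bar>h\<bar>" using \<xi>(1) B_pos by (intro mult_left_mono) auto
    then show "\<bar>dpot \<xi> - dpot y\<bar> \<le> B * \<bar>h\<bar>" using dpot_diff[of \<xi> y] by linarith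
  qed simp
  also have "\<dots> = B * h\<^sup>2" by (simp add: power2_eq_square)
  finally show ?thesis .
qed

lemma abs_pot_le: "\<bar>pot (1 + x)\<bar> \<le> B * x\<^sup>2"
  using pot_Taylor[of 1 x] pot(1) dpot(1) by simp

lemma integrable_pot: "integrable lborel (\<lambda>x. pot (1 + ap w x))"
proof (rule Bochner_Integration.integrable_bound)
  show "integrable lborel (\<lambda>x. B * (ap w x)\<^sup>2)" by (simp add: sq_int_integrable)
  have "continuous_on UNIV (\<lambda>x. pot (1 + ap w x))"
    by (rule continuous_on_compose2[OF continuous_pot[of UNIV]]) (auto intro!: continuous_intros)
  then show "(\<lambda>x. pot (1 + ap w x)) \<in> borel_measurable lborel"
    using borel_measurable_continuous_onI by simp
  show "AE x in lborel. norm (pot (1 + ap w x)) \<le> norm (B * (ap w x)\<^sup>2)"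
    using abs_pot_le B_pos by (intro AE_I2) simp
qed

lemma sq_int_dpot: "sq_int (\<lambda>x. dpot (1 + ap w x))"
proof (rule sq_int_bound[OF sq_int_ap _ abs_dpot_le])
  have "continuous_on UNIV (\<lambda>x. dpot (1 + ap w x))"
    by (rule continuous_on_compose2[OF continuous_dpot[of UNIV]]) (auto intro!: continuous_intros)
  then show "(\<lambda>x. dpot (1 + ap w x)) \<in> borel_measurable borel"
    by (rule borel_measurable_continuous_onI)
qed

text \<open>The integrated remainder is at most \<open>B\<close> times the squared L2 norm of the
  increment, which the norm of \<open>cl2\<close> controls; so the derivative may be taken under the
  integral.\<close>

lemma pot_integral_has_derivative:
  "((\<lambda>w. LBINT x. pot (1 + ap w x)) has_derivative
      (\<lambda>h. LBINT x. dpot (1 + ap w x) * ap h x)) (at w)"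
proof (rule has_derivativeI_sandwich[of 1])
  show "bounded_linear (\<lambda>h. LBINT x. dpot (1 + ap w x) * ap h x)"
    by (rule bounded_linear_inner_sq_int[OF sq_int_dpot])
  fix y assume y: "y \<noteq> w"
  let ?I = "\<lambda>f. LBINT x. f x"
  define r where "r x = pot (1 + ap y x) - pot (1 + ap w x) - dpot (1 + ap w x) * ap (y - w) x" for x
  have i: "integrable lborel (\<lambda>x. dpot (1 + ap w x) * ap (y - w) x)"
    by (rule sq_int_mult[OF sq_int_dpot sq_int_ap])
  have ri: "integrable lborel r" unfolding r_def
    by (intro Bochner_Integration.integrable_diff integrable_pot i)
  have "?I (\<lambda>x. pot (1 + ap y x)) - ?I (\<lambda>x. pot (1 + ap w x)) - ?I (\<lambda>x. dpot (1 + ap w x) * ap (y - w) x) = ?I r"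
    unfolding r_def using i integrable_pot
    by (simp only: Bochner_Integration.integral_diff Bochner_Integration.integrable_diff)
  moreover have "\<bar>?I r\<bar> \<le> ?I (\<lambda>x. B * (ap (y - w) x)\<^sup>2)"
  proof (rule order_trans[OF integral_abs_bound integral_mono])
    show "integrable lborel (\<lambda>x. \<bar>r x\<bar>)" using ri by (rule integrable_abs)
    show "integrable lborel (\<lambda>x. B * (ap (y - w) x)\<^sup>2)"
      by (intro integrable_mult_right sq_int_integrable sq_int_ap)
    show "\<bar>r x\<bar> \<le> B * (ap (y - w) x)\<^sup>2" for x
      using pot_Taylor[of "1 + ap w x" "ap (y - w) x"] by (simp add: r_def)
  qed
  moreover have "?I (\<lambda>x. B * (ap (y - w) x)\<^sup>2) = B * (l2 (ap (y - w)))\<^sup>2"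
    by (simp only: integral_mult_right_zero l2_sq)
  moreover have "B * (l2 (ap (y - w)))\<^sup>2 \<le> B * (norm (y - w))\<^sup>2"
    using B_pos by (intro mult_left_mono power_mono l2_ap_le) auto
  ultimately have "norm (?I (\<lambda>x. pot (1 + ap y x)) - ?I (\<lambda>x. pot (1 + ap w x))
      - ?I (\<lambda>x. dpot (1 + ap w x) * ap (y - w) x)) \<le> B * (norm (y - w))\<^sup>2"
    unfolding real_norm_def by linarith
  also have "\<dots> = B * norm (y - w) * norm (y - w)" by (simp add: power2_eq_square)
  finally show "norm (?I (\<lambda>x. pot (1 + ap y x)) - ?I (\<lambda>x. pot (1 + ap w x))
      - ?I (\<lambda>x. dpot (1 + ap w x) * ap (y - w) x)) / norm (y - w) \<le> B * norm (y - w)"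
    using y by (simp only: divide_le_eq) simp
next
  show "((\<lambda>y. B * norm (y - w)) \<longlongrightarrow> 0) (at w)"
    by (rule tendsto_eq_intros refl | simp)+
qed simp

section \<open>Trajectories of the truncated evolution and their space derivatives\<close>

definition trajectory :: "(real \<Rightarrow> cl2) \<Rightarrow> bool" where
  "trajectory w \<longleftrightarrow> (\<forall>t\<ge>0. (w has_vector_derivative vel (w t)) (at t within {0..}))"

lemma ex_trajectory: "\<exists>w. w 0 = w0 \<and> trajectory w"
proof -
  have "\<exists>y. y 0 = w0 \<and> (\<forall>t\<ge>0. (y has_vector_derivative vel (y t)) (at t within {0..}))"
  proof (rule global_Picard)
    have s: "sqrt B > 0" using B_pos by simp
    then show "LN / sqrt B + 1 > 0" using LN_nonneg by (simp add: add_nonneg_pos)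
    fix x y :: cl2
    have "LN / sqrt B * norm (x - y) \<le> (LN / sqrt B + 1) * norm (x - y)"
      by (rule mult_right_mono) auto
    then show "norm (vel x - vel y) \<le> (LN / sqrt B + 1) * norm (x - y)"
      using vel_Lipschitz[of x y] by linarith
  qed
  then show ?thesis by (simp add: trajectory_def)
qed

lemma continuous_vel: "continuous_on UNIV vel"
proof -
  have "(LN / sqrt B)-lipschitz_on UNIV vel"
    by (rule lipschitz_onI) (use vel_Lipschitz LN_nonneg B_pos in \<open>auto simp: dist_norm\<close>)
  then show ?thesis by (rule lipschitz_on_continuous_on)
qed

lemma continuous_vel_z: "continuous_on UNIV vel_z"
proof -
  have "0 \<le> B * (Lsrc / B1) + LN" using LN_nonneg B_pos Lsrc_nonneg B1 by simp
  then have "(B * (Lsrc / B1) + LN)-lipschitz_on UNIV vel_z"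
    by (intro lipschitz_onI) (use vel_z_Lipschitz in \<open>auto simp: dist_norm\<close>)
  then show ?thesis by (rule lipschitz_on_continuous_on)
qed

lemma trajectory_continuous: "trajectory w \<Longrightarrow> continuous_on {0..} w"
  unfolding trajectory_def continuous_on_eq_continuous_within
  by (auto intro: has_vector_derivative_continuous)

text \<open>The gain in space derivative up to time \<open>t\<close>, as an element of
  \<open>cl2\<close>. The derivative of the data itself is only square integrable and has to be kept
  apart.\<close>

definition vel_z_int :: "(real \<Rightarrow> cl2) \<Rightarrow> real \<Rightarrow> cl2" where
  "vel_z_int w t = integral {0..t} (\<lambda>s. vel_z (w s))"

lemma continuous_on_along:
  assumes "trajectory w"
  shows "continuous_on {0..t} (\<lambda>s. vel (w s))" "continuous_on {0..t} (\<lambda>s. vel_z (w s))"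
  using continuous_on_compose2[OF continuous_vel] continuous_on_compose2[OF continuous_vel_z]
    continuous_on_subset[OF trajectory_continuous[OF assms], of "{0..t}"] by auto

lemma vel_z_int_deriv:
  assumes w: "trajectory w" and t: "t \<ge> 0"
  shows "(vel_z_int w has_vector_derivative vel_z (w t)) (at t within {0..})"
proof -
  have "(vel_z_int w has_vector_derivative vel_z (w t)) (at t within {0..t + 1})"
    unfolding vel_z_int_def
    using t by (intro integral_has_vector_derivative continuous_on_along[OF w]) auto
  moreover have "at t within {0..t + 1} = at t within {0..}"
    by (rule at_within_nhd[of t "{..<t + 1}"]) auto
  ultimately show ?thesis by simp
qed

text \<open>Differentiation in time replaces an exchange of the two integrals: the defect
  \<open>l\<close> in the fundamental theorem on \<open>[a, b]\<close> has time derivative zero,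
  because \<open>vel_z\<close> is the classical derivative of \<open>vel\<close>.\<close>

lemma trajectory_ac:
  assumes w: "trajectory w" and g: "ac (ap (w 0)) g" and t: "t \<ge> 0"
  shows "ac (ap (w t)) (\<lambda>z. g z + ap (vel_z_int w t) z)"
  unfolding ac_def
proof (intro allI impI conjI)
  fix a b :: real assume ab: "a \<le> b"
  show "set_integrable lborel {a..b} (\<lambda>z. g z + ap (vel_z_int w t) z)"
    by (intro set_integral_add acD(1)[OF g ab] sq_int_set_integrable sq_int_ap)
  define l where "l s = ap (w s) b - ap (w s) a - integral {a..b} (ap (vel_z_int w s))" for s
  have "(l has_derivative (\<lambda>h. 0)) (at s within {0..})" if s: "s \<in> {0..}" for s
  proof -
    have wd: "(w has_vector_derivative vel (w s)) (at s within {0..})"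
      using w s by (simp add: trajectory_def)
    have vd: "(vel_z_int w has_vector_derivative vel_z (w s)) (at s within {0..})"
      using vel_z_int_deriv[OF w] s by simp
    have "(l has_vector_derivative ap (vel (w s)) b - ap (vel (w s)) a
        - integral {a..b} (ap (vel_z (w s)))) (at s within {0..})"
      unfolding l_def
      by (intro has_vector_derivative_diff bounded_linear.has_vector_derivative[OF bounded_linear_ap wd]
          bounded_linear.has_vector_derivative[OF bounded_linear_integral_ap[OF ab] vd])
    moreover have "ap (vel (w s)) b - ap (vel (w s)) a = integral {a..b} (ap (vel_z (w s)))"
      using acD(2)[OF ac_C1[OF vel_has_deriv continuous_ap] ab] .
    ultimately show ?thesis by (simp add: has_vector_derivative_def)
  qed
  then obtain c where "\<And>s. s \<in> {0..} \<Longrightarrow> l s = c"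
    using has_derivative_zero_constant[of "{0..}" l] by (auto simp: convex_real_interval)
  then have "l t = l 0" using t by simp
  moreover have "l 0 = ap (w 0) b - ap (w 0) a"
  proof -
    have "ap (vel_z_int w 0) = (\<lambda>x. 0)" by (auto simp: vel_z_int_def)
    then show ?thesis by (simp add: l_def)
  qed
  ultimately have "ap (w t) b - ap (w t) a = integral {a..b} g + integral {a..b} (ap (vel_z_int w t))"
    using acD(2)[OF g ab] by (simp add: l_def)
  then show "ap (w t) b - ap (w t) a = integral {a..b} (\<lambda>z. g z + ap (vel_z_int w t) z)"
    using Henstock_Kurzweil_Integration.integral_add[OF ac_integrable_on[OF g] ap_integrable_on] by simp
qed

text \<open>The space derivative \<open>g\<close> is a separate argument because it is not part of
  the phase space and is determined only up to a null set.\<close>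

definition energy :: "(real \<Rightarrow> real) \<Rightarrow> cl2 \<Rightarrow> real" where
  "energy g w = (l2 g)\<^sup>2 / 2 + (LBINT x. pot (1 + ap w x))"

text \<open>The time derivative of the energy density is the space derivative of
  \<open>dpot (1 + w) * (p - 1) + w\<close>.\<close>

lemma energy_identity:
  assumes g: "ac (ap w) g" "sq_int g"
  shows "(LBINT x. g x * ap (vel_z w) x) + (LBINT x. dpot (1 + ap w x) * ap (vel w) x) = 0"
proof -
  define J where "J x = dpot (1 + ap w x) * (ap (sol w) x - 1) + ap w x" for x
  have "ac (\<lambda>x. dpot (1 + ap w x)) (\<lambda>x. \<beta> (1 + ap w x) * (0 + g x))"
    by (rule ac_chain[OF ac_add[OF ac_const g(1)] dpot(2) continuous_\<beta>])
  moreover have "ac (\<lambda>x. ap (sol w) x - 1) (\<lambda>x. ap (vel w) x - 0)"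
    by (intro ac_diff ac_const ac_C1 sol_has_deriv continuous_ap)
  ultimately have "ac J (\<lambda>x. (\<beta> (1 + ap w x) * (0 + g x)) * (ap (sol w) x - 1)
      + dpot (1 + ap w x) * (ap (vel w) x - 0) + g x)"
    unfolding J_def by (intro ac_add ac_mult g(1))
  moreover have "(\<lambda>x. (\<beta> (1 + ap w x) * (0 + g x)) * (ap (sol w) x - 1)
      + dpot (1 + ap w x) * (ap (vel w) x - 0) + g x)
      = (\<lambda>x. g x * ap (vel_z w) x + dpot (1 + ap w x) * ap (vel w) x)"
    by (rule ext) (simp add: ap_vel_z coef_def algebra_simps)
  ultimately have ac: "ac J (\<lambda>x. g x * ap (vel_z w) x + dpot (1 + ap w x) * ap (vel w) x)" by simp
  have i: "integrable lborel (\<lambda>x. g x * ap (vel_z w) x)"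
    "integrable lborel (\<lambda>x. dpot (1 + ap w x) * ap (vel w) x)"
    by (intro sq_int_mult g(2) sq_int_dpot sq_int_ap)+
  have "sq_int J"
  proof (rule sq_int_bound[OF sq_int_ap])
    show "J \<in> borel_measurable borel" using ac_continuous[OF ac] by (rule borel_measurable_continuous_onI)
    fix x
    have "\<bar>J x\<bar> \<le> \<bar>dpot (1 + ap w x)\<bar> * \<bar>ap (sol w) x - 1\<bar> + \<bar>ap w x\<bar>"
      unfolding J_def by (metis abs_mult abs_triangle_ineq)
    also have "\<bar>dpot (1 + ap w x)\<bar> * \<bar>ap (sol w) x - 1\<bar> \<le> (B * \<bar>ap w x\<bar>) * (supn (sol w) + 1)"
    proof (intro mult_mono abs_dpot_le)
      show "\<bar>ap (sol w) x - 1\<bar> \<le> supn (sol w) + 1" using abs_ap_le_supn[of "sol w" x] by linarith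
    qed (use B_pos in auto)
    finally show "\<bar>J x\<bar> \<le> (B * (supn (sol w) + 1) + 1) * \<bar>ap w x\<bar>" by (simp add: algebra_simps)
  qed
  from ac_integral_eq_0[OF ac _ this] i show ?thesis by simp
qed

text \<open>The square of \<open>g + v\<close> is expanded so that only terms linear or quadratic in
  the curve \<open>v\<close> in \<open>cl2\<close> are differentiated in time; \<open>g\<close>
  stays fixed. The derivatives combine to the left side of \<open>energy_identity\<close>.\<close>

lemma energy_constant:
  assumes w: "trajectory w" and g: "ac (ap (w 0)) g" "sq_int g" and t: "t \<ge> 0"
  shows "energy (\<lambda>z. g z + ap (vel_z_int w t) z) (w t) = energy g (w 0)"
proof -
  let ?v = "vel_z_int w"
  define E where "E s = (l2 g)\<^sup>2 / 2 + (LBINT x. g x * ap (?v s) x)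
      + (LBINT x. ap (?v s) x * ap (?v s) x) / 2 + (LBINT x. pot (1 + ap (w s) x))" for s
  have E: "E s = energy (\<lambda>z. g z + ap (?v s) z) (w s)" for s
  proof -
    have "(l2 (\<lambda>z. g z + ap (?v s) z))\<^sup>2
        = (LBINT x. (g x)\<^sup>2 + 2 * (g x * ap (?v s) x) + ap (?v s) x * ap (?v s) x)"
      unfolding l2_sq by (simp add: power2_sum power2_eq_square algebra_simps)
    also have "\<dots> = (l2 g)\<^sup>2 + 2 * (LBINT x. g x * ap (?v s) x)
        + (LBINT x. ap (?v s) x * ap (?v s) x)"
      unfolding l2_sq using sq_int_integrable[OF g(2)] sq_int_mult[OF g(2) sq_int_ap[of "?v s"]]
        sq_int_mult[OF sq_int_ap[of "?v s"] sq_int_ap[of "?v s"]] by simp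
    finally show ?thesis by (simp add: E_def energy_def)
  qed
  have "(E has_derivative (\<lambda>h. 0)) (at s within {0..})" if s: "s \<in> {0..}" for s
  proof -
    have wd: "(w has_vector_derivative vel (w s)) (at s within {0..})"
      using w s by (simp add: trajectory_def)
    have vd: "(?v has_vector_derivative vel_z (w s)) (at s within {0..})"
      using vel_z_int_deriv[OF w] s by simp
    have 1: "((\<lambda>s. LBINT x. g x * ap (?v s) x) has_vector_derivative
        (LBINT x. g x * ap (vel_z (w s)) x)) (at s within {0..})"
      by (rule bounded_linear.has_vector_derivative[OF bounded_linear_inner_sq_int[OF g(2)] vd])
    have 2: "((\<lambda>s. LBINT x. ap (?v s) x * ap (?v s) x) has_vector_derivative
        (LBINT x. ap (?v s) x * ap (vel_z (w s)) x) + (LBINT x. ap (vel_z (w s)) x * ap (?v s) x))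
        (at s within {0..})"
      by (rule bounded_bilinear.has_vector_derivative[OF bounded_bilinear_inner_cl2 vd vd])
    have "((\<lambda>s. LBINT x. pot (1 + ap (w s) x)) has_derivative
        (\<lambda>h. LBINT x. dpot (1 + ap (w s) x) * ap (h *\<^sub>R vel (w s)) x)) (at s within {0..})"
      using has_derivative_compose[OF wd[unfolded has_vector_derivative_def] pot_integral_has_derivative] .
    moreover have "(\<lambda>h. LBINT x. dpot (1 + ap (w s) x) * ap (h *\<^sub>R vel (w s)) x)
        = (\<lambda>h. h *\<^sub>R (LBINT x. dpot (1 + ap (w s) x) * ap (vel (w s)) x))"
      by (intro ext linear_simps(5)[OF bounded_linear_inner_sq_int[OF sq_int_dpot]])
    ultimately have 3: "((\<lambda>s. LBINT x. pot (1 + ap (w s) x)) has_vector_derivative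
        (LBINT x. dpot (1 + ap (w s) x) * ap (vel (w s)) x)) (at s within {0..})"
      by (simp add: has_vector_derivative_def)
    define d where "d = (LBINT x. g x * ap (vel_z (w s)) x)
        + ((LBINT x. ap (?v s) x * ap (vel_z (w s)) x)
          + (LBINT x. ap (vel_z (w s)) x * ap (?v s) x)) / 2
        + (LBINT x. dpot (1 + ap (w s) x) * ap (vel (w s)) x)"
    have "(E has_vector_derivative 0 + (LBINT x. g x * ap (vel_z (w s)) x)
        + ((LBINT x. ap (?v s) x * ap (vel_z (w s)) x)
          + (LBINT x. ap (vel_z (w s)) x * ap (?v s) x)) / 2
        + (LBINT x. dpot (1 + ap (w s) x) * ap (vel (w s)) x)) (at s within {0..})"
      unfolding E_def
      by (intro has_vector_derivative_add has_vector_derivative_const has_vector_derivative_divide 1 2 3)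
    then have Ed: "(E has_vector_derivative d) (at s within {0..})" by (simp add: d_def)
    have "d = (LBINT x. (g x + ap (?v s) x) * ap (vel_z (w s)) x)
        + (LBINT x. dpot (1 + ap (w s) x) * ap (vel (w s)) x)"
      unfolding d_def using sq_int_mult[OF g(2) sq_int_ap[of "vel_z (w s)"]]
        sq_int_mult[OF sq_int_ap[of "?v s"] sq_int_ap[of "vel_z (w s)"]]
      by (simp add: distrib_right mult.commute[of "ap (vel_z (w s)) _"])
    also have "\<dots> = 0"
      using s by (intro energy_identity trajectory_ac[OF w g(1)] sq_int_add g(2) sq_int_ap) simp
    finally show ?thesis using Ed by (simp add: has_vector_derivative_def)
  qed
  then obtain c where "\<And>s. s \<in> {0..} \<Longrightarrow> E s = c"
    using has_derivative_zero_constant[of "{0..}" E] by (auto simp: convex_real_interval)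
  then have "E t = E 0" using t by simp
  moreover have "ap (?v 0) = (\<lambda>x. 0)" by (auto simp: vel_z_int_def)
  ultimately show ?thesis unfolding E by simp
qed

text \<open>Modica--Mortola: the energy dominates \<open>\<bar>\<kappa> (1 + w) * w'\<bar>\<close>, the total
  variation of \<open>W (1 + w)\<close>.\<close>

lemma energy_controls_range:
  assumes g: "ac (ap w) g" "sq_int g"
    and W: "W 1 = 0" "\<And>y. (W has_real_derivative \<kappa> y) (at y)"
    and \<kappa>: "continuous_on UNIV \<kappa>" "\<And>y. (\<kappa> y)\<^sup>2 / 2 \<le> pot y"
  shows "\<bar>W (1 + ap w z)\<bar> \<le> energy g w"
proof (rule field_le_epsilon)
  fix e :: real assume e: "e > 0"
  have ac: "ac (\<lambda>x. W (1 + ap w x)) (\<lambda>x. \<kappa> (1 + ap w x) * (0 + g x))"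
    by (rule ac_chain[OF ac_add[OF ac_const g(1)] W(2) \<kappa>(1)])
  have kc: "continuous_on UNIV (\<lambda>x. \<kappa> (1 + ap w x))"
    by (rule continuous_on_compose2[OF \<kappa>(1)]) (auto intro!: continuous_intros)
  then have km: "(\<lambda>x. \<kappa> (1 + ap w x)) \<in> borel_measurable borel"
    by (rule borel_measurable_continuous_onI)
  \<comment> \<open>The quadratic growth of \<open>pot\<close> at 1 passes to the weight, which
    makes \<open>\<kappa> (1 + w)\<close> square integrable.\<close>
  have k2: "(\<kappa> (1 + y))\<^sup>2 \<le> (2 * B) * y\<^sup>2" for y
    using \<kappa>(2)[of "1 + y"] abs_pot_le[of y] by linarith
  have ks: "sq_int (\<lambda>x. \<kappa> (1 + ap w x))"
  proof (rule sq_int_bound[OF sq_int_ap km])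
    fix x
    have "sqrt ((\<kappa> (1 + ap w x))\<^sup>2) \<le> sqrt ((2 * B) * (ap w x)\<^sup>2)"
      by (rule real_sqrt_le_mono[OF k2])
    then show "\<bar>\<kappa> (1 + ap w x)\<bar> \<le> sqrt (2 * B) * \<bar>ap w x\<bar>" by (simp add: real_sqrt_mult)
  qed
  have i: "integrable lborel (\<lambda>x. \<kappa> (1 + ap w x) * (0 + g x))"
    using sq_int_mult[OF ks g(2)] by simp
  have "(LBINT x. \<bar>\<kappa> (1 + ap w x) * (0 + g x)\<bar>) \<le> (LBINT x. (g x)\<^sup>2 / 2 + pot (1 + ap w x))"
  proof (rule integral_mono)
    show "integrable lborel (\<lambda>x. \<bar>\<kappa> (1 + ap w x) * (0 + g x)\<bar>)" using i by (rule integrable_abs)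
    show "integrable lborel (\<lambda>x. (g x)\<^sup>2 / 2 + pot (1 + ap w x))"
      using sq_int_integrable[OF g(2)] integrable_pot[of w] by simp
    fix x
    have "0 \<le> (\<bar>\<kappa> (1 + ap w x)\<bar> - \<bar>g x\<bar>)\<^sup>2 / 2" by simp
    also have "\<dots> = (\<kappa> (1 + ap w x))\<^sup>2 / 2 + (g x)\<^sup>2 / 2 - \<bar>\<kappa> (1 + ap w x) * g x\<bar>"
      by (simp add: power2_diff abs_mult field_simps)
    finally show "\<bar>\<kappa> (1 + ap w x) * (0 + g x)\<bar> \<le> (g x)\<^sup>2 / 2 + pot (1 + ap w x)"
      using \<kappa>(2)[of "1 + ap w x"] by simp
  qed
  also have "\<dots> = energy g w"
    unfolding energy_def l2_sq using sq_int_integrable[OF g(2)] integrable_pot[of w] by simp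
  finally have bd: "(LBINT x. \<bar>\<kappa> (1 + ap w x) * (0 + g x)\<bar>) \<le> energy g w" .
  have "isCont W 1" using W(2) by (rule DERIV_isCont)
  then obtain r where r: "r > 0" "\<And>y. \<bar>y - 1\<bar> < r \<Longrightarrow> \<bar>W y\<bar> < e"
    using e W(1) unfolding continuous_at_eps_delta dist_real_def by (metis diff_zero)
  \<comment> \<open>In place of a limit at infinity: a point where \<open>w\<close> is so small that
    \<open>W (1 + w)\<close> is below \<open>e\<close>.\<close>
  obtain y where "\<bar>ap w y\<bar> < r" using sq_int_small_at[OF sq_int_ap r(1)] by blast
  then have "\<bar>W (1 + ap w y)\<bar> < e" by (intro r(2)) simp
  then show "\<bar>W (1 + ap w z)\<bar> \<le> energy g w + e"
    using ac_diff_bound[OF ac i, of z y] bd by linarith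
qed

end

section \<open>A priori bounds and the global solution\<close>

locale truncation =
  fixes n \<delta> M :: real
  assumes n: "4 \<le> n" "n < 6" and \<delta>: "0 < \<delta>" "\<delta> < 1" and M: "1 < M"
begin

definition clamp :: "real \<Rightarrow> real" where
  "clamp y = max \<delta> (min M y)"

definition trunc :: "real \<Rightarrow> real" where
  "trunc y = clamp y powr (- n)"

lemma clamp_bounds: "\<delta> \<le> clamp y" "clamp y \<le> M" "0 < clamp y"
  using \<delta> M by (auto simp: clamp_def)

lemma clamp_id: "\<delta> \<le> y \<Longrightarrow> y \<le> M \<Longrightarrow> clamp y = y"
  by (simp add: clamp_def)

lemma powr_Lipschitz:
  assumes "\<delta> \<le> x" "\<delta> \<le> y"
  shows "\<bar>x powr (- n) - y powr (- n)\<bar> \<le> n * \<delta> powr (- n - 1) * \<bar>x - y\<bar>"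
proof -
  have *: "\<bar>v powr (- n) - u powr (- n)\<bar> \<le> n * \<delta> powr (- n - 1) * \<bar>v - u\<bar>"
    if "\<delta> \<le> u" "u < v" for u v
  proof -
    have "\<exists>z. u < z \<and> z < v \<and> v powr (- n) - u powr (- n) = (v - u) * (- n * z powr (- n - 1))"
    proof (rule MVT2[OF that(2)])
      fix x assume "u \<le> x"
      then have "0 < x" using that(1) \<delta>(1) by simp
      then show "((\<lambda>z. z powr (- n)) has_real_derivative - n * x powr (- n - 1)) (at x)"
        by (rule has_real_derivative_powr)
    qed
    then obtain z where z: "u < z" "v powr (- n) - u powr (- n) = (v - u) * (- n * z powr (- n - 1))"
      by blast
    have "z powr (- n - 1) \<le> \<delta> powr (- n - 1)"
      using z(1) that \<delta>(1) n by (intro powr_mono2') auto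
    then have "n * z powr (- n - 1) \<le> n * \<delta> powr (- n - 1)" using n by (intro mult_left_mono) auto
    then have "\<bar>v - u\<bar> * (n * z powr (- n - 1)) \<le> \<bar>v - u\<bar> * (n * \<delta> powr (- n - 1))"
      by (rule mult_left_mono) simp
    moreover have "\<bar>v powr (- n) - u powr (- n)\<bar> = \<bar>v - u\<bar> * (n * z powr (- n - 1))"
      unfolding z(2) abs_mult using n by simp
    ultimately show ?thesis by (simp add: mult.commute)
  qed
  show ?thesis
    using *[of x y] *[of y x] assms
    by (cases x y rule: linorder_cases) (simp_all add: abs_minus_commute)
qed

sublocale coefficient trunc "M powr (- n)" "\<delta> powr (- n)" "n * \<delta> powr (- n - 1)"
proof
  show "M powr (- n) > 0" using M by simp
  show "M powr (- n) \<le> trunc y" "trunc y \<le> \<delta> powr (- n)" for y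
    unfolding trunc_def using clamp_bounds[of y] \<delta>(1) n by (auto intro!: powr_mono2')
  show "trunc 1 = 1" using \<delta> M by (simp add: trunc_def clamp_id)
  fix x y
  have "\<bar>trunc x - trunc y\<bar> \<le> n * \<delta> powr (- n - 1) * \<bar>clamp x - clamp y\<bar>"
    unfolding trunc_def by (rule powr_Lipschitz) (rule clamp_bounds)+
  also have "\<dots> \<le> n * \<delta> powr (- n - 1) * \<bar>x - y\<bar>"
    using n by (intro mult_left_mono) (auto simp: clamp_def max_def min_def)
  finally show "\<bar>trunc x - trunc y\<bar> \<le> n * \<delta> powr (- n - 1) * \<bar>x - y\<bar>" .
qed

text \<open>The signed root of twice \<open>(1 - 1/y)^2 / 8\<close>. Its primitive
  \<open>(y - 1 - ln y) / 2\<close> grows logarithmically at 0 and linearly at infinity; clamping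
  makes the weight continuous on the whole line.\<close>

definition mm_weight :: "real \<Rightarrow> real" where
  "mm_weight y = (1 - 1 / clamp y) / 2"

lemma continuous_mm_weight: "continuous_on UNIV mm_weight"
proof -
  have "continuous_on UNIV clamp" unfolding clamp_def by (intro continuous_intros)
  then show ?thesis unfolding mm_weight_def using clamp_bounds(3)
    by (intro continuous_intros) (auto simp: less_imp_neq[symmetric])
qed

text \<open>The second derivative of \<open>(1 - 1/y)\<^sup>2 / 8\<close> lies below \<open>y\<^sup>-\<^sup>4\<close> for
  \<open>y \<le> 1\<close> and below \<open>y\<^sup>-\<^sup>6\<close> for \<open>y \<ge> 1\<close>.\<close>

lemma second_derivative_le:
  assumes y: "\<delta> \<le> y" "y \<le> M"
  shows "(3 / y ^ 4 - 2 / y ^ 3) / 4 \<le> trunc y"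
proof -
  have y0: "y > 0" using y \<delta> by simp
  have t: "trunc y = y powr (- n)" using y by (simp add: trunc_def clamp_id)
  show ?thesis
  proof (cases "y \<le> 1")
    case True
    have "y powr (-4) \<le> y powr (- n)" using True y0 n by (intro powr_mono') auto
    moreover have "y powr (-4) = 1 / y ^ 4"
      using y0 by (simp add: powr_minus_divide powr_numeral)
    moreover have "(3 / y ^ 4 - 2 / y ^ 3) / 4 \<le> 1 / y ^ 4"
    proof -
      have "(3 / y ^ 4 - 2 / y ^ 3) / 4 = (3 - 2 * y) / 4 / y ^ 4"
        using y0 by (simp add: field_simps power_numeral_reduce)
      also have "\<dots> \<le> 1 / y ^ 4" using y0 by (intro divide_right_mono) auto
      finally show ?thesis .
    qed
    ultimately show ?thesis unfolding t by linarith
  next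
    case False
    have "y powr (-6) \<le> y powr (- n)" using False n by (intro powr_mono) auto
    moreover have "y powr (-6) = 1 / y ^ 6"
      using y0 by (simp add: powr_minus_divide powr_numeral)
    moreover have "(3 / y ^ 4 - 2 / y ^ 3) / 4 \<le> 1 / y ^ 6"
    proof -
      have "(3 / y ^ 4 - 2 / y ^ 3) / 4 = (3 * y\<^sup>2 - 2 * y ^ 3) / 4 / y ^ 6"
        using y0 by (simp add: field_simps power_numeral_reduce)
      also have "\<dots> \<le> 1 / y ^ 6"
      proof (intro divide_right_mono)
        \<comment> \<open>The cubic \<open>2 y^3 - 3 y^2 + 1\<close> has a double root at 1; its
          nonnegativity gives \<open>3 y^2 - 2 y^3 \<le> 1\<close>.\<close>
        have "0 \<le> (y - 1)\<^sup>2 * (2 * y + 1)" using y0 by simp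
        also have "\<dots> = 2 * y ^ 3 - 3 * y\<^sup>2 + 1"
          by (simp add: power2_eq_square power3_eq_cube algebra_simps)
        finally show "(3 * y\<^sup>2 - 2 * y ^ 3) / 4 \<le> 1" by simp
      qed (use y0 in simp)
      finally show ?thesis .
    qed
    ultimately show ?thesis unfolding t by linarith
  qed
qed

lemma dpot_mono: "x \<le> y \<Longrightarrow> dpot x \<le> dpot y"
  by (rule DERIV_nonneg_imp_nondecreasing) (use dpot(2) \<beta>_ge B1 in \<open>meson less_imp_le order_trans\<close>)+

lemma pot_mono_right: "1 \<le> x \<Longrightarrow> x \<le> y \<Longrightarrow> pot x \<le> pot y"
  by (rule DERIV_nonneg_imp_nondecreasing[of x y])
     (use pot(2) dpot_mono[of 1] dpot(1) in \<open>auto intro!: exI[of _ "dpot _"]\<close>)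

lemma pot_mono_left: "x \<le> y \<Longrightarrow> y \<le> 1 \<Longrightarrow> pot y \<le> pot x"
  by (rule DERIV_nonpos_imp_nonincreasing[of x y])
     (use pot(2) dpot_mono[of _ 1] dpot(1) in \<open>auto intro!: exI[of _ "dpot _"]\<close>)

text \<open>Both sides vanish to first order at 1, so the comparison of second derivatives in
  \<open>second_derivative_le\<close> can be integrated twice from there.\<close>

lemma pot_lower:
  assumes y: "\<delta> \<le> y" "y \<le> M"
  shows "(1 - 1 / y)\<^sup>2 / 8 \<le> pot y"
proof -
  define Q where "Q y = (1 - 1 / y)\<^sup>2 / 8" for y :: real
  define Q' where "Q' y = (1 / y ^ 2 - 1 / y ^ 3) / 4" for y :: real
  have DQ: "(Q has_real_derivative Q' y) (at y)" if "y > 0" for y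
    unfolding Q_def Q'_def using that
    by (auto intro!: derivative_eq_intros simp: field_simps power_numeral_reduce)
  have DQ': "(Q' has_real_derivative (3 / y ^ 4 - 2 / y ^ 3) / 4) (at y)" if "y > 0" for y
    unfolding Q'_def using that
    by (auto intro!: derivative_eq_intros simp: field_simps power_numeral_reduce)
  have D1: "((\<lambda>y. dpot y - Q' y) has_real_derivative trunc y - (3 / y ^ 4 - 2 / y ^ 3) / 4) (at y)"
    if "y > 0" for y by (intro DERIV_diff dpot(2) DQ' that)
  have D0: "((\<lambda>y. pot y - Q y) has_real_derivative dpot y - Q' y) (at y)"
    if "y > 0" for y by (intro DERIV_diff pot(2) DQ that)
  have mono: "dpot x - Q' x \<le> dpot y - Q' y" if "\<delta> \<le> x" "x \<le> y" "y \<le> M" for x y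
  proof (rule DERIV_nonneg_imp_nondecreasing[OF that(2)])
    fix z assume "x \<le> z" "z \<le> y"
    then show "\<exists>l. ((\<lambda>y. dpot y - Q' y) has_real_derivative l) (at z) \<and> 0 \<le> l"
      using that \<delta>(1) D1[of z] second_derivative_le[of z]
      by (intro exI[of _ "trunc z - (3 / z ^ 4 - 2 / z ^ 3) / 4"]) auto
  qed
  have one: "dpot 1 - Q' 1 = 0" "pot 1 - Q 1 = 0" using dpot(1) pot(1) by (simp_all add: Q_def Q'_def)
  have "pot y - Q y \<ge> 0"
  proof (cases "y \<le> 1")
    case True
    have "pot 1 - Q 1 \<le> pot y - Q y"
    proof (rule DERIV_nonpos_imp_nonincreasing[OF True])
      fix z assume z: "y \<le> z" "z \<le> 1"
      then show "\<exists>l. ((\<lambda>y. pot y - Q y) has_real_derivative l) (at z) \<and> l \<le> 0"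
        using y \<delta>(1) M D0[of z] mono[of z 1] one by (intro exI[of _ "dpot z - Q' z"]) auto
    qed
    then show ?thesis using one by simp
  next
    case False
    then have "1 \<le> y" by simp
    have "pot 1 - Q 1 \<le> pot y - Q y"
    proof (rule DERIV_nonneg_imp_nondecreasing[OF \<open>1 \<le> y\<close>])
      fix z assume z: "1 \<le> z" "z \<le> y"
      then show "\<exists>l. ((\<lambda>y. pot y - Q y) has_real_derivative l) (at z) \<and> 0 \<le> l"
        using y \<delta> D0[of z] mono[of 1 z] one by (intro exI[of _ "dpot z - Q' z"]) auto
    qed
    then show ?thesis using one by simp
  qed
  then show ?thesis by (simp add: Q_def)
qed

text \<open>Outside the truncation interval the weight is frozen, while \<open>pot\<close> keeps
  growing away from 1.\<close>

lemma mm_weight_le_pot: "(mm_weight y)\<^sup>2 / 2 \<le> pot y"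
proof -
  have "(mm_weight y)\<^sup>2 / 2 = (1 - 1 / clamp y)\<^sup>2 / 8" by (simp add: mm_weight_def power_divide)
  also have "\<dots> \<le> pot (clamp y)" by (intro pot_lower clamp_bounds)
  also have "\<dots> \<le> pot y"
    using pot_mono_left[of y \<delta>] pot_mono_right[of M y] \<delta> M
    by (auto simp: clamp_def max_def min_def not_le)
  finally show ?thesis .
qed

text \<open>The constant involves \<open>c\<close> and neither truncation level. With
  \<open>c\<close> a lower bound of the data, this bounds the initial energy before
  \<open>\<delta>\<close> and \<open>M\<close> are chosen.\<close>

lemma pot_upper:
  assumes c: "\<delta> \<le> c" "c \<le> 1" and y: "c \<le> y"
  shows "pot y \<le> c powr (- n) * (y - 1)\<^sup>2"
proof -
  have \<beta>c: "0 \<le> trunc z" "trunc z \<le> c powr (- n)" if "c \<le> z" for z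
    using that c \<delta>(1) M n unfolding trunc_def by (auto simp: clamp_def intro!: powr_mono2')
  \<comment> \<open>The intermediate points must stay between 1 and \<open>y\<close>: then
    \<open>\<eta>\<close> is at least \<open>c\<close>, and \<open>\<xi> - 1\<close> has the sign of
    \<open>y - 1\<close> and no larger modulus.\<close>
  obtain \<xi> where \<xi>: "min 1 y \<le> \<xi>" "\<xi> \<le> max 1 y" "pot y - pot 1 = dpot \<xi> * (y - 1)"
    using DERIV_mean_value_between[of pot dpot 1 y] pot(2) by blast
  obtain \<eta> where \<eta>: "min 1 \<xi> \<le> \<eta>" "dpot \<xi> - dpot 1 = trunc \<eta> * (\<xi> - 1)"
    using DERIV_mean_value_between[of dpot trunc 1 \<xi>] dpot(2) by blast
  have "c \<le> \<eta>" using \<eta>(1) \<xi>(1) c y by linarith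
  have "pot y = trunc \<eta> * ((\<xi> - 1) * (y - 1))" using \<xi>(3) \<eta>(2) pot(1) dpot(1) by simp
  also have "\<dots> \<le> c powr (- n) * (y - 1)\<^sup>2"
  proof (rule mult_mono)
    show "trunc \<eta> \<le> c powr (- n)" by (rule \<beta>c(2)[OF \<open>c \<le> \<eta>\<close>])
    show "(\<xi> - 1) * (y - 1) \<le> (y - 1)\<^sup>2"
      unfolding power2_eq_square using \<xi>(1,2)
      by (cases "y \<le> 1") (auto intro: mult_right_mono mult_right_mono_neg)
    show "0 \<le> (\<xi> - 1) * (y - 1)"
      using \<xi>(1,2) by (cases "y \<le> 1") (auto intro: mult_nonneg_nonneg mult_nonpos_nonpos)
  qed simp
  finally show ?thesis .
qed

text \<open>Between the levels \<open>W\<close> is \<open>(y - 1 - ln y) / 2\<close>, and beyond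
  them it is monotone away from 1, so a value past a level would cost more than the available
  energy. Since energy is conserved by the truncated evolution, each time is treated on its own,
  with no continuation argument.\<close>

lemma range_bound:
  assumes w: "trajectory w" and g: "ac (ap (w 0)) g" "sq_int g" and t: "t \<ge> 0"
    and E: "energy g (w 0) < (\<delta> - 1 - ln \<delta>) / 2" "energy g (w 0) < (M - 1 - ln M) / 2"
  shows "\<delta> < 1 + ap (w t) z" "1 + ap (w t) z < M"
proof -
  obtain W where W: "W 1 = 0" "\<And>y. (W has_real_derivative mm_weight y) (at y)"
    using ex_antiderivative[OF continuous_mm_weight, of 1] by blast
  define U where "U y = (y - 1 - ln y) / 2" for y :: real
  have D: "((\<lambda>y. W y - U y) has_real_derivative 0) (at y)" if "\<delta> \<le> y" "y \<le> M" for y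
  proof -
    have "(U has_real_derivative (1 - 1 / y) / 2) (at y)"
      unfolding U_def using that \<delta>(1) by (auto intro!: derivative_eq_intros)
    from DERIV_diff[OF W(2) this] show ?thesis using that by (simp add: mm_weight_def clamp_id)
  qed
  have const: "W y - U y = W x - U x" if "\<delta> \<le> x" "x \<le> y" "y \<le> M" for x y
  proof (rule antisym)
    show "W y - U y \<le> W x - U x"
      by (rule DERIV_nonpos_imp_nonincreasing[OF that(2)]) (use D that in \<open>meson order_trans order_refl\<close>)
    show "W x - U x \<le> W y - U y"
      by (rule DERIV_nonneg_imp_nondecreasing[OF that(2)]) (use D that in \<open>meson order_trans order_refl\<close>)
  qed
  have U1: "U 1 = 0" by (simp add: U_def)
  have W\<delta>: "W \<delta> = U \<delta>" using const[of \<delta> 1] \<delta> M W(1) U1 by simp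
  have WM: "W M = U M" using const[of 1 M] \<delta> M W(1) U1 by simp
  have left: "W \<delta> \<le> W y" if "y \<le> \<delta>" for y
  proof (rule DERIV_nonpos_imp_nonincreasing[OF that])
    fix z assume "z \<le> \<delta>"
    then have "clamp z = \<delta>" using \<delta> M by (simp add: clamp_def)
    then have "mm_weight z \<le> 0" using \<delta> by (simp add: mm_weight_def)
    then show "\<exists>l. (W has_real_derivative l) (at z) \<and> l \<le> 0" using W(2) by blast
  qed
  have right: "W M \<le> W y" if "M \<le> y" for y
  proof (rule DERIV_nonneg_imp_nondecreasing[OF that])
    fix z assume "M \<le> z"
    then have "clamp z = M" using \<delta> M by (simp add: clamp_def)
    then have "0 \<le> mm_weight z" using M by (simp add: mm_weight_def)
    then show "\<exists>l. (W has_real_derivative l) (at z) \<and> 0 \<le> l" using W(2) by blast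
  qed
  have "\<bar>W (1 + ap (w t) z)\<bar> \<le> energy (\<lambda>z. g z + ap (vel_z_int w t) z) (w t)"
    by (intro energy_controls_range[OF trajectory_ac[OF w g(1) t] _ W continuous_mm_weight mm_weight_le_pot]
        sq_int_add g(2) sq_int_ap)
  also have "\<dots> = energy g (w 0)" by (rule energy_constant[OF w g t])
  finally have b: "W (1 + ap (w t) z) \<le> energy g (w 0)" by simp
  show "\<delta> < 1 + ap (w t) z"
    using left[of "1 + ap (w t) z"] b E(1) W\<delta> by (fastforce simp: U_def not_le[symmetric])
  show "1 + ap (w t) z < M"
    using right[of "1 + ap (w t) z"] b E(2) WM by (fastforce simp: U_def not_le[symmetric])
qed

end

lemma ex_truncation_levels:
  fixes E c :: real
  assumes "E \<ge> 0" "c > 0"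
  shows "\<exists>\<delta> M. 0 < \<delta> \<and> \<delta> < 1 \<and> \<delta> \<le> c \<and> 1 < M \<and> E < (\<delta> - 1 - ln \<delta>) / 2 \<and> E < (M - 1 - ln M) / 2"
proof -
  \<comment> \<open>Then \<open>- ln \<delta>\<close> is at least \<open>2 * E + 2\<close>, and half
    of \<open>\<delta> - 1 - ln \<delta>\<close> exceeds \<open>E\<close>; the minimum with
    \<open>c\<close> keeps \<open>pot_upper\<close> applicable.\<close>
  define \<delta> where "\<delta> = min c (exp (- (2 * E + 2)))"
  have \<delta>: "0 < \<delta>" "\<delta> \<le> c" "\<delta> \<le> exp (- (2 * E + 2))" using assms by (auto simp: \<delta>_def)
  have "ln \<delta> \<le> ln (exp (- (2 * E + 2)))" using \<delta> by (subst ln_le_cancel_iff) auto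
  then have 1: "E < (\<delta> - 1 - ln \<delta>) / 2" using \<delta>(1) by simp
  have "exp (- (2 * E + 2)) < exp 0" using assms by (subst exp_less_cancel_iff) auto
  then have 2: "\<delta> < 1" using \<delta>(3) unfolding exp_zero by linarith
  \<comment> \<open>The upper level is \<open>s^2\<close>: from
    \<open>ln (s^2) = 2 ln s \<le> 2 (s - 1)\<close> one gets
    \<open>s^2 - 1 - ln (s^2) \<ge> (s - 1)^2\<close>, and \<open>s - 1 = 2 E + 1\<close> is at
    least 1.\<close>
  define s where "s = 2 * E + 2"
  have s: "s > 1" using assms by (simp add: s_def)
  have "ln (s\<^sup>2) = 2 * ln s" using s by (simp add: ln_realpow)
  also have "\<dots> \<le> 2 * (s - 1)" using ln_le_minus_one[of s] s by simp
  finally have "(s - 1)\<^sup>2 \<le> s\<^sup>2 - 1 - ln (s\<^sup>2)" by (simp add: power2_diff)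
  moreover have "(s - 1)\<^sup>2 > 2 * E"
  proof -
    have "2 * E < s - 1" by (simp add: s_def)
    also have "s - 1 \<le> (s - 1)\<^sup>2" using assms by (intro self_le_power) (auto simp: s_def)
    finally show ?thesis .
  qed
  ultimately have 3: "E < (s\<^sup>2 - 1 - ln (s\<^sup>2)) / 2" by simp
  have "1 < s\<^sup>2" using s by (simp add: one_less_power)
  then show ?thesis using \<delta> 1 2 3 by blast
qed

section \<open>From convergence in the phase space to convergence in the H1 norm\<close>

lemma H1_norm_ap_le:
  assumes "ac (ap f) (ap g)" "h \<in> borel_measurable lebesgue" "AE x in lebesgue. h x = ap f x"
  shows "h \<in> H1" "H1_norm h \<le> norm f + norm g"
proof -
  note H = H1_I[OF assms(1) sq_int_ap sq_int_ap assms(2,3)]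
  show "h \<in> H1" by (rule H(1))
  have "sqrt ((l2 (ap f))\<^sup>2 + (l2 (ap g))\<^sup>2) \<le> l2 (ap f) + l2 (ap g)"
    by (rule sqrt_sum_squares_le_sum) auto
  also have "\<dots> \<le> norm f + norm g" by (intro add_mono l2_ap_le)
  finally show "H1_norm h \<le> norm f + norm g" unfolding H(4) .
qed

lemma ap_lebesgue_measurable: "ap f \<in> borel_measurable lebesgue"
  by (intro measurable_completion) simp

lemma H1_norm_nonneg: "H1_norm f \<ge> 0"
  by (simp add: H1_norm_def)

lemma H1_norm_tendsto_0:
  assumes "\<And>s. ac (ap (f s)) (ap (g s))" "\<And>s. h s \<in> borel_measurable lebesgue"
    "\<And>s. AE x in lebesgue. h s x = ap (f s) x"
    and "((\<lambda>s. norm (f s)) \<longlongrightarrow> 0) F" "((\<lambda>s. norm (g s)) \<longlongrightarrow> 0) F"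
  shows "((\<lambda>s. H1_norm (h s)) \<longlongrightarrow> 0) F"
proof (rule Lim_null_comparison)
  show "\<forall>\<^sub>F s in F. norm (H1_norm (h s)) \<le> norm (f s) + norm (g s)"
    using H1_norm_ap_le(2)[OF assms(1-3)] H1_norm_nonneg by simp
  show "((\<lambda>s. norm (f s) + norm (g s)) \<longlongrightarrow> 0) F"
    using tendsto_add[OF assms(4,5)] by simp
qed

lemma ac_ap_diff: "ac (ap f) (ap f') \<Longrightarrow> ac (ap g) (ap g') \<Longrightarrow> ac (ap (f - g)) (ap (f' - g'))"
  using ac_diff[of "ap f" "ap f'" "ap g" "ap g'"] by (simp add: ap_simps(2)[abs_def])

lemma ac_ap_scaleR: "ac (ap f) (ap f') \<Longrightarrow> ac (ap (c *\<^sub>R f)) (ap (c *\<^sub>R f'))"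
  using ac_scale[of "ap f" "ap f'" c] by (simp add: ap_simps(5)[abs_def])

lemma ac_ap_add: "ac (ap f) (ap f') \<Longrightarrow> ac (ap g) (ap g') \<Longrightarrow> ac (ap (f + g)) (ap (f' + g'))"
  using ac_add[of "ap f" "ap f'" "ap g" "ap g'"] by (simp add: ap_simps(1)[abs_def])

lemma ac_ap_sum:
  assumes "\<And>i. ac (ap (f i)) (ap (g i))"
  shows "ac (ap (\<Sum>i\<in>A. f i)) (ap (\<Sum>i\<in>A. g i))"
proof (induction A rule: infinite_finite_induct)
  case (insert x A)
  show ?case unfolding sum.insert[OF insert.hyps] by (rule ac_ap_add[OF assms insert.IH])
qed (use ac_const[of 0] in \<open>simp_all add: ap_simps(4)[abs_def]\<close>)

lemma ap_sum: "ap (\<Sum>i\<in>A. f i) x = (\<Sum>i\<in>A. ap (f i) x)"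
  by (induction A rule: infinite_finite_induct) simp_all

lemma difference_quotient_norm_tendsto_0:
  assumes "(f has_vector_derivative d) (at t within S)"
  shows "((\<lambda>s. norm ((1 / (s - t)) *\<^sub>R (f s - f t) - d)) \<longlongrightarrow> 0) (at t within S)"
proof -
  have "((\<lambda>s. norm ((f s - f t) - (s - t) *\<^sub>R d) / norm (s - t)) \<longlongrightarrow> 0) (at t within S)"
    using assms by (simp add: has_vector_derivative_def has_derivative_iff_norm)
  moreover have "\<forall>\<^sub>F s in at t within S. norm ((f s - f t) - (s - t) *\<^sub>R d) / norm (s - t)
      = norm ((1 / (s - t)) *\<^sub>R (f s - f t) - d)"
    unfolding eventually_at_filter
  proof (intro always_eventually allI impI)
    fix s assume "s \<noteq> t"
    then have "(1 / (s - t)) *\<^sub>R (f s - f t) - d = (1 / (s - t)) *\<^sub>R ((f s - f t) - (s - t) *\<^sub>R d)"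
      by (simp add: scaleR_diff_right)
    then show "norm ((f s - f t) - (s - t) *\<^sub>R d) / norm (s - t)
        = norm ((1 / (s - t)) *\<^sub>R (f s - f t) - d)" by simp
  qed
  ultimately show ?thesis by (rule Lim_transform_eventually)
qed

context coefficient
begin

lemma vel_ac: "ac (ap (vel w)) (ap (vel_z w))"
  by (rule ac_C1[OF vel_has_deriv continuous_ap])

lemma trajectory_diff_ac:
  assumes w: "trajectory w" and g: "ac (ap (w 0)) g" and s: "s \<ge> 0" and t: "t \<ge> 0"
  shows "ac (ap (w s - w t)) (ap (vel_z_int w s - vel_z_int w t))"
  using ac_diff[OF trajectory_ac[OF w g s] trajectory_ac[OF w g t]]
  by (simp add: ap_simps(2)[abs_def])

lemma trajectory_C1_H1:
  assumes w: "trajectory w" and g: "ac (ap (w 0)) g" "sq_int g"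
  shows "C1_H1_on {0..} (\<lambda>t. ap (w t))"
  unfolding C1_H1_on_def
proof (intro conjI ballI exI[of _ "\<lambda>t. ap (vel (w t))"])
  fix t :: real assume "t \<in> {0..}"
  then have t: "t \<ge> 0" by simp
  show "ap (w t) \<in> H1"
    by (rule H1_I(1)[OF trajectory_ac[OF w g(1) t] sq_int_ap _ ap_lebesgue_measurable AE_I2])
       (intro sq_int_add g(2) sq_int_ap, simp)
  \<comment> \<open>\<open>H1_norm_tendsto_0\<close> asks for absolute continuity at every index,
    while trajectories are controlled at nonnegative times only; hence the default value 0.\<close>
  define f where "f s = (if s \<ge> 0 then (1 / (s - t)) *\<^sub>R (w s - w t) - vel (w t) else 0)" for s
  define h where "h s = (if s \<ge> 0 then (1 / (s - t)) *\<^sub>R (vel_z_int w s - vel_z_int w t) - vel_z (w t) else 0)"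
    for s
  have "ac (ap (f s)) (ap (h s))" for s
  proof (cases "s \<ge> 0")
    case True
    then show ?thesis unfolding f_def h_def
      using ac_ap_diff[OF ac_ap_scaleR[OF trajectory_diff_ac[OF w g(1) True t]] vel_ac] by simp
  next
    case False
    then show ?thesis using ac_const[of 0] by (simp add: f_def h_def ap_simps(4)[abs_def])
  qed
  moreover have ev: "\<forall>\<^sub>F s in at t within {0..}. s \<ge> 0"
    by (auto simp: eventually_at_filter)
  have "((\<lambda>s. norm (f s)) \<longlongrightarrow> 0) (at t within {0..})"
    by (rule Lim_transform_eventually[OF difference_quotient_norm_tendsto_0[of w "vel (w t)"]])
       (use w t ev in \<open>auto simp: trajectory_def f_def elim!: eventually_mono\<close>)
  moreover have "((\<lambda>s. norm (h s)) \<longlongrightarrow> 0) (at t within {0..})"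
    by (rule Lim_transform_eventually[OF difference_quotient_norm_tendsto_0[OF vel_z_int_deriv[OF w t]]])
       (use ev in \<open>auto simp: h_def elim!: eventually_mono\<close>)
  ultimately have "((\<lambda>s. H1_norm (ap (f s))) \<longlongrightarrow> 0) (at t within {0..})"
    by (intro H1_norm_tendsto_0[of f h]) (auto simp: ap_lebesgue_measurable)
  moreover have "\<forall>\<^sub>F s in at t within {0..}. H1_norm (ap (f s))
      = H1_norm (\<lambda>z. (ap (w s) z - ap (w t) z) / (s - t) - ap (vel (w t)) z)"
    using ev
  proof eventually_elim
    case (elim s)
    then have "ap (f s) = (\<lambda>z. (ap (w s) z - ap (w t) z) / (s - t) - ap (vel (w t)) z)"
      by (intro ext) (simp add: f_def)
    then show ?case by simp
  qed
  ultimately show "((\<lambda>s. H1_norm (\<lambda>z. (ap (w s) z - ap (w t) z) / (s - t) - ap (vel (w t)) z)) \<longlongrightarrow> 0)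
      (at t within {0..})" by (rule Lim_transform_eventually)
next
  show "H1_continuous_on {0..} (\<lambda>t. ap (vel (w t)))"
    unfolding H1_continuous_on_def
  proof (intro conjI ballI)
    fix t :: real assume t: "t \<in> {0..}"
    show "ap (vel (w t)) \<in> H1"
      by (rule H1_norm_ap_le(1)[OF vel_ac ap_lebesgue_measurable AE_I2]) simp
    have wc: "(w \<longlongrightarrow> w t) (at t within {0..})"
      using trajectory_continuous[OF w] t by (simp add: continuous_on_def)
    have "((\<lambda>s. vel (w s)) \<longlongrightarrow> vel (w t)) (at t within {0..})"
      "((\<lambda>s. vel_z (w s)) \<longlongrightarrow> vel_z (w t)) (at t within {0..})"
      using isCont_tendsto_compose[OF _ wc] continuous_vel continuous_vel_z
      by (auto simp: continuous_on_eq_continuous_at)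
    then have "((\<lambda>s. norm (vel (w s) - vel (w t))) \<longlongrightarrow> 0) (at t within {0..})"
      "((\<lambda>s. norm (vel_z (w s) - vel_z (w t))) \<longlongrightarrow> 0) (at t within {0..})"
      by (auto intro!: tendsto_norm_zero simp: LIM_zero_iff)
    then show "((\<lambda>s. H1_norm (\<lambda>z. ap (vel (w s)) z - ap (vel (w t)) z)) \<longlongrightarrow> 0) (at t within {0..})"
      by (intro H1_norm_tendsto_0[of "\<lambda>s. vel (w s) - vel (w t)" "\<lambda>s. vel_z (w s) - vel_z (w t)"])
         (auto intro!: ac_ap_diff vel_ac borel_measurable_diff ap_lebesgue_measurable)
  qed
qed

text \<open>The Riemann sums of \<open>vel_z\<close> are the space derivatives of those of
  \<open>vel\<close>, and both converge in \<open>cl2\<close> along the same filter, which amounts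
  to convergence in the H1 norm. \<open>I\<close> is given almost everywhere only, because the data
  may be any representative.\<close>

lemma trajectory_H1_integral:
  assumes w: "trajectory w" and g: "ac (ap (w 0)) g" and t: "t \<ge> 0"
    and I: "I \<in> borel_measurable lebesgue" "AE z in lebesgue. I z = ap (w t - w 0) z"
  shows "has_H1_integral (\<lambda>s. ap (vel (w s))) I 0 t"
  unfolding has_H1_integral_def
proof (intro conjI ballI)
  show "ap (vel (w s)) \<in> H1" for s
    by (rule H1_norm_ap_le(1)[OF vel_ac ap_lebesgue_measurable AE_I2]) simp
  have z0: "vel_z_int w 0 = 0" by (simp add: vel_z_int_def)
  have ac: "ac (ap (w t - w 0)) (ap (vel_z_int w t))"
    using trajectory_diff_ac[OF w g t, of 0] by (simp add: z0)
  show "I \<in> H1" by (rule H1_norm_ap_le(1)[OF ac I])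
  have "((\<lambda>s. vel (w s)) has_integral w t - w 0) {0..t}"
  proof (rule fundamental_theorem_of_calculus[OF t])
    fix s assume "s \<in> {0..t}"
    then show "(w has_vector_derivative vel (w s)) (at s within {0..t})"
      using w by (auto simp: trajectory_def intro: has_vector_derivative_within_subset[of _ _ _ "{0..}"])
  qed
  then have 1: "((\<lambda>p. \<Sum>(s,K)\<in>p. measure lborel K *\<^sub>R vel (w s)) \<longlongrightarrow> w t - w 0) (division_filter (cbox 0 t))"
    unfolding cbox_interval[symmetric] has_integral_cbox .
  have "((\<lambda>s. vel_z (w s)) has_integral vel_z_int w t) {0..t}"
    unfolding vel_z_int_def
    by (intro integrable_integral integrable_continuous_real continuous_on_along w)
  then have 2: "((\<lambda>p. \<Sum>(s,K)\<in>p. measure lborel K *\<^sub>R vel_z (w s)) \<longlongrightarrow> vel_z_int w t) (division_filter (cbox 0 t))"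
    unfolding cbox_interval[symmetric] has_integral_cbox .
  define f where "f p = (\<Sum>(s,K)\<in>p. measure lborel K *\<^sub>R vel (w s)) - (w t - w 0)"
    for p :: "(real \<times> real set) set"
  define h where "h p = (\<Sum>(s,K)\<in>p. measure lborel K *\<^sub>R vel_z (w s)) - vel_z_int w t"
    for p :: "(real \<times> real set) set"
  have apf: "ap (f p) z = (\<Sum>(s,K)\<in>p. measure lborel K * ap (vel (w s)) z) - ap (w t - w 0) z" for p z
    unfolding f_def ap_simps(2)[of "sum _ _"] ap_sum by (simp add: case_prod_beta)
  show "((\<lambda>p. H1_norm (\<lambda>z. (\<Sum>(s,K)\<in>p. measure lborel K * ap (vel (w s)) z) - I z)) \<longlongrightarrow> 0)
      (division_filter (cbox 0 t))"
  proof (rule H1_norm_tendsto_0[of f h])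
    show "ac (ap (f p)) (ap (h p))" for p
      unfolding f_def h_def case_prod_beta
      by (intro ac_ap_diff ac ac_ap_sum ac_ap_scaleR vel_ac)
    show "AE z in lebesgue. (\<Sum>(s,K)\<in>p. measure lborel K * ap (vel (w s)) z) - I z = ap (f p) z" for p
      using I(2) by eventually_elim (simp only: apf)
    have "(\<lambda>z. (\<Sum>(s,K)\<in>p. measure lborel K * ap (vel (w s)) z) - I z) = (\<lambda>z. ap (f p) z + ap (w t - w 0) z - I z)"
      for p by (simp add: apf)
    then show "(\<lambda>z. (\<Sum>(s,K)\<in>p. measure lborel K * ap (vel (w s)) z) - I z) \<in> borel_measurable lebesgue"
      for p :: "(real \<times> real set) set"
      by (simp only:) (intro borel_measurable_diff borel_measurable_add ap_lebesgue_measurable I(1))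
    show "((\<lambda>p. norm (f p)) \<longlongrightarrow> 0) (division_filter (cbox 0 t))"
      unfolding f_def by (intro tendsto_norm_zero) (use 1 in \<open>simp add: LIM_zero_iff\<close>)
    show "((\<lambda>p. norm (h p)) \<longlongrightarrow> 0) (division_filter (cbox 0 t))"
      unfolding h_def by (intro tendsto_norm_zero) (use 2 in \<open>simp add: LIM_zero_iff\<close>)
  qed
qed

end

theorem corollary5p8:
  fixes n :: real and \<phi>0 :: "real \<Rightarrow> real"
  assumes "4 \<le> n" and "n < 6"
    and "(\<lambda>z. \<phi>0 z - 1) \<in> H1"
    and "esssup lebesgue (\<lambda>z. 1 / ennreal \<bar>\<phi>0 z\<bar>) < \<infinity>"
  shows "\<exists>\<phi>. global_solution n \<phi>0 \<phi> \<and> (AE z in lebesgue. \<phi> 0 z = \<phi>0 z)"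
proof -
  obtain w0 g c0 where w0: "ac (ap w0) g" "sq_int g" "AE z in lebesgue. \<phi>0 z - 1 = ap w0 z"
    "0 < c0" "\<And>z. c0 \<le> 1 + ap w0 z"
    using positive_representative[OF assms(3,4)] by blast
  \<comment> \<open>\<open>pot_upper\<close> expands around the rest state 1, hence needs
    \<open>c \<le> 1\<close>.\<close>
  define c where "c = min c0 1"
  have c: "0 < c" "c \<le> 1" "\<And>z. c \<le> 1 + ap w0 z"
    using w0(4,5) by (auto simp: c_def intro: min.coboundedI1)
  \<comment> \<open>A bound of the initial energy by the data alone, fixed before the levels that
    depend on it.\<close>
  define E where "E = (l2 g)\<^sup>2 / 2 + c powr (- n) * (l2 (ap w0))\<^sup>2"
  have "E \<ge> 0" by (simp add: E_def)
  then obtain \<delta> M where lev: "0 < \<delta>" "\<delta> < 1" "\<delta> \<le> c" "1 < M"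
    "E < (\<delta> - 1 - ln \<delta>) / 2" "E < (M - 1 - ln M) / 2"
    using ex_truncation_levels[OF _ c(1)] by blast
  interpret truncation n \<delta> M
    by unfold_locales (use assms lev in auto)
  obtain w where w: "w 0 = w0" "trajectory w" using ex_trajectory by blast
  have g: "ac (ap (w 0)) g" using w0(1) w(1) by simp
  have "energy g (w 0) \<le> E"
  proof -
    have "(LBINT x. pot (1 + ap w0 x)) \<le> (LBINT x. c powr (- n) * (ap w0 x)\<^sup>2)"
      using pot_upper[OF lev(3) c(2) c(3)]
      by (intro integral_mono integrable_pot) (auto simp: sq_int_integrable)
    then show ?thesis unfolding energy_def E_def l2_sq w(1) by simp
  qed
  then have range: "\<delta> < 1 + ap (w t) z" "1 + ap (w t) z < M" if "t \<ge> 0" for t z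
    using range_bound[OF w(2) g w0(2) that] lev(5,6) by auto
  define \<phi> where "\<phi> t z = 1 + ap (w t) z" for t z
  have \<phi>0m: "\<phi>0 \<in> borel_measurable lebesgue"
  proof -
    have "(\<lambda>z. (\<phi>0 z - 1) + 1) \<in> borel_measurable lebesgue"
      using assms(3) by (intro borel_measurable_add) (auto simp: H1_def L2_def)
    then show ?thesis by simp
  qed
  have pos: "continuous_on UNIV (\<phi> t) \<and> (\<forall>z. \<phi> t z > 0)" if "t \<ge> 0" for t
  proof
    show "continuous_on UNIV (\<phi> t)" unfolding \<phi>_def by (intro continuous_intros continuous_ap)
    show "\<forall>z. \<phi> t z > 0" using range(1)[OF that] lev(1) by (auto simp: \<phi>_def intro: less_trans)
  qed
  have C1: "C1_H1_on {0..} (\<lambda>t z. \<phi> t z - 1)"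
    using trajectory_C1_H1[OF w(2) g w0(2)] by (simp add: \<phi>_def)
  have weak: "unique_weak_solution n (\<phi> s) (ap (vel (w s)))" if s: "s \<ge> 0" for s
  proof (rule flux_potential_unique_weak_solution[where b = "coef (w s)"])
    \<comment> \<open>The range bounds make \<open>clamp\<close> the identity along the trajectory,
      so the truncated coefficient coincides with the true one.\<close>
    show "\<phi> s x powr n = 1 / coef (w s) x" for x
    proof -
      have "coef (w s) x = \<phi> s x powr (- n)"
        using range[OF s, of x] by (simp add: coef_def trunc_def clamp_id \<phi>_def)
      then show ?thesis using range(1)[OF s, of x] lev(1) by (simp add: powr_minus_divide)
    qed
    show "ac (ap (sol (w s))) (ap (vel (w s)))" by (rule ac_C1[OF sol_has_deriv continuous_ap])
  qed (use continuous_coef coef_bounds vel_ac ap_vel_z B1 in blast)+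
  have integral: "has_H1_integral (\<lambda>s. ap (vel (w s))) (\<lambda>z. \<phi> t z - \<phi>0 z) 0 t" if t: "t \<ge> 0" for t
  proof (rule trajectory_H1_integral[OF w(2) g t])
    show "(\<lambda>z. \<phi> t z - \<phi>0 z) \<in> borel_measurable lebesgue"
      unfolding \<phi>_def
      by (intro borel_measurable_diff borel_measurable_add ap_lebesgue_measurable \<phi>0m borel_measurable_const)
    show "AE z in lebesgue. \<phi> t z - \<phi>0 z = ap (w t - w 0) z"
      using w0(3) by eventually_elim (simp add: \<phi>_def w(1))
  qed
  have "global_solution n \<phi>0 \<phi>"
    unfolding global_solution_def
  proof (intro conjI exI[of _ "\<lambda>s. ap (vel (w s))"])
    show "\<forall>t\<ge>0. continuous_on UNIV (\<phi> t) \<and> (\<forall>z. \<phi> t z > 0)" using pos by simp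
    show "C1_H1_on {0..} (\<lambda>t z. \<phi> t z - 1)" by (rule C1)
    show "\<forall>s\<ge>0. unique_weak_solution n (\<phi> s) (ap (vel (w s)))" using weak by simp
    show "\<forall>t\<ge>0. has_H1_integral (\<lambda>s. ap (vel (w s))) (\<lambda>z. \<phi> t z - \<phi>0 z) 0 t"
      using integral by simp
  qed
  moreover have "AE z in lebesgue. \<phi> 0 z = \<phi>0 z"
    using w0(3) by eventually_elim (simp add: \<phi>_def w(1))
  ultimately show ?thesis by blast
qed

end
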